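(* There exists a constant $c>0$ such that for every integer $k \geq 1$ there exists an undirected graph $G$ of pathwidth at most $k$ with at most $k^{c}$ vertices such that every tropical circuit calculating $TSP_G$ has at least $2^{\Omega(k \log\log k)}$ gates (nodes).
   Context: For an undirected graph $G$ on $N$ vertices, associate a variable $x_{u,v}=x_{v,u}$ with every edge $uv\in E(G)$. Let $\mathcal{H}(G)$ be the family of sequences $(u_0,\dots,u_N)$ of vertices with $u_0=u_N$ such that $u_0, u_1,\dots,u_N$ traverses a Hamiltonian cycle of $G$ (consecutive vertices adjacent, $u_0,\dots,u_{N-1}$ distinct). $TSP_G$ is the tropical $(\max,+)$ polynomial $\sum_{(u_i)\in\mathcal{H}(G)}\prod_{i\in[N]} x_{u_{i-1},u_i}$; on a valuation $\nu$ (assignment of reals to the variables) it evaluates to $\max_{(u_i)\in\mathcal{H}(G)}\sum_{i\in[N]}\nu(x_{u_{i-1},u_i})$. A tropical circuit is a directed acyclic graph whose nodes have in-degree $0$ or $2$; in-degree-$0$ nodes are labeled by a variable or by the constant $0$; in-degree-$2$ nodes are labeled by $+$ or $\max$; one node is the output. On a valuation, input nodes evaluate to the variable's value, constant nodes to $0$, and $+$/$\max$ nodes to the sum/maximum of their two predecessors' values; the circuit's value is the output node's value. A circuit calculates a polynomial $p$ if its value equals $p(\nu)$ for every valuation $\nu$; its size is its number of nodes. The pathwidth of $G$ is the minimum over sequences of bags $\beta_1,\dots,\beta_\ell\subseteq V(G)$ (each edge inside some bag, bags containing any given vertex contiguous) of $\max_i|\beta_i|-1$. *)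

theory Defs
  imports Complex_Main "HOL-Library.Landau_Symbols"
begin

definition ugraph :: "'a set \<Rightarrow> 'a set set \<Rightarrow> bool" where
  "ugraph V E \<longleftrightarrow> finite V \<and> (\<forall>e\<in>E. e \<subseteq> V \<and> card e = 2)"

definition path_decomposition :: "'a set \<Rightarrow> 'a set set \<Rightarrow> 'a set list \<Rightarrow> bool" where
  "path_decomposition V E bs \<longleftrightarrow>
     bs \<noteq> [] \<and> \<Union>(set bs) = V \<and>
     (\<forall>e\<in>E. \<exists>b\<in>set bs. e \<subseteq> b) \<and>
     (\<forall>v i j l. i \<le> j \<and> j \<le> l \<and> l < length bs \<and> v \<in> bs ! i \<and> v \<in> bs ! l \<longrightarrow> v \<in> bs ! j)"

text \<open>Bags are subsets of the finite set \<open>V\<close>, so only finitely many widths occur and the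
  minimum below exists, even though there are infinitely many decompositions.  Integers avoid
  truncated subtraction (the empty graph has pathwidth \<open>-1\<close>).\<close>

definition pathwidth :: "'a set \<Rightarrow> 'a set set \<Rightarrow> int" where
  "pathwidth V E = Min {int (Max (card ` set bs)) - 1 | bs. path_decomposition V E bs}"

definition ham_tours :: "'a set \<Rightarrow> 'a set set \<Rightarrow> 'a list set" where
  "ham_tours V E = {us. length us = card V + 1 \<and> set us \<subseteq> V \<and> us ! 0 = us ! card V \<and>
     distinct (take (card V) us) \<and> (\<forall>i\<in>{1..card V}. {us ! (i - 1), us ! i} \<in> E)}"

text \<open>The variable \<open>x\<^sub>u\<^sub>v = x\<^sub>v\<^sub>u\<close> is represented by the edge \<open>{u, v}\<close> itself.
  The value is meaningful only if there is a tour; otherwise the polynomial is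
  the empty tropical sum, i.e. minus infinity.\<close>

definition TSP :: "'a set \<Rightarrow> 'a set set \<Rightarrow> ('a set \<Rightarrow> real) \<Rightarrow> real" where
  "TSP V E \<nu> = Max ((\<lambda>us. \<Sum>i\<in>{1..card V}. \<nu> {us ! (i - 1), us ! i}) ` ham_tours V E)"

datatype ('x, 'n) gate = Var 'x | Zero | Plus 'n 'n | MaxG 'n 'n

fun preds :: "('x, 'n) gate \<Rightarrow> 'n set" where
  "preds (Var x) = {}"
| "preds Zero = {}"
| "preds (Plus a b) = {a, b}"
| "preds (MaxG a b) = {a, b}"

record ('x, 'n) circuit =
  nodes :: "'n set"
  gate_of :: "'n \<Rightarrow> ('x, 'n) gate"
  out :: 'n

text \<open>The two incoming wires of a gate may come from the same node (parallel wires).\<close>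

definition tropical_circuit :: "'x set \<Rightarrow> ('x, 'n) circuit \<Rightarrow> bool" where
  "tropical_circuit X C \<longleftrightarrow>
     finite (nodes C) \<and> out C \<in> nodes C \<and>
     (\<forall>n\<in>nodes C. preds (gate_of C n) \<subseteq> nodes C) \<and>
     (\<forall>n\<in>nodes C. \<forall>x. gate_of C n = Var x \<longrightarrow> x \<in> X) \<and>
     acyclic {(p, n). n \<in> nodes C \<and> p \<in> preds (gate_of C n)}"

inductive node_value :: "('x, 'n) circuit \<Rightarrow> ('x \<Rightarrow> real) \<Rightarrow> 'n \<Rightarrow> real \<Rightarrow> bool"
  for C :: "('x, 'n) circuit" and \<nu> :: "'x \<Rightarrow> real" where
  "gate_of C n = Var x \<Longrightarrow> node_value C \<nu> n (\<nu> x)"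
| "gate_of C n = Zero \<Longrightarrow> node_value C \<nu> n 0"
| "gate_of C n = Plus a b \<Longrightarrow> node_value C \<nu> a r \<Longrightarrow> node_value C \<nu> b s
     \<Longrightarrow> node_value C \<nu> n (r + s)"
| "gate_of C n = MaxG a b \<Longrightarrow> node_value C \<nu> a r \<Longrightarrow> node_value C \<nu> b s
     \<Longrightarrow> node_value C \<nu> n (max r s)"

lemma node_value_unique: "node_value C \<nu> n r \<Longrightarrow> node_value C \<nu> n s \<Longrightarrow> s = r"
proof (induction arbitrary: s rule: node_value.induct)
  case (1 n x)
  from 1(2) show ?case by cases (use 1(1) in auto)
next
  case (2 n)
  from 2(2) show ?case by cases (use 2(1) in auto)
next
  case (3 n a b r s')
  from 3(6) show ?case by cases (use 3(1,4,5) in auto)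
next
  case (4 n a b r s')
  from 4(6) show ?case by cases (use 4(1,4,5) in auto)
qed

lemma node_value_exists:
  assumes C: "tropical_circuit X C" and n: "n \<in> nodes C"
  shows "\<exists>r. node_value C \<nu> n r"
proof -
  let ?R = "{(p, n). n \<in> nodes C \<and> p \<in> preds (gate_of C n)}"
  have "?R \<subseteq> nodes C \<times> nodes C"
    using C by (auto simp: tropical_circuit_def)
  then have "finite ?R"
    using C by (meson finite_SigmaI finite_subset tropical_circuit_def)
  then have "wf ?R"
    using C by (simp add: finite_acyclic_wf tropical_circuit_def)
  then show ?thesis using n
  proof (induction n)
    case (less n)
    have p: "\<exists>r. node_value C \<nu> p r" if "p \<in> preds (gate_of C n)" for p
      using less that C by (auto simp: tropical_circuit_def)
    show ?case
    proof (cases "gate_of C n")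
      case (Plus a b)
      then show ?thesis using p[of a] p[of b] node_value.intros(3) by fastforce
    next
      case (MaxG a b)
      then show ?thesis using p[of a] p[of b] node_value.intros(4) by fastforce
    qed (use node_value.intros(1,2) in metis)+
  qed
qed

text \<open>Circuits take real values only, so none calculates the polynomial of a graph without
  a Hamiltonian cycle, whose value is minus infinity.\<close>

definition calculates_TSP :: "('a set, 'n) circuit \<Rightarrow> 'a set \<Rightarrow> 'a set set \<Rightarrow> bool" where
  "calculates_TSP C V E \<longleftrightarrow>
     ham_tours V E \<noteq> {} \<and> (\<forall>\<nu>. node_value C \<nu> (out C) (TSP V E \<nu>))"

end

theory Submission
  imports Defs "HOL-Combinatorics.Permutations" "HOL-Real_Asymp.Real_Asymp"
    "Jordan_Normal_Form.Spectral_Radius"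
begin

text \<open>
  Since circuit and polynomial agree on all real valuations, the formal monomials of the circuit are
  exactly the Hamiltonian cycles.  Descending in a parse tree to a gate of balanced weight covers them by
  one rectangle per gate, every element of which is again a Hamiltonian cycle.  The graph is a cylinder
  of polynomially many columns of \<open>n\<close> cells with complete bipartite graphs between consecutive columns, so that
  the cycles contain all tuples of permutations with a prescribed cyclic product.  In a rectangle each
  step between columns is owned by one side; a column with mixed ownership halves the rectangle, so
  a large rectangle has one column owned entirely by each side.  This leaves two families \<open>A\<close>, \<open>B\<close> of
  permutations of \<open>n\<close> points such that every \<open>b \<circ> a\<close> is an \<open>n\<close>-cycle.

  Such families cannot both have density \<open>Q ^ (-n)\<close> with \<open>Q = (ln n) powr (1/6)\<close>, whence the
  factor \<open>log log k\<close>.  Let \<open>K\<close> count the two-step connections \<open>u \<rightarrow> a u \<rightarrow> b (a u)\<close> through edges that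
  occur in some \<open>a \<in> A\<close> and some \<open>b \<in> B\<close>.  Iterating \<open>\<Prod>\<^sub>u \<Sum>\<^sub>w g w \<ge> |A| \<Prod>\<^sub>w g w\<close> shows that \<open>K\<close> has
  spectral radius of order \<open>n\<^sup>2 / Q\<^sup>2\<close>.  As its Frobenius norm is at most \<open>n\<^sup>2\<close>, a Fejer kernel argument gives
  some \<open>t\<close> polynomial in \<open>Q\<close> with \<open>tr (K ^ t) \<ge> n powr (2 * t - o(1))\<close>, so there are many closed walks.  Replacing \<open>A\<close> and
  \<open>B\<close> by subsets that maximise \<open>ln |A| - |supp A| / n\<close> makes almost every list of \<open>t\<close> support edges
  simultaneously realisable, and some closed walk becomes a cycle of length \<open>t < n\<close> of some \<open>b \<circ> a\<close>.
\<close>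

section \<open>Traces of powers of nonnegative matrices\<close>

text \<open>Two pressures fix the walk length \<open>t\<close>. The matrix \<open>K\<close> need not
  be symmetric, so eigenvalues of equal modulus may cancel in a single trace; averaging over
  exponents with Fejer weights excludes this for some \<open>t\<close>, within a range that does not
  grow with the number of eigenvalues but only with the squared Frobenius norm over the squared
  spectral radius, which is of order \<open>Q ^ 4\<close>. On the other side, edge lists of length
  \<open>t\<close> that no map contains number at most \<open>n ^ (2 * t - 1)\<close> up to factors
  in \<open>t\<close> and \<open>ln n\<close>, while the guaranteed number of closed walks is of
  order \<open>n ^ (2 * t) / D ^ t\<close> with \<open>D\<close> of order \<open>Q ^ 2\<close>. One
  factor \<open>n\<close> has to pay for \<open>D ^ t\<close>, and since \<open>t\<close> can be as
  large as order \<open>Q ^ 4\<close>, this confines \<open>Q\<close> to a power of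
  \<open>ln n\<close> below \<open>1/4\<close>. The cylinder needs so many columns because a mixed
  column only gains a factor \<open>2\<close>: a gain of \<open>Q ^ n\<close> takes
  \<open>n * log 2 Q\<close> of them, and these must still be less than a third of all
  columns.\<close>

text \<open>The right-hand side shows that the Fejer kernel is nonnegative on the whole closed unit disc,
  not only on the circle.\<close>

lemma fejer_identity:
  fixes z :: complex
  defines "G \<equiv> \<lambda>l. \<Sum>i<l. z ^ i"
  shows "real (Suc m) + 2 * (\<Sum>j=1..m. real (Suc m - j) * Re (z ^ j))
    = (cmod (G (Suc m)))\<^sup>2 + (1 - (cmod z)\<^sup>2) * (\<Sum>l=1..m. (cmod (G l))\<^sup>2)"
proof (induction m)
  case 0
  then show ?case by (simp add: G_def)
next
  case (Suc m)
  have G1: "G (Suc l) = 1 + z * G l" for l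
    unfolding G_def sum.lessThan_Suc_shift by (simp add: sum_distrib_left)
  have sq: "(cmod (1 + w))\<^sup>2 = 1 + 2 * Re w + (cmod w)\<^sup>2" for w
    unfolding cmod_power2 by (simp add: power2_eq_square algebra_simps)
  have "Re (z * G (Suc m)) = (\<Sum>j=1..Suc m. Re (z ^ j))"
    unfolding G_def sum_distrib_left Re_sum
    by (rule sum.reindex_bij_witness[of _ "\<lambda>j. j - 1" Suc]) (auto simp: power_Suc[symmetric] simp del: power_Suc)
  moreover have "(\<Sum>j=1..Suc m. real (Suc (Suc m) - j) * Re (z ^ j))
     = (\<Sum>j=1..m. real (Suc m - j) * Re (z ^ j)) + (\<Sum>j=1..Suc m. Re (z ^ j))"
  proof -
    have "(\<Sum>j=1..Suc m. real (Suc (Suc m) - j) * Re (z ^ j))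
      = (\<Sum>j=1..Suc m. real (Suc m - j) * Re (z ^ j) + Re (z ^ j))"
      by (rule sum.cong) (auto simp: of_nat_diff algebra_simps)
    then show ?thesis by (simp add: sum.distrib)
  qed
  moreover have "(cmod (G (Suc (Suc m))))\<^sup>2 = 1 + 2 * Re (z * G (Suc m)) + (cmod z)\<^sup>2 * (cmod (G (Suc m)))\<^sup>2"
    unfolding G1[of "Suc m"] sq by (simp add: norm_mult power_mult_distrib)
  ultimately show ?case
    using Suc by (simp add: algebra_simps)
qed

lemma fejer_nonneg:
  fixes z :: complex
  assumes "cmod z \<le> 1"
  shows "(\<Sum>j=1..m. real (Suc m - j) * Re (z ^ j)) \<ge> - real (Suc m) / 2"
proof -
  have "(cmod z)\<^sup>2 \<le> 1" using assms by (simp add: power_le_one)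
  then have "(1 - (cmod z)\<^sup>2) * (\<Sum>l=1..m. (cmod (\<Sum>i<l. z ^ i))\<^sup>2) \<ge> 0"
    by (intro mult_nonneg_nonneg sum_nonneg) auto
  then have "real (Suc m) + 2 * (\<Sum>j=1..m. real (Suc m - j) * Re (z ^ j)) \<ge> 0"
    unfolding fejer_identity by simp
  then show ?thesis by simp
qed

text \<open>Without the linear term the sum vanishes to second order at \<open>0\<close>, so its
  negative part is bounded by \<open>(cmod z)\<^sup>2\<close>, a quantity that Schur's inequality
  controls when summed over eigenvalues; the sum of the moduli would not be controlled. Near
  \<open>0\<close> a geometric series suffices. Elsewhere the Fejer bound and the omitted term lose
  at most \<open>3/2 * Suc m\<close>, which is where \<open>6 * (1/4)\<close> comes from.\<close>

lemma fejer_quadratic_lower: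
  fixes z :: complex
  assumes z: "cmod z \<le> 1"
  shows "(\<Sum>j=2..m. real (Suc m - j) * Re (z ^ j)) \<ge> - 6 * real (Suc m) * (cmod z)\<^sup>2"
proof (cases "cmod z \<le> 1/2")
  case True
  have "(\<Sum>j=2..m. real (Suc m - j) * Re (z ^ j)) \<ge> (\<Sum>j=2..m. - (real (Suc m) * ((cmod z)\<^sup>2 * (1/2) ^ (j - 2))))"
  proof (rule sum_mono)
    fix j assume j: "j \<in> {2..m}"
    have "\<bar>Re (z ^ j)\<bar> \<le> cmod z ^ j"
      using abs_Re_le_cmod[of "z ^ j"] by (simp add: norm_power)
    also have "cmod z ^ j = (cmod z)\<^sup>2 * cmod z ^ (j - 2)"
      using j by (metis atLeastAtMost_iff le_add_diff_inverse power_add)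
    also have "\<dots> \<le> (cmod z)\<^sup>2 * (1/2) ^ (j - 2)"
      using True by (intro mult_left_mono power_mono) auto
    finally have "\<bar>Re (z ^ j)\<bar> \<le> (cmod z)\<^sup>2 * (1/2) ^ (j - 2)" .
    then have "real (Suc m - j) * \<bar>Re (z ^ j)\<bar> \<le> real (Suc m) * ((cmod z)\<^sup>2 * (1/2) ^ (j - 2))"
      by (intro mult_mono) auto
    moreover have "real (Suc m - j) * Re (z ^ j) \<ge> - (real (Suc m - j) * \<bar>Re (z ^ j)\<bar>)"
      by (metis abs_ge_minus_self abs_mult abs_of_nat minus_le_iff)
    ultimately show "- (real (Suc m) * ((cmod z)\<^sup>2 * (1/2) ^ (j - 2))) \<le> real (Suc m - j) * Re (z ^ j)"
      by linarith
  qed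
  also have "(\<Sum>j=2..m. - (real (Suc m) * ((cmod z)\<^sup>2 * (1/2) ^ (j - 2))))
     = - (real (Suc m) * (cmod z)\<^sup>2 * (\<Sum>j=2..m. (1/2) ^ (j - 2)))"
    by (simp add: sum_negf sum_distrib_left mult.assoc)
  finally have 1: "(\<Sum>j=2..m. real (Suc m - j) * Re (z ^ j)) \<ge> - (real (Suc m) * (cmod z)\<^sup>2 * (\<Sum>j=2..m. (1/2) ^ (j - 2)))" .
  have "(\<Sum>j=2..m. (1/2::real) ^ (j - 2)) \<le> (\<Sum>i<m. (1/2) ^ i)"
    by (rule sum_le_included[where i="\<lambda>i. i + 2"]) (auto intro!: bexI[of _ "_ - 2"])
  also have "\<dots> \<le> 2"
    by (simp add: sum_gp_strict)
  finally have "real (Suc m) * (cmod z)\<^sup>2 * (\<Sum>j=2..m. (1/2) ^ (j - 2)) \<le> real (Suc m) * (cmod z)\<^sup>2 * 2"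
    by (intro mult_left_mono) auto
  moreover have "real (Suc m) * (cmod z)\<^sup>2 \<ge> 0" by simp
  ultimately show ?thesis using 1 by linarith
next
  case False
  have s: "(\<Sum>j=1..m. real (Suc m - j) * Re (z ^ j)) \<le> (\<Sum>j=2..m. real (Suc m - j) * Re (z ^ j)) + real (Suc m)"
  proof (cases "m = 0")
    case False
    then have "{1..m} = insert 1 {2..m}" by auto
    then have "(\<Sum>j=1..m. real (Suc m - j) * Re (z ^ j)) = real m * Re z + (\<Sum>j=2..m. real (Suc m - j) * Re (z ^ j))"
      by simp
    moreover have "Re z \<le> 1" using complex_Re_le_cmod[of z] z by linarith
    then have "real m * Re z \<le> real m" by (simp add: mult_left_le)
    ultimately show ?thesis by simp
  qed simp
  have "(1/2)\<^sup>2 \<le> (cmod z)\<^sup>2" using False by (intro power_mono) auto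
  then have "1 / 4 \<le> (cmod z)\<^sup>2" by (simp add: power2_eq_square)
  then have "real (Suc m) * (1 / 4) \<le> real (Suc m) * (cmod z)\<^sup>2"
    by (intro mult_left_mono) auto
  moreover have "- 6 * R * y \<le> b" if "R * (1 / 4) \<le> R * y" "a \<le> b + R" "- R / 2 \<le> a" for R y a b :: real
  proof -
    have "6 * R * y = 6 * (R * y)" by simp
    then show ?thesis using that by linarith
  qed
  ultimately show ?thesis using s fejer_nonneg[OF z, of m] by blast
qed

text \<open>Average the power sums with the weights \<open>Suc m - j\<close>. The entry
  \<open>1\<close> contributes the full weight \<open>S = m (m - 1) / 2\<close>, all other entries
  together at least \<open>- 6 * Suc m * q\<close>, so for \<open>m\<close> beyond a multiple of
  \<open>q\<close> not every power sum can stay below \<open>1/2\<close>. The length of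
  \<open>zs\<close> does not enter.\<close>

lemma power_sum_lower:
  fixes zs :: "complex list"
  assumes le1: "\<And>z. z \<in> set zs \<Longrightarrow> cmod z \<le> 1" and one: "1 \<in> set zs"
    and q: "(\<Sum>z\<leftarrow>zs. (cmod z)\<^sup>2) \<le> q" and m: "real m \<ge> 24 * q + 8"
  shows "\<exists>j\<in>{2..m}. cmod (\<Sum>z\<leftarrow>zs. z ^ j) \<ge> 1/2"
proof (rule ccontr)
  assume "\<not> ?thesis"
  then have small: "cmod (\<Sum>z\<leftarrow>zs. z ^ j) \<le> 1/2" if "j \<in> {2..m}" for j using that by force
  have q0: "q \<ge> 0" using q sum_list_nonneg[of "map (\<lambda>z. (cmod z)\<^sup>2) zs"] by (force intro: order_trans)
  define h where "h z = (\<Sum>j=2..m. real (Suc m - j) * Re (z ^ j))" for z :: complex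
  define S where "S = (\<Sum>j=2..m. real (Suc m - j))"
  \<comment> \<open>Only one occurrence of \<open>1\<close> is split off; further ones stay in the
    rest, where the lower bound holds for every entry.\<close>
  obtain xs ys where zs: "zs = xs @ 1 # ys" using one by (meson split_list)
  have low: "(\<Sum>z\<leftarrow>zs'. h z) \<ge> - 6 * real (Suc m) * (\<Sum>z\<leftarrow>zs'. (cmod z)\<^sup>2)"
    if "set zs' \<subseteq> set zs" for zs'
    using that
  proof (induction zs')
    case (Cons a zs')
    then show ?case using fejer_quadratic_lower[OF le1[of a], of m]
      by (simp add: h_def algebra_simps)
  qed simp
  have h1: "h 1 = S" by (simp add: h_def S_def)
  have "(\<Sum>z\<leftarrow>zs. h z) = S + (\<Sum>z\<leftarrow>xs @ ys. h z)"
    unfolding zs using h1 by simp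
  also have "\<dots> \<ge> S - 6 * real (Suc m) * (\<Sum>z\<leftarrow>xs@ys. (cmod z)\<^sup>2)"
  proof -
    have "set (xs @ ys) \<subseteq> set zs" using zs by auto
    from low[OF this] show ?thesis by linarith
  qed
  finally have "(\<Sum>z\<leftarrow>zs. h z) \<ge> S - 6 * real (Suc m) * (\<Sum>z\<leftarrow>xs@ys. (cmod z)\<^sup>2)" .
  moreover have "(\<Sum>z\<leftarrow>xs@ys. (cmod z)\<^sup>2) \<le> q" using q zs by auto
  then have "6 * real (Suc m) * (\<Sum>z\<leftarrow>xs@ys. (cmod z)\<^sup>2) \<le> 6 * real (Suc m) * q"
    by (intro mult_left_mono) auto
  ultimately have lower: "(\<Sum>z\<leftarrow>zs. h z) \<ge> S - 6 * real (Suc m) * q" by linarith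
  have swap: "(\<Sum>z\<leftarrow>zs'. h z) = (\<Sum>j=2..m. real (Suc m - j) * Re (\<Sum>z\<leftarrow>zs'. z ^ j))" for zs'
    by (induction zs') (simp_all add: h_def distrib_left sum.distrib)
  have "(\<Sum>z\<leftarrow>zs. h z) \<le> (\<Sum>j=2..m. real (Suc m - j) * (1/2))"
    unfolding swap using small complex_Re_le_cmod order_trans
    by (intro sum_mono mult_left_mono) (blast, simp)
  also have "\<dots> = S / 2" by (simp add: S_def sum_divide_distrib)
  finally have "S / 2 \<le> 6 * real (Suc m) * q" using lower by linarith
  moreover have S: "S = real (m - 1) * real m / 2"
  proof -
    have "(\<Sum>j=2..m. real (Suc m - j)) = (\<Sum>j=1..m-1. real j)"
      by (rule sum.reindex_bij_witness[of _ "\<lambda>j. Suc m - j" "\<lambda>j. Suc m - j"]) auto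
    moreover have "(\<Sum>j=1..k. real j) = real k * real (Suc k) / 2" for k
      by (induction k) (auto simp: field_simps)
    moreover have "Suc (m - 1) = m" using m q0 by (cases m) auto
    ultimately show ?thesis unfolding S_def by metis
  qed
  ultimately have "real (m - 1) * real m \<le> 24 * q * (real m + 1)" by (simp add: algebra_simps)
  also have "\<dots> \<le> (real m - 8) * (real m + 1)" using m by (intro mult_right_mono) auto
  finally show False using m q0 by (simp add: of_nat_diff algebra_simps)
qed



section \<open>Frobenius norm, unitary conjugation and Schur's inequality\<close>

definition frob :: "complex mat \<Rightarrow> real" where
  "frob A = (\<Sum>i<dim_row A. \<Sum>j<dim_col A. (cmod (A $$ (i,j)))\<^sup>2)"

definition unitary :: "nat \<Rightarrow> complex mat \<Rightarrow> bool" where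
  "unitary n U \<longleftrightarrow> U \<in> carrier_mat n n \<and> mat_adjoint U * U = 1\<^sub>m n \<and> U * mat_adjoint U = 1\<^sub>m n"

lemma mat_adjoint_index:
  assumes "U \<in> carrier_mat n m" "i < m" "j < n"
  shows "mat_adjoint U $$ (i,j) = cnj (U $$ (j,i))"
  using assms by (auto simp: mat_adjoint_def mat_of_rows_def)

lemma mat_adjoint_carrier: "U \<in> carrier_mat n n \<Longrightarrow> mat_adjoint U \<in> carrier_mat n n"
  by (auto simp: mat_adjoint_def mat_of_rows_def)

lemma mat_adjoint_mult:
  assumes A: "A \<in> carrier_mat n n" and B: "(B :: complex mat) \<in> carrier_mat n n"
  shows "mat_adjoint (A * B) = mat_adjoint B * mat_adjoint A"
proof (rule eq_matI)
  note c = mat_adjoint_carrier[OF A] mat_adjoint_carrier[OF B] mat_adjoint_carrier[OF mult_carrier_mat[OF A B]]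
  show "dim_row (mat_adjoint (A * B)) = dim_row (mat_adjoint B * mat_adjoint A)"
    "dim_col (mat_adjoint (A * B)) = dim_col (mat_adjoint B * mat_adjoint A)" using c by auto
  fix i j assume "i < dim_row (mat_adjoint B * mat_adjoint A)" "j < dim_col (mat_adjoint B * mat_adjoint A)"
  then have ij: "i < n" "j < n" using c by auto
  show "mat_adjoint (A * B) $$ (i, j) = (mat_adjoint B * mat_adjoint A) $$ (i, j)"
    using ij A B c
    by (simp add: mat_adjoint_index[OF mult_carrier_mat[OF A B]] mat_adjoint_index[OF A] mat_adjoint_index[OF B]
        scalar_prod_def mult.commute)
qed

lemma mat_adjoint_adjoint: "A \<in> carrier_mat n n \<Longrightarrow> mat_adjoint (mat_adjoint A) = (A :: complex mat)"
  by (rule eq_matI)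
    (use mat_adjoint_carrier[of A n] mat_adjoint_carrier[of "mat_adjoint A" n] in
      \<open>auto simp: mat_adjoint_index[of _ n n]\<close>)

lemma frob_eq_trace:
  assumes A: "A \<in> carrier_mat n n"
  shows "complex_of_real (frob A) = (\<Sum>j<n. (mat_adjoint A * A) $$ (j,j))"
proof -
  have "(mat_adjoint A * A) $$ (j,j) = (\<Sum>i<n. complex_of_real ((cmod (A $$ (i,j)))\<^sup>2))" if "j < n" for j
    using that A mat_adjoint_carrier[OF A]
    by (simp add: mat_adjoint_index[OF A] scalar_prod_def complex_norm_square mult.commute lessThan_atLeast0 del: of_real_power)
  then have "(\<Sum>j<n. (mat_adjoint A * A) $$ (j,j)) = (\<Sum>j<n. \<Sum>i<n. complex_of_real ((cmod (A $$ (i,j)))\<^sup>2))"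
    by simp
  also have "\<dots> = complex_of_real (frob A)"
    unfolding frob_def using A by (subst sum.swap) simp
  finally show ?thesis by simp
qed

lemma trace_mult_commute:
  assumes "A \<in> carrier_mat n n" "(B :: complex mat) \<in> carrier_mat n n"
  shows "(\<Sum>j<n. (A * B) $$ (j,j)) = (\<Sum>j<n. (B * A) $$ (j,j))"
  using assms by (simp add: scalar_prod_def lessThan_atLeast0 mult.commute) (rule sum.swap)

lemma frob_unitary:
  assumes A: "A \<in> carrier_mat n n" and U: "unitary n U"
  shows "frob (mat_adjoint U * A * U) = frob A"
proof -
  let ?V = "mat_adjoint U"
  note c = U[unfolded unitary_def, THEN conjunct1] mat_adjoint_carrier[OF U[unfolded unitary_def, THEN conjunct1]]
  note [simp] = c A mat_adjoint_carrier[OF A] mult_carrier_mat[of _ n n _ n] left_mult_one_mat[of _ n n]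
    right_mult_one_mat[of _ n n]
  have UV: "U * ?V = 1\<^sub>m n" using U by (auto simp: unitary_def)
  have B: "?V * A * U \<in> carrier_mat n n" using c A by (meson mult_carrier_mat)
  have adj: "mat_adjoint (?V * A * U) = ?V * (mat_adjoint A * U)"
    unfolding mat_adjoint_mult[OF mult_carrier_mat[OF c(2) A] c(1)] mat_adjoint_mult[OF c(2) A]
      mat_adjoint_adjoint[OF c(1)] ..
  have "mat_adjoint (?V * A * U) * (?V * A * U) = ?V * (mat_adjoint A * U) * (?V * A * U)" by (simp only: adj)
  also have "\<dots> = ?V * (mat_adjoint A * (U * ?V) * (A * U))"
    by (simp add: assoc_mult_mat[of _ n n _ n _ n])
  also have "\<dots> = ?V * ((mat_adjoint A * A) * U)"
    by (simp add: UV assoc_mult_mat[of _ n n _ n _ n])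
  finally have e: "mat_adjoint (?V * A * U) * (?V * A * U) = ?V * ((mat_adjoint A * A) * U)" .
  have "complex_of_real (frob (?V * A * U)) = (\<Sum>j<n. (?V * ((mat_adjoint A * A) * U)) $$ (j,j))"
    by (simp only: frob_eq_trace[OF B] e)
  also have "\<dots> = (\<Sum>j<n. (((mat_adjoint A * A) * U) * ?V) $$ (j,j))"
    by (rule trace_mult_commute) simp_all
  also have "((mat_adjoint A * A) * U) * ?V = mat_adjoint A * A"
    by (simp add: UV assoc_mult_mat[of _ n n _ n _ n])
  also have "(\<Sum>j<n. (mat_adjoint A * A) $$ (j,j)) = complex_of_real (frob A)"
    by (simp only: frob_eq_trace[OF A])
  finally show ?thesis by (simp only: of_real_eq_iff)
qed

text \<open>Gram-Schmidt applied to a basis that starts with \<open>v\<close> leaves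
  \<open>v\<close> in place, so scaling the resulting orthogonal vectors to norm \<open>1\<close>
  changes the first one only by the scalar \<open>c\<close>.\<close>

lemma unitary_first_column:
  assumes v: "v \<in> carrier_vec n" and v0: "v \<noteq> 0\<^sub>v n"
  shows "\<exists>U c. unitary n U \<and> col U 0 = c \<cdot>\<^sub>v (v :: complex vec) \<and> n > 0"
proof -
  interpret cof_vec_space n "TYPE(complex)" .
  define b where "b = basis_completion v"
  define ws where "ws = gram_schmidt n b"
  from basis_completion[OF v v0, folded b_def]
  have dist_b: "distinct b" and indep: "\<not> lin_dep (set b)" and b: "set b \<subseteq> carrier_vec n"
    and hdb: "hd b = v" and len_b: "length b = n" by auto
  have n: "n > 0" using v v0 by (cases n) auto
  from hdb len_b n obtain vs where bv: "b = v # vs" by (cases b, auto)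
  from gram_schmidt_result[OF b dist_b indep refl, folded ws_def]
  have ws: "set ws \<subseteq> carrier_vec n" "corthogonal ws" "length ws = n" by (auto simp: len_b)
  from gram_schmidt_hd[OF v, of vs, folded bv] have hdws: "hd ws = v" unfolding ws_def .
  define s where "s j = sqrt (Re (ws ! j \<bullet>c ws ! j))" for j
  have wsc: "ws ! j \<in> carrier_vec n" if "j < n" for j using ws that by auto
  have sp: "ws ! j \<bullet>c ws ! i = (\<Sum>k<n. ws ! j $ k * cnj (ws ! i $ k))" if "i < n" "j < n" for i j
    using wsc[OF that(1)] wsc[OF that(2)] by (simp add: scalar_prod_def lessThan_atLeast0)
  have spr: "ws ! j \<bullet>c ws ! j = complex_of_real (\<Sum>k<n. (cmod (ws ! j $ k))\<^sup>2)" if "j < n" for j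
    unfolding sp[OF that that] of_real_sum by (rule sum.cong) (simp_all add: complex_norm_square del: of_real_power)
  have s2: "complex_of_real (s j) * complex_of_real (s j) = ws ! j \<bullet>c ws ! j" if "j < n" for j
  proof -
    have "Re (ws ! j \<bullet>c ws ! j) \<ge> 0" unfolding spr[OF that] by (auto intro: sum_nonneg)
    then have "s j * s j = Re (ws ! j \<bullet>c ws ! j)" by (simp add: s_def)
    moreover have "complex_of_real (Re (ws ! j \<bullet>c ws ! j)) = ws ! j \<bullet>c ws ! j" unfolding spr[OF that] by simp
    ultimately show ?thesis by (metis of_real_mult)
  qed
  have s0: "s j \<noteq> 0" if "j < n" for j
    using s2[OF that] corthogonalD[OF ws(2), of j j] ws(3) that by auto
  define U where "U = mat n n (\<lambda>(i,j). ws ! j $ i / complex_of_real (s j))"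
  have U: "U \<in> carrier_mat n n" by (simp add: U_def)
  note Ua = mat_adjoint_carrier[OF U]
  have VU: "mat_adjoint U * U = 1\<^sub>m n"
  proof (rule eq_matI)
    fix i j assume "i < dim_row (1\<^sub>m n)" "j < dim_col (1\<^sub>m n)"
    then have ij: "i < n" "j < n" by auto
    have "(mat_adjoint U * U) $$ (i,j) = (\<Sum>k<n. mat_adjoint U $$ (i,k) * U $$ (k,j))"
      using ij U Ua by (simp add: scalar_prod_def lessThan_atLeast0)
    also have "\<dots> = (\<Sum>k<n. ws ! j $ k * cnj (ws ! i $ k) / (complex_of_real (s i) * complex_of_real (s j)))"
      using ij by (intro sum.cong) (auto simp: mat_adjoint_index[OF U], auto simp: U_def)
    also have "\<dots> = (ws ! j \<bullet>c ws ! i) / (complex_of_real (s i) * complex_of_real (s j))"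
      by (simp add: sp[OF ij] sum_divide_distrib)
    also have "\<dots> = 1\<^sub>m n $$ (i,j)"
      using corthogonalD[OF ws(2), of j i] ij ws(3) s2[OF ij(1)] s0[OF ij(1)] by auto
    finally show "(mat_adjoint U * U) $$ (i,j) = 1\<^sub>m n $$ (i,j)" .
  qed (use U Ua in auto)
  then have "unitary n U"
    using mat_mult_left_right_inverse[OF Ua U] U by (auto simp: unitary_def)
  moreover have "ws ! 0 = v" using hdws ws(3) n by (metis hd_conv_nth length_greater_0_conv)
  then have "col U 0 = (1 / complex_of_real (s 0)) \<cdot>\<^sub>v v"
    using n hdws ws v by (intro eq_vecI) (auto simp: U_def)
  ultimately show ?thesis using n by blast
qed

text \<open>Deflation: in an orthonormal basis that begins with an eigenvector the first column is
  \<open>e\<close> followed by zeros, the lower right block has the remaining eigenvalues, and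
  dropping the rest of the first row only lowers the norm. The change of basis has to be unitary,
  since a general similarity does not preserve \<open>frob\<close>.\<close>

lemma schur_inequality:
  assumes "A \<in> carrier_mat n n" and "char_poly A = (\<Prod>e\<leftarrow>es. [:- e, 1:])"
  shows "(\<Sum>e\<leftarrow>es. (cmod e)\<^sup>2) \<le> frob A"
  using assms
proof (induction es arbitrary: n A)
  case Nil
  then show ?case by (simp add: frob_def sum_nonneg)
next
  case (Cons e es n A)
  note A = Cons.prems(1)
  have cp: "char_poly A = [:-e, 1:] * (\<Prod>e\<leftarrow>es. [:- e, 1:])" using Cons.prems(2) by simp
  have e: "eigenvalue A e" unfolding eigenvalue_root_char_poly[OF A] cp by simp
  define v where "v = find_eigenvector A e"
  have ev: "eigenvector A v e" unfolding v_def using find_eigenvector[OF A e] .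
  then have v: "v \<in> carrier_vec n" and v0: "v \<noteq> 0\<^sub>v n" and Av: "A *\<^sub>v v = e \<cdot>\<^sub>v v"
    using A by (auto simp: eigenvector_def)
  obtain U c where Uu: "unitary n U" and col0: "col U 0 = c \<cdot>\<^sub>v v" and n: "n > 0"
    using unitary_first_column[OF v v0] by blast
  have U: "U \<in> carrier_mat n n" and VU: "mat_adjoint U * U = 1\<^sub>m n" and UV: "U * mat_adjoint U = 1\<^sub>m n"
    using Uu by (auto simp: unitary_def)
  note V = mat_adjoint_carrier[OF U]
  define B where "B = mat_adjoint U * A * U"
  have B: "B \<in> carrier_mat n n" using U V A by (auto simp: B_def)
  have sim: "similar_mat B A"
    unfolding similar_mat_def
    by (rule exI[of _ "mat_adjoint U"], rule exI[of _ U], rule similar_mat_witI[of _ _ n])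
      (use U V A B UV VU in \<open>auto simp: B_def\<close>)
  have colB: "B $$ (i,0) = (if i = 0 then e else 0)" if i: "i < n" for i
  proof -
    have "col B 0 = mat_adjoint U *\<^sub>v (A *\<^sub>v col U 0)"
      unfolding B_def assoc_mult_mat[OF V A U] col_mult2[OF V mult_carrier_mat[OF A U] n] col_mult2[OF A U n] ..
    also have "A *\<^sub>v col U 0 = e \<cdot>\<^sub>v col U 0"
      unfolding col0 using A v Av by (simp add: mult_mat_vec smult_smult_assoc mult.commute)
    also have "mat_adjoint U *\<^sub>v (e \<cdot>\<^sub>v col U 0) = e \<cdot>\<^sub>v (mat_adjoint U *\<^sub>v col U 0)"
      using V U n by (intro mult_mat_vec) auto
    also have "mat_adjoint U *\<^sub>v col U 0 = col (1\<^sub>m n) 0"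
      unfolding VU[symmetric] col_mult2[OF V U n] ..
    finally have "col B 0 $ i = (e \<cdot>\<^sub>v col (1\<^sub>m n) 0) $ i" by simp
    then show ?thesis using i n B by auto
  qed
  obtain A1 A2 A0 A3 where split: "split_block B 1 1 = (A1,A2,A0,A3)"
    by (cases "split_block B 1 1", auto)
  have "dim_row B = 1 + (n - 1)" "dim_col B = 1 + (n - 1)" using B n by auto
  from split_block[OF split this] have A1: "A1 \<in> carrier_mat 1 1" and A2: "A2 \<in> carrier_mat 1 (n - 1)"
    and A0: "A0 \<in> carrier_mat (n - 1) 1" and A3: "A3 \<in> carrier_mat (n - 1) (n - 1)"
    and block: "B = four_block_mat A1 A2 A0 A3" by auto
  have A1id: "A1 = mat 1 1 (\<lambda>_. e)"
    using split[unfolded split_block_def Let_def] colB[of 0] B n by auto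
  have A0id: "A0 = 0\<^sub>m (n - 1) 1"
    using split[unfolded split_block_def Let_def] colB B n by (auto intro!: eq_matI)
  have A3i: "A3 $$ (i,j) = B $$ (Suc i, Suc j)" if "i < n - 1" "j < n - 1" for i j
    using split[unfolded split_block_def Let_def] B that by auto
  have "char_poly A = char_poly A1 * char_poly A3"
    unfolding char_poly_similar[OF sim, symmetric] block A0id
    by (rule char_poly_four_block_zeros_col[OF A1 A2 A3])
  also have "char_poly A1 = [: -e,1 :]"
    by (simp add: A1id char_poly_defs det_def sign_def)
  finally have cp3: "char_poly A3 = (\<Prod>e\<leftarrow>es. [:- e, 1:])"
    unfolding cp by (metis mult_cancel_left pCons_eq_0_iff zero_neq_one)
  have IH: "(\<Sum>e\<leftarrow>es. (cmod e)\<^sup>2) \<le> frob A3" by (rule Cons.IH[OF A3 cp3])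
  obtain n' where n': "n = Suc n'" using n by (cases n) auto
  have "frob B = (\<Sum>j<n. (cmod (B $$ (0,j)))\<^sup>2) + (\<Sum>i<n'. \<Sum>j<n. (cmod (B $$ (Suc i,j)))\<^sup>2)"
  proof -
    have "dim_row B = Suc n'" "dim_col B = n" using B n' by auto
    then show ?thesis unfolding frob_def by (simp only: sum.lessThan_Suc_shift)
  qed
  moreover have "(\<Sum>j<n. (cmod (B $$ (0,j)))\<^sup>2) \<ge> (cmod e)\<^sup>2"
    using member_le_sum[of 0 "{..<n}" "\<lambda>j. (cmod (B $$ (0,j)))\<^sup>2"] n colB[of 0] by simp
  moreover have "(\<Sum>i<n'. \<Sum>j<n. (cmod (B $$ (Suc i,j)))\<^sup>2) \<ge> frob A3"
  proof -
    have "frob A3 = (\<Sum>i<n'. \<Sum>j<n'. (cmod (B $$ (Suc i,Suc j)))\<^sup>2)"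
      unfolding frob_def using A3 A3i n' by simp
    also have "\<dots> \<le> (\<Sum>i<n'. \<Sum>j<n. (cmod (B $$ (Suc i,j)))\<^sup>2)"
      unfolding n' by (intro sum_mono) (simp only: sum.lessThan_Suc_shift, simp)
    finally show ?thesis .
  qed
  moreover have "frob B = frob A" unfolding B_def by (rule frob_unitary[OF A Uu])
  ultimately show ?case using IH by simp
qed


section \<open>Traces of powers as power sums of the eigenvalues\<close>

definition mtrace :: "complex mat \<Rightarrow> complex" where
  "mtrace A = (\<Sum>i<dim_row A. A $$ (i,i))"

lemma upper_triangular_mult:
  assumes A: "A \<in> carrier_mat n n" "upper_triangular A" and B: "(B :: complex mat) \<in> carrier_mat n n" "upper_triangular B"
  shows "upper_triangular (A * B)" "\<And>i. i < n \<Longrightarrow> (A * B) $$ (i,i) = A $$ (i,i) * B $$ (i,i)"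
proof -
  have z: "A $$ (i,k) * B $$ (k,j) = 0" if "k < n" "i < n" "j < n" "k < i \<or> j < k" for i j k
    using that upper_triangularD[OF A(2), of k i] upper_triangularD[OF B(2), of j k] A B by auto
  have e: "(A * B) $$ (i,j) = (\<Sum>k<n. A $$ (i,k) * B $$ (k,j))" if "i < n" "j < n" for i j
    using that A B by (simp add: scalar_prod_def lessThan_atLeast0)
  show "upper_triangular (A * B)"
  proof (rule upper_triangularI)
    fix i j assume ij: "j < i" "i < dim_row (A * B)"
    then have "A $$ (i,k) * B $$ (k,j) = 0" if "k < n" for k
      using z[of k i j] that A by (cases "k < i") auto
    then show "(A * B) $$ (i,j) = 0"
      using A ij e[of i j] by (simp del: mult_eq_0_iff)
  qed
  fix i assume i: "i < n"
  have "(\<Sum>k<n. A $$ (i,k) * B $$ (k,i)) = (\<Sum>k\<in>{i}. A $$ (i,k) * B $$ (k,i))"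
    using i z[of _ i i] by (intro sum.mono_neutral_right) (auto simp: nat_neq_iff)
  then show "(A * B) $$ (i,i) = A $$ (i,i) * B $$ (i,i)" using e[OF i i] by simp
qed

lemma upper_triangular_pow:
  assumes B: "B \<in> carrier_mat n n" "upper_triangular (B :: complex mat)"
  shows "upper_triangular (B ^\<^sub>m k) \<and> (\<forall>i<n. (B ^\<^sub>m k) $$ (i,i) = (B $$ (i,i)) ^ k)"
proof (induction k)
  case 0
  then show ?case using B by auto
next
  case (Suc k)
  have c: "B ^\<^sub>m k \<in> carrier_mat n n" using B by auto
  show ?case using upper_triangular_mult[OF c _ B] Suc by (auto simp: mult.commute)
qed

text \<open>Any triangularising similarity will do here, because traces, unlike the Frobenius norm,
  are invariant under all similarities.\<close>

lemma mtrace_pow: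
  assumes A: "A \<in> carrier_mat n n" and cp: "char_poly A = (\<Prod>e\<leftarrow>es. [:- e, 1:])"
  shows "mtrace (A ^\<^sub>m k) = (\<Sum>e\<leftarrow>es. e ^ k)"
proof -
  obtain B P Q where s: "schur_decomposition A es = (B,P,Q)" by (cases "schur_decomposition A es") auto
  from schur_decomposition[OF A cp s] have w: "similar_mat_wit A B P Q" and ut: "upper_triangular B"
    and diag: "diag_mat B = es" by auto
  from similar_mat_witD2[OF A w] have c: "B \<in> carrier_mat n n" "P \<in> carrier_mat n n" "Q \<in> carrier_mat n n"
    and QP: "Q * P = 1\<^sub>m n" by auto
  have wk: "A ^\<^sub>m k = P * (B ^\<^sub>m k) * Q"
    using similar_mat_wit_pow[OF w, of k] by (simp add: similar_mat_wit_def Let_def)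
  have Bk: "B ^\<^sub>m k \<in> carrier_mat n n" using c by auto
  have "mtrace (A ^\<^sub>m k) = (\<Sum>i<n. (P * (B ^\<^sub>m k) * Q) $$ (i,i))"
    unfolding mtrace_def wk using c by simp
  also have "\<dots> = (\<Sum>i<n. (P * ((B ^\<^sub>m k) * Q)) $$ (i,i))"
    using assoc_mult_mat[OF c(2) Bk c(3)] by simp
  also have "\<dots> = (\<Sum>i<n. (((B ^\<^sub>m k) * Q) * P) $$ (i,i))"
    using c Bk by (intro trace_mult_commute) auto
  also have "((B ^\<^sub>m k) * Q) * P = B ^\<^sub>m k"
    using assoc_mult_mat[OF Bk c(3) c(2)] QP right_mult_one_mat[OF Bk] by simp
  also have "(\<Sum>i<n. (B ^\<^sub>m k) $$ (i,i)) = (\<Sum>i<n. (B $$ (i,i)) ^ k)"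
    using upper_triangular_pow[OF c(1) ut] by simp
  also have "\<dots> = (\<Sum>e\<leftarrow>es. e ^ k)"
    unfolding diag[symmetric] using c
    by (simp add: diag_mat_def comp_def interv_sum_list_conv_sum_set_nat lessThan_atLeast0)
  finally show ?thesis .
qed

text \<open>Powers are kept as real functions because their entries will count walks; complex
  matrices serve only to speak about the spectrum.\<close>

fun mpow :: "nat \<Rightarrow> (nat \<Rightarrow> nat \<Rightarrow> real) \<Rightarrow> nat \<Rightarrow> nat \<Rightarrow> nat \<Rightarrow> real" where
  "mpow n K 0 i j = (if i = j then 1 else 0)"
| "mpow n K (Suc t) i j = (\<Sum>l<n. K i l * mpow n K t l j)"

lemma mpow_nonneg: "(\<And>i j. K i j \<ge> 0) \<Longrightarrow> mpow n K t i j \<ge> 0"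
  by (induction t arbitrary: i) (auto intro!: sum_nonneg)

lemma mat_pow_mpow:
  assumes "i < n" "j < n"
  shows "(mat n n (\<lambda>(i,j). complex_of_real (K i j)) ^\<^sub>m t) $$ (i,j) = complex_of_real (mpow n K t i j)"
  using assms
proof (induction t arbitrary: i j)
  case (Suc t)
  let ?A = "mat n n (\<lambda>(i,j). complex_of_real (K i j))"
  have A: "?A \<in> carrier_mat n n" by simp
  have "?A ^\<^sub>m Suc t = ?A * ?A ^\<^sub>m t"
  proof (induction t)
    case (Suc t)
    then show ?case using assoc_mult_mat[OF A pow_carrier_mat[OF A, of t] A] by simp
  qed (use A in auto)
  then show ?case using Suc by (simp add: scalar_prod_def lessThan_atLeast0)
qed auto

text \<open>Dividing the eigenvalues by one of largest modulus \<open>\<rho> \<ge> c / 2\<close> leaves numbers in the unit disc, one of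
  them \<open>1\<close>, whose squared moduli add up to at most \<open>F / \<rho>\<^sup>2\<close> by Schur's inequality; their power sums
  cannot all be small.\<close>

theorem mpow_trace_lower:
  fixes K :: "nat \<Rightarrow> nat \<Rightarrow> real"
  assumes n: "n > 0" and c: "c > 0" and K0: "\<And>i j. K i j \<ge> 0"
    and F: "(\<Sum>i<n. \<Sum>j<n. (K i j)\<^sup>2) \<le> F"
    and grow: "\<And>t. \<exists>i<n. (\<Sum>j<n. mpow n K t i j) \<ge> c ^ t"
    and m: "real m \<ge> 24 * (4 * F / c\<^sup>2) + 8"
  shows "\<exists>j\<in>{2..m}. (\<Sum>i<n. mpow n K j i i) \<ge> (c/2) ^ j / 2"
proof -
  define A where "A = mat n n (\<lambda>(i,j). complex_of_real (K i j))"
  have A: "A \<in> carrier_mat n n" by (simp add: A_def)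
  obtain es where cp: "char_poly A = (\<Prod>e\<leftarrow>es. [:- e, 1:])" and len: "length es = n"
    using char_poly_factorized[OF A] by auto
  have es: "set es = spectrum A"
    unfolding spectrum_root_char_poly[OF A] cp by (auto simp: poly_prod_list prod_list_zero_iff o_def)
  \<comment> \<open>Giving away a factor \<open>2\<close> makes the scaled radius strictly less than
    \<open>1\<close>: then all powers of the scaled matrix are bounded entrywise by one constant,
    whereas \<open>grow\<close> makes some row sum at least \<open>2 ^ t\<close> for each
    \<open>t\<close>.\<close>
  have rho: "spectral_radius A \<ge> c / 2"
  proof (rule ccontr)
    assume "\<not> ?thesis"
    then have lt: "spectral_radius A < c / 2" by simp
    define d where "d = complex_of_real (2 / c)"
    define K' where "K' i j = 2 / c * K i j" for i j
    define B where "B = mat n n (\<lambda>(i,j). complex_of_real (K' i j))"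
    have B: "B \<in> carrier_mat n n" by (simp add: B_def)
    have d0: "d \<noteq> 0" using c by (simp add: d_def)
    have BA: "A = (1/d) \<cdot>\<^sub>m B"
      using c by (auto simp: A_def B_def d_def K'_def)
    have "spectral_radius B < 1"
    proof -
      obtain e where e: "e \<in> spectrum B" "spectral_radius B = cmod e"
        using spectral_radius_mem_max(1)[OF B n] by auto
      then obtain v where v: "eigenvector B v e" by (auto simp: spectrum_def eigenvalue_def)
      then have "A *\<^sub>v v = (e / d) \<cdot>\<^sub>v v"
      proof -
        have c: "v \<in> carrier_vec n" and Bv: "B *\<^sub>v v = e \<cdot>\<^sub>v v" using v B by (auto simp: eigenvector_def)
        have "A *\<^sub>v v = (1/d) \<cdot>\<^sub>v (B *\<^sub>v v)"
          unfolding BA using B c by (intro eq_vecI) (auto simp: scalar_prod_def sum_distrib_left mult.assoc)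
        then show ?thesis unfolding Bv by (simp add: smult_smult_assoc)
      qed
      then have "e / d \<in> spectrum A"
        using v A B by (auto simp: spectrum_def eigenvalue_def eigenvector_def)
      then have "cmod (e / d) \<le> spectral_radius A"
        using spectral_radius_mem_max(2)[OF A n] by auto
      then have "cmod e * c \<le> spectral_radius A * 2" using c by (simp add: d_def norm_divide norm_mult)
      then have "cmod e * c < 1 * c" using lt by linarith
      then show ?thesis using e c by (simp only: mult_less_cancel_right_pos)
    qed
    from spectral_radius_jnf_norm_bound_less_1_upper_triangular[OF B this]
    obtain b where b: "\<And>k. norm_bound (B ^\<^sub>m k) b" by auto
    have le: "mpow n K' t i j \<le> b" if "i < n" "j < n" for t i j
    proof -
      have "cmod ((B ^\<^sub>m t) $$ (i,j)) \<le> b" using b[of t] B that by (auto simp: norm_bound_def)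
      then show ?thesis using mat_pow_mpow[OF that, of K' t] by (simp add: B_def)
    qed
    have K'p: "mpow n K' t i j = (2 / c) ^ t * mpow n K t i j" for t i j
      by (induction t arbitrary: i) (auto simp: K'_def sum_distrib_left mult_ac)
    have "2 ^ t \<le> real n * b" for t
    proof -
      obtain i where i: "i < n" "(\<Sum>j<n. mpow n K t i j) \<ge> c ^ t" using grow by blast
      have "2 ^ t = (2 / c) ^ t * c ^ t" using c by (simp add: power_divide)
      also have "\<dots> \<le> (2 / c) ^ t * (\<Sum>j<n. mpow n K t i j)" using i c by (intro mult_left_mono) auto
      also have "\<dots> = (\<Sum>j<n. mpow n K' t i j)" by (simp add: K'p sum_distrib_left)
      also have "\<dots> \<le> (\<Sum>j<n. b)" using i by (intro sum_mono le) auto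
      finally show ?thesis by simp
    qed
    moreover obtain t where "2 ^ t > real n * b" using real_arch_pow[of 2 "real n * b"] by auto
    ultimately show False using leD by blast
  qed
  obtain l where l: "l \<in> spectrum A" "cmod l = spectral_radius A"
    using spectral_radius_mem_max(1)[OF A n] by auto
  then have l0: "cmod l \<ge> c / 2" "l \<noteq> 0" using rho c by auto
  define zs where "zs = map (\<lambda>e. e / l) es"
  have Fn: "frob A \<le> F" using F by (simp add: frob_def A_def)
  have "0 \<le> frob A" by (simp add: frob_def sum_nonneg)
  then have F0: "0 \<le> F" using Fn by linarith
  have z1: "cmod z \<le> 1" if z: "z \<in> set zs" for z
  proof -
    obtain e where e: "e \<in> spectrum A" "z = e / l" using z es by (auto simp: zs_def)
    then have "cmod e \<le> cmod l" using l spectral_radius_mem_max(2)[OF A n] by auto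
    then show ?thesis using e l0 by (simp add: norm_divide)
  qed
  have one: "1 \<in> set zs" using l es l0 by (force simp: zs_def)
  have "(\<Sum>z\<leftarrow>zs. (cmod z)\<^sup>2) = (\<Sum>e\<leftarrow>es. (cmod e)\<^sup>2) / (cmod l)\<^sup>2"
    unfolding zs_def by (induction es) (auto simp: norm_divide power_divide add_divide_distrib)
  also have "\<dots> \<le> F / (c/2)\<^sup>2"
    using schur_inequality[OF A cp] Fn F0 l0 c
    by (intro frac_le power_mono) (auto intro: order_trans[OF _ Fn] sum_list_nonneg)
  also have "\<dots> = 4 * F / c\<^sup>2" by (simp add: power_divide)
  finally have q: "(\<Sum>z\<leftarrow>zs. (cmod z)\<^sup>2) \<le> 4 * F / c\<^sup>2" .
  from power_sum_lower[OF z1 one q m] obtain j where j: "j \<in> {2..m}" "cmod (\<Sum>z\<leftarrow>zs. z ^ j) \<ge> 1/2"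
    by blast
  have "(\<Sum>z\<leftarrow>zs. z ^ j) = (\<Sum>e\<leftarrow>es. e ^ j) / l ^ j"
    unfolding zs_def by (induction es) (auto simp: power_divide add_divide_distrib)
  also have "\<dots> = mtrace (A ^\<^sub>m j) / l ^ j" using mtrace_pow[OF A cp] by simp
  also have "mtrace (A ^\<^sub>m j) = complex_of_real (\<Sum>i<n. mpow n K j i i)"
    using mat_pow_mpow[of _ n _ K j] A by (simp add: mtrace_def A_def)
  finally have "cmod (\<Sum>z\<leftarrow>zs. z ^ j) = (\<Sum>i<n. mpow n K j i i) / cmod l ^ j"
    by (simp add: norm_divide norm_power sum_nonneg mpow_nonneg K0 del: of_real_sum)
  with j have "(\<Sum>i<n. mpow n K j i i) \<ge> cmod l ^ j / 2" using l0 by (simp add: field_simps)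
  moreover have "cmod l ^ j \<ge> (c/2) ^ j" using l0 c by (intro power_mono) auto
  ultimately show ?thesis using j by (intro bexI[of _ j]) auto
qed

section \<open>Families of permutations and short cycles\<close>

definition supp :: "nat \<Rightarrow> (nat \<Rightarrow> nat) set \<Rightarrow> (nat \<times> nat) set" where
  "supp n A = {(u, a u) | u a. u < n \<and> a \<in> A}"

definition realised :: "(nat \<Rightarrow> nat) set \<Rightarrow> (nat \<times> nat) list \<Rightarrow> bool" where
  "realised A es \<longleftrightarrow> (\<exists>a\<in>A. \<forall>(u,w)\<in>set es. a u = w)"

lemma supp_mono: "A \<subseteq> B \<Longrightarrow> supp n A \<subseteq> supp n B"
  by (auto simp: supp_def)

lemma supp_subset: "\<forall>a\<in>A. \<forall>u<n. a u < n \<Longrightarrow> supp n A \<subseteq> {..<n} \<times> {..<n}"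
  by (auto simp: supp_def)

text \<open>Maximising \<open>ln |A| - |supp A| / n\<close> makes the support robust: passing to a subset costs few edges
  unless the subset is tiny.\<close>

lemma robust_subset:
  assumes fin: "finite A" and ne: "A \<noteq> {}" and n: "n > 0"
    and cl: "\<forall>a\<in>A. \<forall>u<n. a u < n"
  obtains A' where "A' \<subseteq> A" "A' \<noteq> {}" "real (card A) \<le> exp (real n) * real (card A')"
    "\<And>B. B \<subseteq> A' \<Longrightarrow> B \<noteq> {} \<Longrightarrow>
      real (card (supp n A' - supp n B)) \<le> real n * ln (real (card A') / real (card B))"
proof -
  define g where "g B = ln (real (card B)) - real (card (supp n B)) / real n" for B
  have fs: "finite (supp n A)" using supp_subset[OF cl] finite_subset by blast
  have cs: "card (supp n A) \<le> n * n"
    using card_mono[OF _ supp_subset[OF cl]] by (simp add: card_cartesian_product)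
  obtain A' where A': "A' \<subseteq> A" "A' \<noteq> {}" and mx: "\<And>B. B \<subseteq> A \<Longrightarrow> B \<noteq> {} \<Longrightarrow> g B \<le> g A'"
  proof -
    have "finite (g ` (Pow A - {{}}))" "g ` (Pow A - {{}}) \<noteq> {}" using fin ne by auto
    then have "Max (g ` (Pow A - {{}})) \<in> g ` (Pow A - {{}})" by (rule Max_in)
    then obtain A' where A': "A' \<in> Pow A - {{}}" "g A' = Max (g ` (Pow A - {{}}))"
      by (metis imageE)
    have "g B \<le> g A'" if "B \<subseteq> A" "B \<noteq> {}" for B
      unfolding A'(2) by (rule Max_ge) (use fin that in auto)
    then show thesis using that[of A'] A'(1) by auto
  qed
  have pos: "card B > 0" if "B \<subseteq> A" "B \<noteq> {}" for B using that fin by (simp add: card_gt_0_iff finite_subset)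
  note p = pos[OF A'] pos[OF order_refl ne]
  show thesis
  proof (rule that[OF A'])
    \<comment> \<open>The support has at most \<open>n * n\<close> pairs, so the penalty never
      exceeds \<open>n\<close>. Passing to the maximiser costs a factor \<open>exp n\<close>, which
      later only multiplies \<open>Q\<close> by a constant.\<close>
    have "ln (real (card A)) - real n \<le> g A"
      unfolding g_def using cs n by (simp add: field_simps flip: of_nat_mult)
    also have "g A \<le> g A'" using mx[OF order_refl ne] .
    also have "g A' \<le> ln (real (card A'))" by (simp add: g_def)
    finally have "ln (real (card A)) \<le> real n + ln (real (card A'))" by simp
    then have "exp (ln (real (card A))) \<le> exp (real n + ln (real (card A')))" by simp
    then show "real (card A) \<le> exp (real n) * real (card A')" using p by (simp add: exp_add)
    fix B assume B: "B \<subseteq> A'" "B \<noteq> {}"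
    then have BA: "B \<subseteq> A" using A' by auto
    have sub: "supp n B \<subseteq> supp n A'" "supp n A' \<subseteq> supp n A" using supp_mono B A' by auto
    have "card (supp n B) \<le> card (supp n A')" using sub fs by (meson card_mono finite_subset)
    then have "real (card (supp n A' - supp n B)) = real (card (supp n A')) - real (card (supp n B))"
      using sub fs by (subst card_Diff_subset) (auto intro: finite_subset simp: of_nat_diff)
    moreover have "g B \<le> g A'" using mx[OF BA B(2)] .
    ultimately have "real (card (supp n A' - supp n B)) / real n \<le> ln (real (card A')) - ln (real (card B))"
      by (simp add: g_def diff_divide_distrib)
    also have "\<dots> = ln (real (card A') / real (card B))"
      using p pos[OF BA B(2)] by (simp add: ln_div)
    finally show "real (card (supp n A' - supp n B)) \<le> real n * ln (real (card A') / real (card B))"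
      using n by (simp add: field_simps)
  qed
qed

text \<open>Fix the edges of a list one after the other.  At each stage all but few edges of the support
  are heavy, and fixing a heavy edge keeps a polynomial fraction of the maps.\<close>

lemma unrealised_card:
  assumes fin: "finite A" and n: "n > 0" and cl: "\<forall>a\<in>A. \<forall>u<n. a u < n"
    and rob: "\<And>B. B \<subseteq> A \<Longrightarrow> B \<noteq> {} \<Longrightarrow>
      real (card (supp n A - supp n B)) \<le> real n * ln (real (card A) / real (card B))"
    and B: "B \<subseteq> A" "B \<noteq> {}" "real (card A) \<le> real (card B) * (2 * real n ^ 2) ^ i" and ij: "i + j \<le> t"
  shows "real (card {es. length es = j \<and> set es \<subseteq> supp n A \<and> \<not> realised B es})
    \<le> real j * (real n * (real t * ln (2 * real n ^ 2))) * (real n ^ 2) ^ (j - 1)"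
  using B ij
proof (induction j arbitrary: B i)
  case 0
  then have "{es. length es = 0 \<and> set es \<subseteq> supp n A \<and> \<not> realised B es} = {}"
    by (auto simp: realised_def)
  then show ?case by simp
next
  case (Suc j)
  define M where "M = real n ^ 2"
  define \<beta> where "\<beta> = real n * (real t * ln (2 * M))"
  have M1: "M \<ge> 1" using n by (simp add: M_def)
  have M0: "M > 0" using M1 by simp
  have l0: "ln (2 * M) \<ge> ln 2" using M1 by simp
  have lp: "ln (2 * M) > 0" using l0 ln_gt_zero[of "2::real"] by linarith
  have \<beta>0: "\<beta> \<ge> 0" unfolding \<beta>_def using lp by simp
  define S where "S = supp n A"
  have SM: "S \<subseteq> {..<n} \<times> {..<n}" unfolding S_def by (rule supp_subset[OF cl])
  have fS: "finite S" using SM finite_subset by blast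
  have cS: "real (card S) \<le> M"
  proof -
    have "card S \<le> n * n" using card_mono[OF _ SM] by (simp add: card_cartesian_product)
    then show ?thesis unfolding M_def power2_eq_square by (metis of_nat_le_iff of_nat_mult)
  qed
  have fB: "finite B" using Suc.prems fin finite_subset by blast
  have cB: "real (card B) > 0" using Suc.prems(2) fB by (simp add: card_gt_0_iff)
  define Be where "Be e = {b \<in> B. b (fst e) = snd e}" for e
  \<comment> \<open>Heavy edges. The threshold is chosen so that the light edges, of which there are
    at most \<open>M\<close>, together occur in at most half of the maps in
    \<open>B\<close>.\<close>
  define H where "H = {e \<in> S. real (card (Be e)) * (2 * M) \<ge> real (card B)}"
  have light: "real (card (S - H)) \<le> \<beta>"
  proof -
    \<comment> \<open>\<open>B'\<close> uses no light edge and is still at least half of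
      \<open>B\<close>, so all light edges lie in the part of the support lost by passing from
      \<open>A\<close> to \<open>B'\<close>, whose size robustness bounds.\<close>
    define B' where "B' = B - (\<Union>e\<in>S - H. Be e)"
    have "real (card (\<Union>e\<in>S - H. Be e)) \<le> real (card B) / 2"
    proof -
      have "card (\<Union>e\<in>S - H. Be e) \<le> (\<Sum>e\<in>S - H. card (Be e))"
        using fS by (intro card_UN_le) auto
      then have "real (card (\<Union>e\<in>S - H. Be e)) \<le> (\<Sum>e\<in>S - H. real (card (Be e)))"
        by (metis of_nat_le_iff of_nat_sum)
      also have "\<dots> \<le> (\<Sum>e\<in>S - H. real (card B) / (2 * M))"
        using M0 by (intro sum_mono) (auto simp: H_def field_simps)
      also have "\<dots> = real (card (S - H)) * (real (card B) / (2 * M))" by simp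
      also have "\<dots> \<le> M * (real (card B) / (2 * M))"
        using cS card_mono[of S "S - H"] fS M0 by (intro mult_right_mono) auto
      finally show ?thesis using M0 by simp
    qed
    moreover have "real (card B') = real (card B) - real (card (\<Union>e\<in>S - H. Be e))"
    proof -
      have sub: "(\<Union>e\<in>S - H. Be e) \<subseteq> B" by (auto simp: Be_def)
      then show ?thesis unfolding B'_def
        using card_mono[OF fB sub] by (subst card_Diff_subset) (auto intro: finite_subset fB simp: of_nat_diff)
    qed
    ultimately have half: "real (card B) \<le> 2 * real (card B')" by linarith
    then have B'0: "real (card B') > 0" using cB by linarith
    then have B'ne: "B' \<noteq> {}" by auto
    have B'A: "B' \<subseteq> A" using Suc.prems(1) by (auto simp: B'_def)
    have "S - H \<subseteq> S - supp n B'"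
    proof
      fix e assume e: "e \<in> S - H"
      then have "\<forall>b\<in>B'. b (fst e) \<noteq> snd e" by (auto simp: B'_def Be_def)
      then have "e \<notin> supp n B'" by (auto simp: supp_def)
      then show "e \<in> S - supp n B'" using e by blast
    qed
    then have "real (card (S - H)) \<le> real (card (S - supp n B'))"
      using fS by (simp add: card_mono)
    also have "\<dots> \<le> real n * ln (real (card A) / real (card B'))"
      unfolding S_def by (rule rob[OF B'A B'ne])
    also have "\<dots> \<le> real n * (real t * ln (2 * M))"
    proof (intro mult_left_mono)
      have "real (card A) / real (card B') \<le> 2 * (2 * M) ^ i"
      proof -
        have "real (card A) \<le> real (card B) * (2 * M) ^ i" using Suc.prems(3) by (simp add: M_def)
        also have "\<dots> \<le> 2 * real (card B') * (2 * M) ^ i"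
          using half M0 by (intro mult_right_mono) auto
        finally show ?thesis using B'0 by (simp add: field_simps)
      qed
      also have "\<dots> \<le> (2 * M) * (2 * M) ^ i" using M1 by (intro mult_right_mono) auto
      finally have le: "real (card A) / real (card B') \<le> (2 * M) ^ Suc i" by simp
      have "card A > 0" using B'A B'ne fin by (simp add: card_gt_0_iff) blast
      then have "ln (real (card A) / real (card B')) \<le> ln ((2 * M) ^ Suc i)"
        using le B'0 by (intro ln_mono) auto
      also have "\<dots> = real (Suc i) * ln (2 * M)" using M0 by (subst ln_realpow) auto
      also have "\<dots> \<le> real t * ln (2 * M)"
        using Suc.prems(4) lp by (intro mult_right_mono) auto
      finally show "ln (real (card A) / real (card B')) \<le> real t * ln (2 * M)" .
    qed simp
    finally show ?thesis by (simp add: \<beta>_def)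
  qed
  define L where "L k = {es :: (nat \<times> nat) list. length es = k \<and> set es \<subseteq> S}" for k
  have L: "finite (L k)" "real (card (L k)) \<le> M ^ k" for k
  proof -
    have e: "L k = {xs. set xs \<subseteq> S \<and> length xs = k}" by (auto simp: L_def)
    show "finite (L k)" unfolding e using fS by (rule finite_lists_length_eq)
    show "real (card (L k)) \<le> M ^ k"
      unfolding e card_lists_length_eq[OF fS] using cS by (simp add: power_mono)
  qed
  define bad where "bad B k = {es \<in> L k. \<not> realised B es}" for B k
  have IH: "real (card (bad (Be e) j)) \<le> real j * \<beta> * M ^ (j - 1)" if e: "e \<in> H" for e
  proof -
    have h: "real (card (Be e)) * (2 * M) \<ge> real (card B)" using e by (simp add: H_def)
    have "real (card A) \<le> real (card B) * (2 * M) ^ i" using Suc.prems(3) by (simp add: M_def)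
    also have "\<dots> \<le> real (card (Be e)) * (2 * M) * (2 * M) ^ i" using h M0 by (intro mult_right_mono) auto
    finally have "real (card A) \<le> real (card (Be e)) * (2 * M) ^ Suc i" by simp
    moreover have "Be e \<subseteq> A" using Suc.prems(1) by (auto simp: Be_def)
    moreover have "Be e \<noteq> {}" using h cB by auto
    ultimately show ?thesis
      using Suc.IH[of "Be e" "Suc i"] Suc.prems(4) by (simp add: bad_def L_def S_def \<beta>_def M_def)
  qed
  \<comment> \<open>A bad list starts with a light edge and continues arbitrarily, or starts with a
    heavy edge and continues with a list that is bad for \<open>Be e\<close>. The latter family
    satisfies the invariant for \<open>Suc i\<close>.\<close>
  have "bad B (Suc j) \<subseteq> (\<lambda>(e,es). e # es) ` ((S - H) \<times> L j) \<union> (\<Union>e\<in>H. (#) e ` bad (Be e) j)"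
  proof
    fix es assume es: "es \<in> bad B (Suc j)"
    then obtain e es' where e: "es = e # es'" by (cases es) (auto simp: bad_def L_def)
    have e2: "e \<in> S" "es' \<in> L j" using es e by (auto simp: bad_def L_def)
    show "es \<in> (\<lambda>(e,es). e # es) ` ((S - H) \<times> L j) \<union> (\<Union>e\<in>H. (#) e ` bad (Be e) j)"
    proof (cases "e \<in> H")
      case True
      have "\<not> realised (Be e) es'"
        using es e by (fastforce simp: bad_def realised_def Be_def)
      then show ?thesis using True e e2 by (auto simp: bad_def)
    qed (use e e2 in auto)
  qed
  then have "card (bad B (Suc j)) \<le> card ((\<lambda>(e,es). e # es) ` ((S - H) \<times> L j) \<union> (\<Union>e\<in>H. (#) e ` bad (Be e) j))"
    using fS L(1) by (intro card_mono) (auto simp: H_def bad_def)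
  also have "\<dots> \<le> card ((\<lambda>(e,es). e # es) ` ((S - H) \<times> L j)) + card (\<Union>e\<in>H. (#) e ` bad (Be e) j)"
    by (rule card_Un_le)
  also have "\<dots> \<le> card (S - H) * card (L j) + (\<Sum>e\<in>H. card (bad (Be e) j))"
  proof (rule add_mono)
    show "card ((\<lambda>(e,es). e # es) ` ((S - H) \<times> L j)) \<le> card (S - H) * card (L j)"
      using card_image_le[of "(S - H) \<times> L j"] fS L(1) by (simp add: card_cartesian_product)
    have "card (\<Union>e\<in>H. (#) e ` bad (Be e) j) \<le> (\<Sum>e\<in>H. card ((#) e ` bad (Be e) j))"
      using fS by (intro card_UN_le) (auto simp: H_def)
    also have "\<dots> \<le> (\<Sum>e\<in>H. card (bad (Be e) j))"
      by (intro sum_mono card_image_le) (auto simp: bad_def L(1))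
    finally show "card (\<Union>e\<in>H. (#) e ` bad (Be e) j) \<le> (\<Sum>e\<in>H. card (bad (Be e) j))" .
  qed
  finally have "real (card (bad B (Suc j))) \<le> real (card (S - H)) * real (card (L j)) + (\<Sum>e\<in>H. real (card (bad (Be e) j)))"
    by (metis of_nat_add of_nat_le_iff of_nat_mult of_nat_sum)
  also have "\<dots> \<le> \<beta> * M ^ j + (\<Sum>e\<in>H. real j * \<beta> * M ^ (j - 1))"
    using light L(2) \<beta>0 IH by (intro add_mono mult_mono sum_mono) auto
  also have "(\<Sum>e\<in>H. real j * \<beta> * M ^ (j - 1)) \<le> M * (real j * \<beta> * M ^ (j - 1))"
  proof -
    have "card H \<le> card S" using fS by (intro card_mono) (auto simp: H_def)
    then have "real (card H) \<le> M" using cS by linarith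
    then show ?thesis using \<beta>0 M0 by (simp add: mult_right_mono)
  qed
  also have "M * (real j * \<beta> * M ^ (j - 1)) = real j * \<beta> * M ^ j"
    by (cases j) auto
  finally show ?case by (simp add: bad_def L_def S_def \<beta>_def M_def algebra_simps)
qed

section \<open>Two-step walks through the supports of two families\<close>

definition adj :: "(nat \<times> nat) set \<Rightarrow> nat \<Rightarrow> nat \<Rightarrow> real" where
  "adj S u w = (if (u,w) \<in> S then 1 else 0)"

definition two_step :: "nat \<Rightarrow> (nat \<times> nat) set \<Rightarrow> (nat \<times> nat) set \<Rightarrow> nat \<Rightarrow> nat \<Rightarrow> real" where
  "two_step n S T u l = (\<Sum>w<n. adj S u w * adj T w l)"

text \<open>Expanding the right-hand product gives a sum over all ways to choose a support edge at
  every \<open>u\<close>. Each \<open>a\<close> in \<open>A\<close> is one such choice, distinct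
  maps give distinct choices, and a permutation contributes exactly the product of all
  \<open>g w\<close>.\<close>

lemma prod_supp_ge:
  assumes perm: "\<And>a. a \<in> A \<Longrightarrow> a permutes {..<n}" and g: "\<And>w. g w \<ge> (0::real)"
  shows "real (card A) * (\<Prod>w<n. g w) \<le> (\<Prod>u<n. \<Sum>w<n. adj (supp n A) u w * g w)"
proof -
  define S where "S u = {w\<in>{..<n}. (u,w) \<in> supp n A}" for u
  define r where "r a = restrict a {..<n}" for a :: "nat \<Rightarrow> nat"
  have fA: "finite A" by (rule finite_subset[OF _ finite_permutations[of "{..<n}"]]) (use perm in auto)
  have S: "(\<Sum>w<n. adj (supp n A) u w * g w) = (\<Sum>w\<in>S u. g w)" for u
    unfolding S_def by (subst sum.inter_filter) (auto simp: adj_def intro!: sum.cong)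
  have inj: "inj_on r A"
  proof (rule inj_onI)
    fix a b assume ab: "a \<in> A" "b \<in> A" "r a = r b"
    show "a = b"
    proof
      fix x show "a x = b x"
        using fun_cong[OF ab(3), of x] perm[OF ab(1)] perm[OF ab(2)]
        by (cases "x < n") (auto simp: r_def permutes_not_in)
    qed
  qed
  have pr: "(\<Prod>u<n. g (r a u)) = (\<Prod>w<n. g w)" if "a \<in> A" for a
  proof -
    have "(\<Prod>u<n. g (r a u)) = (\<Prod>u<n. g (a u))" by (auto simp: r_def intro: prod.cong)
    then show ?thesis using prod.permute[OF perm[OF that], of g] by (simp add: comp_def)
  qed
  have sub: "r ` A \<subseteq> PiE {..<n} S"
  proof (clarify)
    fix a assume a: "a \<in> A"
    then have "a u \<in> S u" if "u < n" for u
      using that permutes_in_image[OF perm[OF a], of u] by (auto simp: S_def supp_def)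
    then show "r a \<in> PiE {..<n} S" by (auto simp: r_def)
  qed
  have "real (card A) * (\<Prod>w<n. g w) = (\<Sum>a\<in>A. \<Prod>u<n. g (r a u))" using pr by simp
  also have "\<dots> = (\<Sum>\<phi>\<in>r ` A. \<Prod>u<n. g (\<phi> u))" using inj by (simp add: sum.reindex)
  also have "\<dots> \<le> (\<Sum>\<phi>\<in>PiE {..<n} S. \<Prod>u<n. g (\<phi> u))"
    using sub g by (intro sum_mono2 finite_PiE) (auto simp: S_def intro!: prod_nonneg)
  also have "\<dots> = (\<Prod>u<n. \<Sum>w\<in>S u. g w)"
    by (rule prod_sum_PiE[symmetric]) (auto simp: S_def)
  finally show ?thesis by (simp add: S)
qed

text \<open>One step of the walk applies \<open>prod_supp_ge\<close> for \<open>B\<close> and for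
  \<open>A\<close>, with the row sums as weights. The product over the rows, not their sum, is what
  permutations leave unchanged, so growth is measured by the geometric mean.\<close>

lemma two_step_growth:
  assumes A: "\<And>a. a \<in> A \<Longrightarrow> a permutes {..<n}" and B: "\<And>b. b \<in> B \<Longrightarrow> b permutes {..<n}"
  defines "K \<equiv> two_step n (supp n A) (supp n B)"
  shows "(real (card A) * real (card B)) ^ t \<le> (\<Prod>u<n. \<Sum>j<n. mpow n K t u j)"
proof (induction t)
  case 0
  have "(\<Sum>j<n. mpow n K 0 u j) = 1" if "u < n" for u
    using that by simp
  then show ?case by simp
next
  case (Suc t)
  define r where "r t u = (\<Sum>j<n. mpow n K t u j)" for t u
  have K0: "K i j \<ge> 0" for i j by (auto simp: K_def two_step_def adj_def intro!: sum_nonneg)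
  have r0: "r t u \<ge> 0" for t u using mpow_nonneg[of K n] K0 by (auto simp: r_def intro!: sum_nonneg)
  define h where "h w = (\<Sum>l<n. adj (supp n B) w l * r t l)" for w
  have h0: "h w \<ge> 0" for w using r0 by (auto simp: h_def adj_def intro!: sum_nonneg)
  have rS: "r (Suc t) u = (\<Sum>w<n. adj (supp n A) u w * h w)" for u
  proof -
    have "r (Suc t) u = (\<Sum>l<n. K u l * r t l)"
      unfolding r_def by (simp add: sum_distrib_left) (rule sum.swap)
    also have "\<dots> = (\<Sum>l<n. \<Sum>w<n. adj (supp n A) u w * adj (supp n B) w l * r t l)"
      by (simp add: K_def two_step_def sum_distrib_right)
    also have "\<dots> = (\<Sum>w<n. adj (supp n A) u w * h w)"
      by (subst sum.swap) (simp add: h_def sum_distrib_left mult.assoc)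
    finally show ?thesis .
  qed
  have "(real (card A) * real (card B)) ^ Suc t = real (card A) * (real (card B) * (real (card A) * real (card B)) ^ t)"
    by simp
  also have "\<dots> \<le> real (card A) * (real (card B) * (\<Prod>u<n. r t u))"
    using Suc unfolding r_def by (intro mult_left_mono) auto
  also have "\<dots> \<le> real (card A) * (\<Prod>w<n. h w)"
    unfolding h_def using prod_supp_ge[of B n "r t"] B r0 by (intro mult_left_mono) auto
  also have "\<dots> \<le> (\<Prod>u<n. r (Suc t) u)"
    unfolding rS using prod_supp_ge[of A n h] A h0 by auto
  finally show ?case by (simp only: r_def)
qed

text \<open>A two-step walk is stored as the list of its first steps \<open>(u,w)\<close>; the second steps
  \<open>(w,l)\<close> are recovered from consecutive entries and the end point.\<close>

fun walk :: "(nat \<times> nat) set \<Rightarrow> (nat \<times> nat) set \<Rightarrow> nat \<Rightarrow> (nat \<times> nat) list \<Rightarrow> nat \<Rightarrow> bool" where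
  "walk S T u [] v = (u = v)"
| "walk S T u (e # es) v = (fst e = u \<and> e \<in> S \<and> (\<exists>l. (snd e, l) \<in> T \<and> walk S T l es v))"

fun links :: "(nat \<times> nat) list \<Rightarrow> nat \<Rightarrow> (nat \<times> nat) list" where
  "links [] v = []"
| "links (e # es) v = (snd e, if es = [] then v else fst (hd es)) # links es v"

lemma walk_start: "walk S T u es v \<Longrightarrow> u = (if es = [] then v else fst (hd es))"
  by (cases es) auto

lemma walk_edges:
  "walk S T u es v \<Longrightarrow> set es \<subseteq> S \<and> set (links es v) \<subseteq> T"
proof (induction es arbitrary: u)
  case (Cons e es)
  then obtain l where l: "(snd e, l) \<in> T" "walk S T l es v" and e: "e \<in> S" by auto
  show ?case using Cons.IH[OF l(2)] l e walk_start[OF l(2)] by auto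
qed simp

lemma length_links [simp]: "length (links es v) = length es"
  by (induction es) auto

text \<open>The links forget only the very first starting point. In a closed walk this is the end
  point \<open>v\<close>, which the last link records, so a closed walk can be recovered from its
  second steps alone.\<close>

lemma links_inj:
  "links es v = links es' v' \<Longrightarrow> es \<noteq> [] \<Longrightarrow> v = v' \<and> map snd es = map snd es' \<and> map fst (tl es) = map fst (tl es')"
proof (induction es arbitrary: es')
  case (Cons e es)
  then obtain f fs where es': "es' = f # fs" by (cases es') auto
  have len: "es = [] \<longleftrightarrow> fs = []"
    using arg_cong[OF Cons.prems(1), of length] es' by auto
  show ?case
  proof (cases "es = []")
    case False
    then show ?thesis using Cons.IH[of fs] Cons.prems(1) len es' by (cases es; cases fs) auto
  qed (use Cons.prems es' len in auto)
qed simp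

lemma card_walks:
  assumes S: "S \<subseteq> {..<n} \<times> {..<n}" and T: "T \<subseteq> {..<n} \<times> {..<n}"
  shows "finite {es. length es = t \<and> walk S T u es v} \<and>
    (u < n \<longrightarrow> real (card {es. length es = t \<and> walk S T u es v}) = mpow n (two_step n S T) t u v)"
proof (induction t arbitrary: u)
  case 0
  have "{es. length es = 0 \<and> walk S T u es v} = (if u = v then {[]} else {})" by auto
  then show ?case by simp
next
  case (Suc t)
  define W where "W t u = {es. length es = t \<and> walk S T u es v}" for t u
  define P where "P = {(w,l). (u,w) \<in> S \<and> (w,l) \<in> T}"
  have "P \<subseteq> {..<n} \<times> {..<n}" using S T by (auto simp: P_def)
  then have fP: "finite P" using finite_subset by blast
  have e: "W (Suc t) u = (\<Union>(w,l)\<in>P. (#) (u,w) ` W t l)"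
  proof (intro subset_antisym subsetI)
    fix es assume "es \<in> W (Suc t) u"
    then obtain x w es' l where "es = (x,w) # es'" "x = u" "(x,w) \<in> S" "(w,l) \<in> T" "walk S T l es' v" "length es' = t"
      by (cases es) (auto simp: W_def)
    then show "es \<in> (\<Union>(w,l)\<in>P. (#) (u,w) ` W t l)" by (auto simp: P_def W_def)
  qed (auto simp: W_def P_def)
  have fW: "finite (W t l)" for l using Suc by (auto simp: W_def)
  have fin: "finite (W (Suc t) u)" unfolding e using fP fW by auto
  have "real (card (W (Suc t) u)) = mpow n (two_step n S T) (Suc t) u v" if u: "u < n"
  proof -
    have "card (W (Suc t) u) = (\<Sum>p\<in>P. card (case p of (w,l) \<Rightarrow> (#) (u,w) ` W t l))"
      unfolding e
    proof (rule card_UN_disjoint[OF fP])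
      show "\<forall>p\<in>P. finite (case p of (w,l) \<Rightarrow> (#) (u,w) ` W t l)" using fW by auto
      \<comment> \<open>The head of the list determines \<open>w\<close>, and \<open>l\<close> is
        the starting point of the tail, so different pairs give disjoint classes.\<close>
      show "\<forall>p\<in>P. \<forall>q\<in>P. p \<noteq> q \<longrightarrow> (case p of (w,l) \<Rightarrow> (#) (u,w) ` W t l) \<inter> (case q of (w,l) \<Rightarrow> (#) (u,w) ` W t l) = {}"
        by (auto simp: W_def dest!: walk_start)
    qed
    also have "\<dots> = (\<Sum>(w,l)\<in>P. card (W t l))"
      by (intro sum.cong) (auto simp: card_image)
    finally have "real (card (W (Suc t) u)) = (\<Sum>(w,l)\<in>P. real (card (W t l)))"
      by (simp add: case_prod_beta)
    also have "\<dots> = (\<Sum>(w,l)\<in>P. mpow n (two_step n S T) t l v)"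
      using Suc T by (intro sum.cong) (auto simp: W_def P_def)
    also have "\<dots> = (\<Sum>(w,l)\<in>{..<n}\<times>{..<n}. adj S u w * adj T w l * mpow n (two_step n S T) t l v)"
      using \<open>P \<subseteq> {..<n} \<times> {..<n}\<close> by (intro sum.mono_neutral_cong_left) (auto simp: P_def adj_def)
    also have "\<dots> = (\<Sum>w<n. \<Sum>l<n. adj S u w * adj T w l * mpow n (two_step n S T) t l v)"
      by (simp add: sum.cartesian_product)
    also have "\<dots> = mpow n (two_step n S T) (Suc t) u v"
      by (subst sum.swap) (simp add: two_step_def sum_distrib_right)
    finally show ?thesis .
  qed
  then show ?case using fin by (simp add: W_def)
qed

lemma realised_closed_walk:
  assumes "walk S T u es v" "\<forall>(x,w)\<in>set es. a x = w" "\<forall>(w,l)\<in>set (links es v). b w = l"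
  shows "((b \<circ> a) ^^ length es) u = v"
  using assms
proof (induction es arbitrary: u)
  case (Cons e es)
  then obtain l where l: "walk S T l es v" and e: "fst e = u" by auto
  have 1: "(b \<circ> a) u = l" using Cons.prems e walk_start[OF l] by (auto simp: case_prod_beta)
  have 2: "((b \<circ> a) ^^ length es) l = v" by (rule Cons.IH[OF l]) (use Cons.prems in auto)
  have 3: "((b \<circ> a) ^^ length (e # es)) u = ((b \<circ> a) ^^ length es) ((b \<circ> a) u)"
    unfolding length_Cons funpow_Suc_right by (rule comp_apply)
  show ?case unfolding 3 1 2 ..
qed simp

text \<open>At least \<open>(c/2) ^ t / 2\<close> closed walks exist, and \<open>big\<close> says
  that the unrealisable lists for \<open>A\<close> and \<open>B\<close> together are fewer. A closed
  walk avoiding both kinds has all its first steps in one \<open>a\<close> and all its second steps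
  in one \<open>b\<close>, and \<open>b \<circ> a\<close> follows it.\<close>

lemma robust_short_cycle:
  assumes n: "n > 0" and A: "\<And>a. a \<in> A \<Longrightarrow> a permutes {..<n}" and B: "\<And>b. b \<in> B \<Longrightarrow> b permutes {..<n}"
    and ne: "A \<noteq> {}" "B \<noteq> {}"
    and robA: "\<And>A'. A' \<subseteq> A \<Longrightarrow> A' \<noteq> {} \<Longrightarrow>
      real (card (supp n A - supp n A')) \<le> real n * ln (real (card A) / real (card A'))"
    and robB: "\<And>B'. B' \<subseteq> B \<Longrightarrow> B' \<noteq> {} \<Longrightarrow>
      real (card (supp n B - supp n B')) \<le> real n * ln (real (card B) / real (card B'))"
    and c: "c > 0" "c ^ n \<le> real (card A) * real (card B)"
    and m: "real m \<ge> 96 * real n ^ 4 / c\<^sup>2 + 8"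
    and big: "\<And>t. t \<in> {2..m} \<Longrightarrow>
      4 * (real t * (real n * (real t * ln (2 * real n ^ 2))) * (real n ^ 2) ^ (t - 1)) < (c/2) ^ t"
  shows "\<exists>a\<in>A. \<exists>b\<in>B. \<exists>u<n. \<exists>t\<in>{2..m}. ((b \<circ> a) ^^ t) u = u"
proof -
  define S where "S = supp n A"
  define T where "T = supp n B"
  define K where "K = two_step n S T"
  have clA: "\<forall>a\<in>A. \<forall>u<n. a u < n" using A permutes_in_image[of _ "{..<n}"] by fastforce
  have clB: "\<forall>a\<in>B. \<forall>u<n. a u < n" using B permutes_in_image[of _ "{..<n}"] by fastforce
  have fA: "finite A" by (rule finite_subset[OF _ finite_permutations[of "{..<n}"]]) (use A in auto)
  have fB: "finite B" by (rule finite_subset[OF _ finite_permutations[of "{..<n}"]]) (use B in auto)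
  have ST: "S \<subseteq> {..<n} \<times> {..<n}" "T \<subseteq> {..<n} \<times> {..<n}"
    unfolding S_def T_def using supp_subset[OF clA] supp_subset[OF clB] by auto
  have K0: "K i j \<ge> 0" for i j by (auto simp: K_def two_step_def adj_def intro!: sum_nonneg)
  have Kn: "K i j \<le> real n" for i j
  proof -
    have "K i j \<le> (\<Sum>w<n. 1)" unfolding K_def two_step_def by (intro sum_mono) (auto simp: adj_def)
    then show ?thesis by simp
  qed
  have F: "(\<Sum>i<n. \<Sum>j<n. (K i j)\<^sup>2) \<le> real n ^ 4"
  proof -
    have "(\<Sum>i<n. \<Sum>j<n. (K i j)\<^sup>2) \<le> (\<Sum>i<n. \<Sum>j<n. real n ^ 2)"
      using K0 Kn by (intro sum_mono power_mono) auto
    then show ?thesis by (simp add: power_numeral_reduce)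
  qed
  \<comment> \<open>The product of all row sums is at least \<open>(c ^ n) ^ t\<close>, so some row
    reaches \<open>c ^ t\<close>; which row it is may depend on \<open>t\<close>.\<close>
  have grow: "\<exists>i<n. (\<Sum>j<n. mpow n K t i j) \<ge> c ^ t" for t
  proof (rule ccontr)
    assume "\<not> ?thesis"
    then have lt: "(\<Sum>j<n. mpow n K t i j) < c ^ t" if "i < n" for i using that by (meson not_less)
    have "(\<Prod>u<n. \<Sum>j<n. mpow n K t u j) < (\<Prod>u<n. c ^ t)"
      using lt n c(1) mpow_nonneg[of K n] K0
      by (intro prod_mono_strict) (auto intro!: sum_nonneg intro: less_imp_le)
    also have "\<dots> = (c ^ n) ^ t" by (simp add: mult.commute flip: power_mult)
    also have "\<dots> \<le> (real (card A) * real (card B)) ^ t" using c by (intro power_mono) auto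
    also have "\<dots> \<le> (\<Prod>u<n. \<Sum>j<n. mpow n K t u j)"
      unfolding K_def S_def T_def by (rule two_step_growth[OF A B])
    finally show False by simp
  qed
  have m': "real m \<ge> 24 * (4 * real n ^ 4 / c\<^sup>2) + 8" using m by simp
  from mpow_trace_lower[OF n c(1) K0 F grow m']
  obtain t where t: "t \<in> {2..m}" "(\<Sum>u<n. mpow n K t u u) \<ge> (c/2) ^ t / 2" by blast
  define W where "W u = {es. length es = t \<and> walk S T u es u}" for u
  define C where "C = (\<Union>u<n. W u)"
  have fW: "finite (W u)" for u using card_walks[OF ST] by (simp add: W_def)
  have cW: "real (card (W u)) = mpow n K t u u" if "u < n" for u
    using card_walks[OF ST] that by (simp add: W_def K_def)
  have st: "fst (hd es) = u" "es \<noteq> []" if "es \<in> W u" for es u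
    using that t(1) walk_start[of S T u es u] by (auto simp: W_def split: if_splits)
  have "card C = (\<Sum>u<n. card (W u))"
    unfolding C_def using fW st by (intro card_UN_disjoint) blast+
  then have cC: "real (card C) \<ge> (c/2) ^ t / 2" using cW t(2) by simp
  have fC: "finite C" using fW by (simp add: C_def)
  define badA where "badA = {es. length es = t \<and> set es \<subseteq> S \<and> \<not> realised A es}"
  define badB where "badB = {es. length es = t \<and> set es \<subseteq> T \<and> \<not> realised B es}"
  define \<beta> where "\<beta> = real t * (real n * (real t * ln (2 * real n ^ 2))) * (real n ^ 2) ^ (t - 1)"
  have bA: "real (card badA) \<le> \<beta>"
    unfolding badA_def \<beta>_def S_def by (rule unrealised_card[where i = 0, OF fA n clA robA]) (use ne in auto)
  have bB: "real (card badB) \<le> \<beta>"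
    unfolding badB_def \<beta>_def T_def by (rule unrealised_card[where i = 0, OF fB n clB robB]) (use ne in auto)
  have fin_lists: "finite {es. length es = t \<and> set es \<subseteq> X}" if "X \<subseteq> {..<n} \<times> {..<n}" for X
    using finite_lists_length_eq[of X t] that finite_subset[OF that] by (simp add: conj_commute)
  have fbad: "finite badA" "finite badB"
    using finite_subset[OF _ fin_lists[OF ST(1)], of badA] finite_subset[OF _ fin_lists[OF ST(2)], of badB]
    by (auto simp: badA_def badB_def)
  define L where "L es = links es (fst (hd es))" for es
  have injL: "inj_on L C"
  proof (rule inj_onI)
    fix x y assume xy: "x \<in> C" "y \<in> C" "L x = L y"
    then have ne: "x \<noteq> []" "y \<noteq> []" using st by (auto simp: C_def)
    from links_inj[OF xy(3)[unfolded L_def] ne(1)]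
    have h: "fst (hd x) = fst (hd y)" "map snd x = map snd y" "map fst (tl x) = map fst (tl y)" by auto
    then have "map fst x = map fst y" using ne by (cases x; cases y) auto
    then show "x = y" using h(2) by (metis zip_map_fst_snd)
  qed
  have "\<not> C \<subseteq> badA \<union> (L -` badB \<inter> C)"
  proof
    assume "C \<subseteq> badA \<union> (L -` badB \<inter> C)"
    then have "card C \<le> card (badA \<union> (L -` badB \<inter> C))" using fbad fC by (intro card_mono) auto
    also have "\<dots> \<le> card badA + card (L -` badB \<inter> C)" by (rule card_Un_le)
    also have "card (L -` badB \<inter> C) \<le> card badB"
      using injL fbad by (intro card_inj_on_le[of L]) (auto intro: inj_on_subset)
    finally have "real (card C) \<le> 2 * \<beta>" using bA bB by linarith
    then show False using cC big[OF t(1)] by (simp add: \<beta>_def)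
  qed
  then obtain es where es: "es \<in> C" "es \<notin> badA" "L es \<notin> badB" by blast
  then obtain u where u: "u < n" "es \<in> W u" by (auto simp: C_def)
  then have w: "walk S T u es u" "length es = t" by (auto simp: W_def)
  have "realised A es" using es(2) w walk_edges[OF w(1)] by (auto simp: badA_def)
  then obtain a where a: "a \<in> A" "\<forall>(x,w)\<in>set es. a x = w" by (auto simp: realised_def)
  have "realised B (links es u)" using es(3) w walk_edges[OF w(1)] st[OF u(2)] by (auto simp: badB_def L_def)
  then obtain b where b: "b \<in> B" "\<forall>(w,l)\<in>set (links es u). b w = l" by (auto simp: realised_def)
  from realised_closed_walk[OF w(1) a(2) b(2)] have "((b \<circ> a) ^^ t) u = u" using w by simp
  then show ?thesis using a b u t by blast
qed

theorem short_cycle: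
  assumes n: "n > 0" and A: "\<And>a. a \<in> A \<Longrightarrow> a permutes {..<n}" and B: "\<And>b. b \<in> B \<Longrightarrow> b permutes {..<n}"
    and ne: "A \<noteq> {}" "B \<noteq> {}"
    and Q1: "Q \<ge> 1" and Q: "real (card A) \<ge> fact n / Q ^ n" "real (card B) \<ge> fact n / Q ^ n"
    and m: "real m \<ge> 96 * (exp 2 * Q) ^ 4 + 8"
    and big: "4 * real m ^ 2 * ln (2 * real n ^ 2) * (2 * (exp 2 * Q)\<^sup>2) ^ m < real n"
  shows "\<exists>a\<in>A. \<exists>b\<in>B. \<exists>u<n. \<exists>t\<in>{2..m}. ((b \<circ> a) ^^ t) u = u"
proof -
  have Q: "Q > 0" "real (card A) \<ge> fact n / Q ^ n" "real (card B) \<ge> fact n / Q ^ n" using Q Q1 by auto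
  \<comment> \<open>Since \<open>fact n\<close> is at least \<open>(n / exp 1) ^ n\<close>, density
    \<open>1 / Q ^ n\<close> leaves \<open>(n / (exp 1 * Q)) ^ n\<close> maps in each family, and
    robustness costs another \<open>exp n\<close>. Hence \<open>exp 2 * Q\<close>, and a square for
    the two families.\<close>
  define c where "c = (real n / (exp 2 * Q))\<^sup>2"
  have c: "c > 0" using n Q by (simp add: c_def)
  have clA: "\<forall>a\<in>A. \<forall>u<n. a u < n" using A permutes_in_image[of _ "{..<n}"] by fastforce
  have clB: "\<forall>a\<in>B. \<forall>u<n. a u < n" using B permutes_in_image[of _ "{..<n}"] by fastforce
  have fA: "finite A" by (rule finite_subset[OF _ finite_permutations[of "{..<n}"]]) (use A in auto)
  have fB: "finite B" by (rule finite_subset[OF _ finite_permutations[of "{..<n}"]]) (use B in auto)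
  obtain A' where A': "A' \<subseteq> A" "A' \<noteq> {}" "real (card A) \<le> exp (real n) * real (card A')"
    "\<And>B. B \<subseteq> A' \<Longrightarrow> B \<noteq> {} \<Longrightarrow>
      real (card (supp n A' - supp n B)) \<le> real n * ln (real (card A') / real (card B))"
    using robust_subset[OF fA ne(1) n clA] by metis
  obtain B' where B': "B' \<subseteq> B" "B' \<noteq> {}" "real (card B) \<le> exp (real n) * real (card B')"
    "\<And>X. X \<subseteq> B' \<Longrightarrow> X \<noteq> {} \<Longrightarrow>
      real (card (supp n B' - supp n X)) \<le> real n * ln (real (card B') / real (card X))"
    using robust_subset[OF fB ne(2) n clB] by metis
  have fac: "(real n / exp 1) ^ n \<le> fact n"
  proof -
    have "(\<Sum>i\<in>{n}. real n ^ i /\<^sub>R fact i) \<le> exp (real n)"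
      unfolding exp_def using summable_exp_generic[of "real n"] by (intro sum_le_suminf) auto
    then show ?thesis by (simp add: power_divide field_simps exp_of_nat_mult[symmetric])
  qed
  have low: "(real n / (exp 2 * Q)) ^ n \<le> real (card X)"
    if "real (card Y) \<ge> fact n / Q ^ n" "real (card Y) \<le> exp (real n) * real (card X)" for X Y :: "(nat \<Rightarrow> nat) set"
  proof -
    have "(real n / (exp 2 * Q)) ^ n = (real n / exp 1) ^ n / Q ^ n / exp 1 ^ n"
    proof -
      have e2: "exp 2 = exp 1 * exp (1::real)" using exp_add[of 1 "1::real"] by (simp only: one_add_one)
      have "exp 2 * Q = exp 1 * Q * exp 1" unfolding e2 by (simp only: ac_simps)
      then have "real n / (exp 2 * Q) = real n / exp 1 / Q / exp 1" by (simp only: divide_divide_eq_left)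
      then show ?thesis by (simp only: power_divide)
    qed
    also have "\<dots> \<le> fact n / Q ^ n / exp 1 ^ n" using fac Q by (intro divide_right_mono) auto
    also have "\<dots> \<le> exp (real n) * real (card X) / exp 1 ^ n" using that by (intro divide_right_mono) auto
    also have "\<dots> = real (card X)" by (simp add: exp_of_nat_mult[symmetric])
    finally show ?thesis .
  qed
  have "c ^ n = (real n / (exp 2 * Q)) ^ n * (real n / (exp 2 * Q)) ^ n"
    unfolding c_def power2_eq_square by (rule power_mult_distrib)
  also have "\<dots> \<le> real (card A') * real (card B')"
    using low[OF Q(2) A'(3)] low[OF Q(3) B'(3)] Q n by (intro mult_mono) auto
  finally have cn: "c ^ n \<le> real (card A') * real (card B')" .
  have "real n ^ 4 / c\<^sup>2 = (exp 2 * Q) ^ 4"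
    using n Q by (simp add: c_def power_divide flip: power_mult)
  then have m': "real m \<ge> 96 * real n ^ 4 / c\<^sup>2 + 8" using m by simp
  define D where "D = 2 * (exp 2 * Q)\<^sup>2"
  have D: "D > 0" using Q by (simp add: D_def)
  have cD: "c / 2 = real n ^ 2 / D" by (simp add: c_def D_def power_divide)
  have D1: "D \<ge> 1"
  proof -
    have "1 * 1 \<le> exp 2 * Q" using Q1 by (intro mult_mono) auto
    then have "1\<^sup>2 \<le> (exp 2 * Q)\<^sup>2" by (intro power_mono) auto
    then show ?thesis by (simp add: D_def)
  qed
  have "\<exists>a\<in>A'. \<exists>b\<in>B'. \<exists>u<n. \<exists>t\<in>{2..m}. ((b \<circ> a) ^^ t) u = u"
  proof (rule robust_short_cycle[OF n _ _ A'(2) B'(2) A'(4) B'(4) c cn m'])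
    fix t assume t: "t \<in> {2..m}"
    have "1 \<le> real n ^ 2" using n by (intro one_le_power) simp
    then have l: "ln (2 * real n ^ 2) \<ge> 0" by (intro ln_ge_zero) simp
    \<comment> \<open>After division by \<open>n ^ (2 * t - 1)\<close> the left side of the
      requirement increases with \<open>t\<close>, because \<open>D\<close> is at least
      \<open>1\<close>; its instance at \<open>m\<close> therefore suffices.\<close>
    have "4 * real t ^ 2 * ln (2 * real n ^ 2) * D ^ t \<le> 4 * real m ^ 2 * ln (2 * real n ^ 2) * D ^ m"
      using t D1 l by (intro mult_mono power_increasing power_mono) auto
    also have "\<dots> < real n" using big by (simp add: D_def)
    finally have "4 * real t ^ 2 * ln (2 * real n ^ 2) * D ^ t * (real n * (real n ^ 2) ^ (t - 1)) < real n * (real n * (real n ^ 2) ^ (t - 1))"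
      using n by (intro mult_strict_right_mono) auto
    also have "\<dots> = (real n ^ 2) ^ t" using t by (cases t) (auto simp: power2_eq_square)
    finally have "4 * real t ^ 2 * ln (2 * real n ^ 2) * (real n * (real n ^ 2) ^ (t - 1)) * D ^ t < (real n ^ 2) ^ t"
      by (simp add: mult_ac)
    then have "4 * real t ^ 2 * ln (2 * real n ^ 2) * (real n * (real n ^ 2) ^ (t - 1)) < (real n ^ 2) ^ t / D ^ t"
      using D by (simp add: field_simps)
    then show "4 * (real t * (real n * (real t * ln (2 * real n ^ 2))) * (real n ^ 2) ^ (t - 1)) < (c/2) ^ t"
      unfolding cD by (simp add: power_divide power2_eq_square mult_ac)
  qed (use A B A'(1) B'(1) in auto)
  then show ?thesis using A'(1) B'(1) by blast
qed

section \<open>Monomials of tropical circuits\<close>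

text \<open>Exponent vectors of the monomials of the formal polynomial computed at a node.\<close>

inductive mon :: "('x, 'n) circuit \<Rightarrow> 'n \<Rightarrow> ('x \<Rightarrow> nat) \<Rightarrow> bool" for C where
  mon_Var: "gate_of C n = Var x \<Longrightarrow> mon C n (\<lambda>y. if y = x then 1 else 0)"
| mon_Zero: "gate_of C n = Zero \<Longrightarrow> mon C n (\<lambda>_. 0)"
| mon_Plus: "gate_of C n = Plus a b \<Longrightarrow> mon C a f \<Longrightarrow> mon C b g \<Longrightarrow> mon C n (\<lambda>y. f y + g y)"
| mon_Max1: "gate_of C n = MaxG a b \<Longrightarrow> mon C a f \<Longrightarrow> mon C n f"
| mon_Max2: "gate_of C n = MaxG a b \<Longrightarrow> mon C b f \<Longrightarrow> mon C n f"

definition wt :: "'x set \<Rightarrow> ('x \<Rightarrow> real) \<Rightarrow> ('x \<Rightarrow> nat) \<Rightarrow> real" where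
  "wt E \<nu> f = (\<Sum>e\<in>E. real (f e) * \<nu> e)"

lemma wt_add: "wt E \<nu> (\<lambda>e. f e + g e) = wt E \<nu> f + wt E \<nu> g"
  by (simp add: wt_def distrib_right sum.distrib)

lemma wt_Var: "finite E \<Longrightarrow> x \<in> E \<Longrightarrow> wt E \<nu> (\<lambda>y. if y = x then 1 else 0) = \<nu> x"
  by (simp add: wt_def if_distrib[of "\<lambda>t. real t * _"] cong: if_cong)

lemma gate_closed:
  assumes C: "tropical_circuit E C" and n: "n \<in> nodes C"
  shows "gate_of C n = Plus a b \<Longrightarrow> a \<in> nodes C \<and> b \<in> nodes C"
    and "gate_of C n = MaxG a b \<Longrightarrow> a \<in> nodes C \<and> b \<in> nodes C"
    and "gate_of C n = Var x \<Longrightarrow> x \<in> E"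
  using C n by (force simp: tropical_circuit_def)+

context
  fixes C :: "('x, 'n) circuit" and E :: "'x set"
  assumes C: "tropical_circuit E C" and finE: "finite E"
begin

lemma mon_support: "mon C n f \<Longrightarrow> n \<in> nodes C \<Longrightarrow> e \<notin> E \<Longrightarrow> f e = 0"
  by (induction rule: mon.induct) (auto dest: gate_closed[OF C])

lemma mon_le_value: "mon C n f \<Longrightarrow> n \<in> nodes C \<Longrightarrow> node_value C \<nu> n r \<Longrightarrow> wt E \<nu> f \<le> r"
proof (induction arbitrary: r rule: mon.induct)
  case (mon_Var n x)
  from mon_Var(3) show ?case
    by cases (use mon_Var gate_closed(3)[OF C mon_Var(2,1)] wt_Var[OF finE] in auto)
next
  case (mon_Zero n)
  from mon_Zero(3) show ?case by cases (use mon_Zero in \<open>auto simp: wt_def\<close>)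
next
  case (mon_Plus n a b f g)
  from mon_Plus.prems(2) show ?case
    by cases (use mon_Plus gate_closed(1)[OF C mon_Plus.prems(1) mon_Plus.hyps(1)] in \<open>auto simp: wt_add intro: add_mono\<close>)
next
  case (mon_Max1 n a b f)
  from mon_Max1.prems(2) show ?case
    by cases (use mon_Max1 gate_closed(2)[OF C mon_Max1.prems(1) mon_Max1.hyps(1)] in \<open>auto intro: max.coboundedI1\<close>)
next
  case (mon_Max2 n a b f)
  from mon_Max2.prems(2) show ?case
    by cases (use mon_Max2 gate_closed(2)[OF C mon_Max2.prems(1) mon_Max2.hyps(1)] in \<open>auto intro: max.coboundedI2\<close>)
qed

text \<open>Together with \<open>mon_le_value\<close> this identifies the value of a node with the
  maximum weight of its monomials, which carries information from valuations over to
  monomials.\<close>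

lemma value_attained: "node_value C \<nu> n r \<Longrightarrow> n \<in> nodes C \<Longrightarrow> \<exists>f. mon C n f \<and> wt E \<nu> f = r"
proof (induction rule: node_value.induct)
  case (1 n x)
  then show ?case using mon_Var[OF 1(1)] wt_Var[OF finE gate_closed(3)[OF C 1(2,1)]] by blast
next
  case (2 n)
  then show ?case using mon_Zero[OF 2(1)] by (auto simp: wt_def)
next
  case (3 n a b r s)
  then show ?case using mon_Plus[OF 3(1)] gate_closed(1)[OF C 3(6,1)] wt_add by metis
next
  case (4 n a b r s)
  then show ?case using mon_Max1[OF 4(1)] mon_Max2[OF 4(1)] gate_closed(2)[OF C 4(6,1)]
    by (metis max_def)
qed

end

text \<open>The part of a parse tree outside the subtree at \<open>g\<close>. Because every monomial
  of \<open>g\<close> is allowed inside, contexts and monomials found for different outputs at the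
  same gate may be recombined; rectangles come from this.\<close>

definition mon_context :: "('x, 'n) circuit \<Rightarrow> 'n \<Rightarrow> 'n \<Rightarrow> ('x \<Rightarrow> nat) \<Rightarrow> bool" where
  "mon_context C r g c \<longleftrightarrow> (\<forall>m. mon C g m \<longrightarrow> mon C r (\<lambda>e. c e + m e))"

text \<open>Descend from the output to the heavier predecessor until the weight first drops to at most two thirds.\<close>

lemma balanced_split:
  assumes "mon C n f" "n \<in> nodes C" "mon_context C r n c" and C: "tropical_circuit E C"
    and add: "\<And>f g. W (\<lambda>e. f e + g e) = W f + W g" and W0: "W (\<lambda>_. 0) = (0::nat)"
    and W1: "\<And>x. W (\<lambda>y. if y = x then 1 else 0) \<le> 1" and T: "T \<ge> 2" and big: "3 * W f > 2 * T"
  shows "\<exists>g\<in>nodes C. \<exists>m c'. mon C g m \<and> mon_context C r g c' \<and> T \<le> 3 * W m \<and> 3 * W m \<le> 2 * T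
    \<and> (\<lambda>e. c' e + m e) = (\<lambda>e. c e + f e)"
  using assms(1-3) big
proof (induction arbitrary: c rule: mon.induct)
  case (mon_Var n x)
  \<comment> \<open>A leaf weighs at most \<open>1\<close>, but the weight here exceeds two thirds
    of \<open>T\<close>, hence \<open>4/3\<close>.\<close>
  then show ?case using W1[of x] T by linarith
next
  case (mon_Zero n)
  then show ?case using W0 by simp
next
  case (mon_Plus n a b f g)
  have nd: "a \<in> nodes C" "b \<in> nodes C" using gate_closed(1)[OF C mon_Plus.prems(1) mon_Plus.hyps(1)] by auto
  have ca: "mon_context C r a (\<lambda>e. c e + g e)"
    unfolding mon_context_def
  proof (intro allI impI)
    fix m assume "mon C a m"
    then have "mon C n (\<lambda>y. m y + g y)" by (rule mon.mon_Plus[OF mon_Plus.hyps(1) _ mon_Plus.hyps(3)])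
    then have "mon C r (\<lambda>e. c e + (m e + g e))"
      using mon_Plus.prems(2) unfolding mon_context_def by (elim allE) (erule mp)
    then show "mon C r (\<lambda>e. c e + g e + m e)" by (simp only: ac_simps)
  qed
  have cb: "mon_context C r b (\<lambda>e. c e + f e)"
    unfolding mon_context_def
  proof (intro allI impI)
    fix m assume "mon C b m"
    then have "mon C n (\<lambda>y. f y + m y)" by (rule mon.mon_Plus[OF mon_Plus.hyps(1,2)])
    then have "mon C r (\<lambda>e. c e + (f e + m e))"
      using mon_Plus.prems(2) unfolding mon_context_def by (elim allE) (erule mp)
    then show "mon C r (\<lambda>e. c e + f e + m e)" by (simp only: ac_simps)
  qed
  have sum: "3 * (W f + W g) > 2 * T" using mon_Plus.prems(3) add by simp
  show ?case
  \<comment> \<open>The heavier summand has at least half of more than \<open>2 * T / 3\<close>,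
    hence more than \<open>T / 3\<close>: the lower limit can never be missed on the way
    down.\<close>
  proof (cases "W f \<ge> W g")
    case True
    show ?thesis
    proof (cases "3 * W f > 2 * T")
      case True
      from mon_Plus.IH(1)[OF nd(1) ca True] show ?thesis by (simp add: ac_simps)
    next
      case False
      then show ?thesis
        using \<open>W f \<ge> W g\<close> sum ca nd mon_Plus.hyps
        by (intro bexI[of _ a] exI[of _ f] exI[of _ "\<lambda>e. c e + g e"]) (auto simp: ac_simps)
    qed
  next
    case le: False
    show ?thesis
    proof (cases "3 * W g > 2 * T")
      case True
      from mon_Plus.IH(2)[OF nd(2) cb True] show ?thesis by (simp add: ac_simps)
    next
      case False
      then show ?thesis
        using le sum cb nd mon_Plus.hyps
        by (intro bexI[of _ b] exI[of _ g] exI[of _ "\<lambda>e. c e + f e"]) (auto simp: ac_simps)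
    qed
  qed
next
  case (mon_Max1 n a b f)
  have "mon_context C r a c" using mon_Max1.prems(2) mon.mon_Max1[OF mon_Max1.hyps(1)] by (auto simp: mon_context_def)
  then show ?case using mon_Max1.IH[OF _ _ mon_Max1.prems(3)] gate_closed(2)[OF C mon_Max1.prems(1) mon_Max1.hyps(1)] by blast
next
  case (mon_Max2 n a b f)
  have "mon_context C r b c" using mon_Max2.prems(2) mon.mon_Max2[OF mon_Max2.hyps(1)] by (auto simp: mon_context_def)
  then show ?case using mon_Max2.IH[OF _ _ mon_Max2.prems(3)] gate_closed(2)[OF C mon_Max2.prems(1) mon_Max2.hyps(1)] by blast
qed

section \<open>Hamiltonian cycles as the monomials at the output\<close>

definition tour_edges :: "'a set \<Rightarrow> 'a list \<Rightarrow> 'a set set" where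
  "tour_edges V us = (\<lambda>i. {us ! (i - 1), us ! i}) ` {1..card V}"

lemma tour_nth_eq:
  assumes us: "us \<in> ham_tours V E" and ij: "i \<le> card V" "j \<le> card V" "us ! i = us ! j"
  shows "i = j \<or> (i = 0 \<and> j = card V) \<or> (j = 0 \<and> i = card V)"
proof -
  let ?N = "card V"
  have l: "length us = ?N + 1" and c: "us ! 0 = us ! ?N" and d: "distinct (take ?N us)"
    using us by (auto simp: ham_tours_def)
  have eq: "i = j" if "i < ?N" "j < ?N" "us ! i = us ! j" for i j
    using nth_eq_iff_index_eq[OF d, of i j] that l by auto
  show ?thesis
  proof (cases "?N = 0")
    case False
    consider "i = ?N" "j = ?N" | "i = ?N" "j < ?N" | "i < ?N" "j = ?N" | "i < ?N" "j < ?N"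
      using ij by linarith
    then show ?thesis
    proof cases
      case 2
      then have "us ! 0 = us ! j" using ij(3) c by metis
      then have "0 = j" by (rule eq[rotated 2]) (use 2 False in auto)
      then show ?thesis using 2 by blast
    next
      case 3
      then have "us ! i = us ! 0" using ij(3) c by metis
      then have "i = 0" by (rule eq[rotated 2]) (use 3 False in auto)
      then show ?thesis using 3 by blast
    next
      case 4
      then show ?thesis using eq[OF 4 ij(3)] by blast
    qed blast
  qed (use ij in auto)
qed

text \<open>Two steps over one edge in opposite directions would have to follow each other
  cyclically on both sides, which happens only on two vertices; this is why three are
  required.\<close>

lemma tour_edges_inj:
  assumes us: "us \<in> ham_tours V E" and N: "card V \<ge> 3"
  shows "inj_on (\<lambda>i. {us ! (i - 1), us ! i}) {1..card V}"
proof (rule inj_onI)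
  let ?N = "card V"
  fix i j assume ij: "i \<in> {1..?N}" "j \<in> {1..?N}" and e: "{us ! (i - 1), us ! i} = {us ! (j - 1), us ! j}"
  note eq = tour_nth_eq[OF us]
  from e consider "us ! i = us ! j" "us ! (i - 1) = us ! (j - 1)" | "us ! i = us ! (j - 1)" "us ! (i - 1) = us ! j"
    by (auto simp: doubleton_eq_iff)
  then show "i = j"
  proof cases
    case 1
    then show ?thesis using eq[of i j] ij by auto
  next
    case 2
    have "i = j - 1 \<or> (j - 1 = 0 \<and> i = ?N)" using eq[OF _ _ 2(1)] ij by auto
    moreover have "i - 1 = j \<or> (i - 1 = 0 \<and> j = ?N)" using eq[OF _ _ 2(2)] ij by auto
    ultimately show ?thesis using ij N by (auto simp: atLeastAtMost_iff)
  qed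
qed

lemma tour_edges_card: "us \<in> ham_tours V E \<Longrightarrow> card V \<ge> 3 \<Longrightarrow> card (tour_edges V us) = card V"
  unfolding tour_edges_def by (subst card_image[OF tour_edges_inj]) auto

lemma tour_edges_subset: "us \<in> ham_tours V E \<Longrightarrow> tour_edges V us \<subseteq> E"
  by (auto simp: ham_tours_def tour_edges_def)

lemma tour_sum:
  "us \<in> ham_tours V E \<Longrightarrow> card V \<ge> 3 \<Longrightarrow>
    (\<Sum>i\<in>{1..card V}. \<nu> {us ! (i - 1), us ! i}) = (\<Sum>e\<in>tour_edges V us. \<nu> e)" for \<nu> :: "'a set \<Rightarrow> real"
  unfolding tour_edges_def by (subst sum.reindex[OF tour_edges_inj]) (auto simp: comp_def)

lemma finite_ham_tours: "finite V \<Longrightarrow> finite (ham_tours V E)"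
  by (rule finite_subset[OF _ finite_lists_length_eq[of V "card V + 1"]]) (auto simp: ham_tours_def)

definition ind :: "'x set \<Rightarrow> 'x \<Rightarrow> nat" where
  "ind S e = (if e \<in> S then 1 else 0)"

context
  fixes V :: "'a set" and E :: "'a set set" and C :: "('a set, 'n) circuit"
  assumes C: "tropical_circuit E C" and calc: "calculates_TSP C V E" and finV: "finite V" and finE: "finite E"
    and N3: "card V \<ge> 3"
begin

lemma out_le_tour:
  assumes "mon C (out C) f"
  shows "\<exists>us\<in>ham_tours V E. wt E \<nu> f \<le> (\<Sum>e\<in>tour_edges V us. \<nu> e)"
proof -
  have "wt E \<nu> f \<le> TSP V E \<nu>"
    using mon_le_value[OF C finE assms] calc C by (auto simp: calculates_TSP_def tropical_circuit_def)
  moreover have "TSP V E \<nu> \<in> (\<lambda>us. \<Sum>i\<in>{1..card V}. \<nu> {us ! (i - 1), us ! i}) ` ham_tours V E"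
    unfolding TSP_def using finite_ham_tours[OF finV] calc by (intro Max_in) (auto simp: calculates_TSP_def)
  ultimately show ?thesis using tour_sum[OF _ N3] by fastforce
qed

lemma tour_le_out:
  assumes "us \<in> ham_tours V E"
  shows "\<exists>f. mon C (out C) f \<and> (\<Sum>e\<in>tour_edges V us. \<nu> e) \<le> wt E \<nu> f"
proof -
  have "(\<Sum>e\<in>tour_edges V us. \<nu> e) \<le> TSP V E \<nu>"
    unfolding TSP_def tour_sum[OF assms N3, symmetric]
    using finite_ham_tours[OF finV] assms by (intro Max_ge) auto
  moreover obtain f where "mon C (out C) f" "wt E \<nu> f = TSP V E \<nu>"
  proof -
    have "node_value C \<nu> (out C) (TSP V E \<nu>)" using calc by (simp add: calculates_TSP_def)
    moreover have "out C \<in> nodes C" using C by (simp add: tropical_circuit_def)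
    ultimately show thesis using value_attained[OF C finE] that by blast
  qed
  ultimately show ?thesis by auto
qed

text \<open>Testing with the valuations \<open>1\<close> and \<open>-1\<close> fixes the degree of a monomial; testing with the indicator
  of its support then produces the tour.\<close>

lemma out_mon_tour:
  assumes f: "mon C (out C) f"
  shows "\<exists>us\<in>ham_tours V E. f = ind (tour_edges V us)"
proof -
  have card: "(\<Sum>e\<in>tour_edges V us. (1::real)) = real (card V)" if "us \<in> ham_tours V E" for us
    using tour_edges_card[OF that N3] by simp
  obtain us1 where "us1 \<in> ham_tours V E" "wt E (\<lambda>_. 1) f \<le> (\<Sum>e\<in>tour_edges V us1. 1)"
    using out_le_tour[OF f] by blast
  then have up: "(\<Sum>e\<in>E. f e) \<le> card V" using card[of us1] by (simp add: wt_def flip: of_nat_sum)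
  define S where "S = {e\<in>E. f e \<noteq> 0}"
  obtain us2 where "us2 \<in> ham_tours V E" "wt E (\<lambda>_. -1) f \<le> (\<Sum>e\<in>tour_edges V us2. -1)"
    using out_le_tour[OF f] by blast
  then have "card V \<le> (\<Sum>e\<in>E. f e)" using card[of us2] by (simp add: wt_def sum_negf flip: of_nat_sum)
  then have tot: "(\<Sum>e\<in>E. f e) = card V" using up by simp
  obtain us where us: "us \<in> ham_tours V E"
    and le: "wt E (\<lambda>e. of_bool (e \<in> S)) f \<le> (\<Sum>e\<in>tour_edges V us. of_bool (e \<in> S))"
    using out_le_tour[OF f] by blast
  let ?T = "tour_edges V us"
  have finT: "finite ?T" by (simp add: tour_edges_def)
  have "wt E (\<lambda>e. of_bool (e \<in> S)) f = real (\<Sum>e\<in>E. f e)"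
    unfolding wt_def of_nat_sum by (intro sum.cong) (auto simp: S_def)
  moreover have "(\<Sum>e\<in>?T. of_bool (e \<in> S)) = real (card (?T \<inter> S))"
    using finT by (simp add: sum_of_bool_eq Int_def)
  ultimately have "card ?T \<le> card (?T \<inter> S)" using le tot tour_edges_card[OF us N3] by simp
  then have TS: "?T \<subseteq> S" using finT by (metis Int_lower1 card_seteq inf.absorb_iff1)
  have TE: "?T \<subseteq> E" using tour_edges_subset[OF us] .
  \<comment> \<open>The degree equals the number of tour edges, each of which has positive exponent,
    so there is no room for an exponent above \<open>1\<close> or for an edge off the tour.\<close>
  have "(\<Sum>e\<in>E. f e) = (\<Sum>e\<in>E - ?T. f e) + (\<Sum>e\<in>?T. f e)"
    using sum.subset_diff[OF TE finE] .
  moreover have ge: "(\<Sum>e\<in>?T. f e) = (\<Sum>e\<in>?T. f e - 1) + card ?T"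
  proof -
    have "(\<Sum>e\<in>?T. f e) = (\<Sum>e\<in>?T. (f e - 1) + 1)" using TS by (intro sum.cong) (auto simp: S_def)
    then show ?thesis by (simp only: sum.distrib card_eq_sum)
  qed
  ultimately have z: "(\<Sum>e\<in>E - ?T. f e) = 0" "(\<Sum>e\<in>?T. f e - 1) = 0"
    using tot tour_edges_card[OF us N3] by auto
  have "f e = ind ?T e" for e
  proof (cases "e \<in> ?T")
    case True
    then have "f e \<noteq> 0" "f e - 1 = 0" using TS z(2) finT by (auto simp: S_def)
    then show ?thesis using True by (simp add: ind_def)
  next
    case False
    then show ?thesis using z(1) finE mon_support[OF C finE f, of e] C
      by (cases "e \<in> E") (auto simp: ind_def tropical_circuit_def)
  qed
  then show ?thesis using us by auto
qed

text \<open>Under the indicator valuation of the tour the polynomial is worth at least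
  \<open>card V\<close>. A monomial reaching this belongs to a tour by \<open>out_mon_tour\<close>,
  and two tours with \<open>card V\<close> common edges have the same edge set.\<close>

lemma tour_out_mon:
  assumes us: "us \<in> ham_tours V E"
  shows "mon C (out C) (ind (tour_edges V us))"
proof -
  let ?T = "tour_edges V us"
  have finT: "finite ?T" by (simp add: tour_edges_def)
  obtain f where f: "mon C (out C) f" and le: "(\<Sum>e\<in>?T. of_bool (e \<in> ?T)) \<le> wt E (\<lambda>e. of_bool (e \<in> ?T)) f"
    using tour_le_out[OF us] by blast
  obtain us' where us': "us' \<in> ham_tours V E" "f = ind (tour_edges V us')" using out_mon_tour[OF f] by blast
  have "(\<Sum>e\<in>?T. of_bool (e \<in> ?T)) = real (card V)" using tour_edges_card[OF us N3] by simp
  moreover have "wt E (\<lambda>e. of_bool (e \<in> ?T)) f = real (card (?T \<inter> tour_edges V us'))"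
  proof -
    have "wt E (\<lambda>e. of_bool (e \<in> ?T)) f = (\<Sum>e\<in>E. of_bool (e \<in> ?T \<inter> tour_edges V us'))"
      unfolding wt_def us'(2) by (intro sum.cong) (auto simp: ind_def)
    also have "\<dots> = real (card (E \<inter> (?T \<inter> tour_edges V us')))"
      using finE by (simp add: sum_of_bool_eq Int_def)
    also have "E \<inter> (?T \<inter> tour_edges V us') = ?T \<inter> tour_edges V us'"
      using tour_edges_subset[OF us] by auto
    finally show ?thesis .
  qed
  ultimately have c: "card V \<le> card (?T \<inter> tour_edges V us')" using le by simp
  have "?T \<inter> tour_edges V us' = ?T"
    using c tour_edges_card[OF us N3] finT by (intro card_seteq) auto
  moreover have "?T \<inter> tour_edges V us' = tour_edges V us'"
    using c tour_edges_card[OF us'(1) N3] by (intro card_seteq) (auto simp: tour_edges_def)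
  ultimately show ?thesis using f us' by simp
qed

end

section \<open>Tours and cyclic permutations of cells\<close>

definition forced :: "nat \<Rightarrow> nat set set" where
  "forced m = (\<lambda>x. {3 * x, 3 * x + 1}) ` {..<m} \<union> (\<lambda>x. {3 * x + 1, 3 * x + 2}) ` {..<m}"

definition gap :: "nat \<Rightarrow> nat \<Rightarrow> nat set" where
  "gap x y = {3 * x + 2, 3 * y}"

definition cycle_edges :: "nat \<Rightarrow> (nat \<Rightarrow> nat) \<Rightarrow> nat set set" where
  "cycle_edges m \<pi> = forced m \<union> (\<lambda>x. gap x (\<pi> x)) ` {..<m}"

lemma gap_eq_iff: "gap x y = gap x' y' \<longleftrightarrow> x = x' \<and> y = y'"
proof -
  have "3 * x + 2 \<noteq> 3 * y'" "3 * x' + 2 \<noteq> 3 * y" by presburger+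
  then show ?thesis by (auto simp: gap_def doubleton_eq_iff)
qed

lemma gap_not_forced: "gap x y \<notin> forced m"
proof
  assume "gap x y \<in> forced m"
  then obtain z where "gap x y = {3 * z, 3 * z + 1} \<or> gap x y = {3 * z + 1, 3 * z + 2}"
    by (auto simp: forced_def)
  then have "3 * z + 1 \<in> gap x y" by auto
  then have "3 * z + 1 = 3 * x + 2 \<or> 3 * z + 1 = 3 * y" by (simp add: gap_def)
  then show False by presburger
qed

lemma card_cycle_edges: "card (cycle_edges m \<pi>) \<le> 3 * m"
proof -
  have "card (cycle_edges m \<pi>) \<le> card ((\<lambda>x. {3 * x, 3 * x + 1}) ` {..<m}) + card ((\<lambda>x. {3 * x + 1, 3 * x + 2}) ` {..<m})
     + card ((\<lambda>x. gap x (\<pi> x)) ` {..<m})"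
    unfolding cycle_edges_def forced_def by (meson add_le_mono1 card_Un_le order_trans)
  also have "\<dots> \<le> card {..<m} + card {..<m} + card {..<m}"
    by (intro add_mono card_image_le) auto
  finally show ?thesis by simp
qed

lemma funpow_permutes_less: "\<pi> permutes {..<m::nat} \<Longrightarrow> x < m \<Longrightarrow> (\<pi> ^^ i) x < m"
  by (induction i) (auto simp: permutes_in_image[of \<pi> "{..<m}", simplified])

lemma funpow_inj_eq:
  assumes "inj f" "(f ^^ i) x = (f ^^ j) x" "i \<le> j"
  shows "(f ^^ (j - i)) x = x"
proof -
  have "(f ^^ i) ((f ^^ (j - i)) x) = (f ^^ i) x"
    using assms by (metis comp_apply funpow_add le_add_diff_inverse)
  then show ?thesis using inj_fn[OF assms(1), of i] by (simp add: inj_eq)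
qed

lemma cycle_tour:
  assumes \<pi>: "\<pi> permutes {..<m}" and x0: "x0 < m" and cyc: "\<And>j. 1 \<le> j \<Longrightarrow> j < m \<Longrightarrow> (\<pi> ^^ j) x0 \<noteq> x0"
    and E: "cycle_edges m \<pi> \<subseteq> E"
  shows "\<exists>us\<in>ham_tours {..<3 * m} E. tour_edges {..<3 * m} us = cycle_edges m \<pi>"
proof -
  \<comment> \<open>Position \<open>i\<close> of the tour is vertex \<open>i mod 3\<close> inside
    the cell reached from \<open>x0\<close> after \<open>i div 3\<close> steps.\<close>
  define f where "f i = 3 * (\<pi> ^^ (i div 3)) x0 + i mod 3" for i
  define us where "us = map f [0..<3 * m + 1]"
  have inj: "inj \<pi>" using permutes_inj[OF \<pi>] .
  have m0: "m > 0" using x0 by simp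
  have it: "(\<pi> ^^ i) x0 < m" for i using funpow_permutes_less[OF \<pi> x0] .
  have aux: "i = j" if ij: "i \<le> j" "j < m" "(\<pi> ^^ i) x0 = (\<pi> ^^ j) x0" for i j
  proof (rule ccontr)
    assume "i \<noteq> j"
    then have "1 \<le> j - i" "j - i < m" using ij by auto
    from cyc[OF this] show False using funpow_inj_eq[OF inj ij(3,1)] by simp
  qed
  have distinct_it: "i = j" if ij: "i < m" "j < m" "(\<pi> ^^ i) x0 = (\<pi> ^^ j) x0" for i j
    using aux[of i j] aux[of j i] ij by (cases "i \<le> j") auto
  \<comment> \<open>The first \<open>m\<close> iterates are distinct and fill all cells, so the next
    one repeats one of them, and by injectivity only \<open>x0\<close> itself is possible.\<close>
  have "(\<pi> ^^ m) x0 = x0"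
  proof -
    have "(\<lambda>i. (\<pi> ^^ i) x0) ` {..<m} = {..<m}"
      using distinct_it it by (intro card_subset_eq) (auto simp: card_image inj_on_def)
    then have "(\<pi> ^^ m) x0 \<in> (\<lambda>i. (\<pi> ^^ i) x0) ` {..<m}" using it[of m] by blast
    then obtain i where i: "i < m" "(\<pi> ^^ i) x0 = (\<pi> ^^ m) x0" by (elim imageE) simp
    then have "(\<pi> ^^ (m - i)) x0 = x0" using funpow_inj_eq[OF inj i(2)] by simp
    have "i = 0"
    proof (rule ccontr)
      assume "i \<noteq> 0"
      then have "1 \<le> m - i" "m - i < m" using i(1) by auto
      then show False using cyc \<open>(\<pi> ^^ (m - i)) x0 = x0\<close> by blast
    qed
    then have "(\<pi> ^^ 0) x0 = (\<pi> ^^ m) x0" using i(2) by blast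
    then show ?thesis unfolding funpow_0 by (rule sym)
  qed
  then have closed: "f 0 = f (3 * m)" by (simp add: f_def)
  have len: "length us = 3 * m + 1" by (simp add: us_def)
  have nth: "us ! i = f i" if "i \<le> 3 * m" for i using that by (simp add: us_def nth_append del: upt_Suc)
  have f_less: "f i < 3 * m" for i
  proof -
    have "i mod 3 < 3" by simp
    then show ?thesis using it[of "i div 3"] unfolding f_def by linarith
  qed
  have f_inj: "i = j" if "i < 3 * m" "j < 3 * m" "f i = f j" for i j
  proof -
    have "f k div 3 = (\<pi> ^^ (k div 3)) x0" "f k mod 3 = k mod 3" for k by (simp_all add: f_def)
    then have "(\<pi> ^^ (i div 3)) x0 = (\<pi> ^^ (j div 3)) x0" "i mod 3 = j mod 3" using that(3) by metis+
    moreover have "i div 3 < m" "j div 3 < m" using that by auto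
    ultimately show ?thesis using distinct_it by (metis div_mod_decomp)
  qed
  have edge: "{f i, f (Suc i)} \<in> cycle_edges m \<pi>" for i
  proof -
    let ?y = "(\<pi> ^^ (i div 3)) x0"
    have y: "?y < m" using it .
    consider "i mod 3 = 0" | "i mod 3 = 1" | "i mod 3 = 2" by linarith
    then show ?thesis
    proof cases
      case 1
      then have "Suc i div 3 = i div 3" "Suc i mod 3 = 1" by presburger+
      then have "{f i, f (Suc i)} = {3 * ?y, 3 * ?y + 1}" using 1 by (simp add: f_def)
      then show ?thesis using y by (auto simp: cycle_edges_def forced_def)
    next
      case 2
      then have "Suc i div 3 = i div 3" "Suc i mod 3 = 2" by presburger+
      then have "{f i, f (Suc i)} = {3 * ?y + 1, 3 * ?y + 2}" using 2 by (simp add: f_def)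
      then show ?thesis using y by (auto simp: cycle_edges_def forced_def)
    next
      case 3
      then have "Suc i div 3 = Suc (i div 3)" "Suc i mod 3 = 0" by presburger+
      then have "{f i, f (Suc i)} = gap ?y (\<pi> ?y)" using 3 by (simp add: f_def gap_def)
      then show ?thesis using y by (auto simp: cycle_edges_def)
    qed
  qed
  have edge': "{us ! (i - 1), us ! i} \<in> cycle_edges m \<pi>" if i: "i \<in> {1..3 * m}" for i
  proof -
    obtain i' where "i = Suc i'" using i by (cases i) auto
    then show ?thesis using edge[of i'] nth i by simp
  qed
  have take: "take (3 * m) us = map f [0..<3 * m]"
    unfolding us_def by (simp add: take_map)
  have "length us = card {..<3 * m} + 1" using len by simp
  moreover have "set us \<subseteq> {..<3 * m}" using f_less by (auto simp: us_def)
  moreover have "us ! 0 = us ! card {..<3 * m}" using nth[of 0] nth[of "3 * m"] closed by simp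
  moreover have "distinct (take (card {..<3 * m}) us)"
    using f_inj by (simp add: take distinct_map inj_on_def)
  moreover have "\<forall>i\<in>{1..card {..<3 * m}}. {us ! (i - 1), us ! i} \<in> E"
    unfolding card_lessThan using edge' E by blast
  ultimately have tour: "us \<in> ham_tours {..<3 * m} E" unfolding ham_tours_def by blast
  have sub: "tour_edges {..<3 * m} us \<subseteq> cycle_edges m \<pi>"
    unfolding tour_edges_def card_lessThan using edge' by blast
  have "finite (cycle_edges m \<pi>)" by (simp add: cycle_edges_def forced_def)
  then have "tour_edges {..<3 * m} us = cycle_edges m \<pi>"
    using sub tour_edges_card[OF tour] card_cycle_edges[of m \<pi>] m0 by (intro card_seteq) auto
  then show ?thesis using tour by blast
qed

text \<open>The cells of a short cycle of \<open>\<pi>\<close> form a proper subset that no edge of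
  \<open>cycle_edges m \<pi>\<close> leaves, so a tour through these edges could not visit every
  cell.\<close>

lemma tour_no_short_cycle:
  assumes \<pi>: "\<pi> permutes {..<m}" and us: "us \<in> ham_tours {..<3 * m} E"
    and te: "tour_edges {..<3 * m} us \<subseteq> cycle_edges m \<pi>" and x: "x < m" and j: "1 \<le> j" "j < m"
  shows "(\<pi> ^^ j) x \<noteq> x"
proof
  assume cyc: "(\<pi> ^^ j) x = x"
  define orb where "orb = (\<lambda>i. (\<pi> ^^ i) x) ` {..<j}"
  have inj: "inj \<pi>" using permutes_inj[OF \<pi>] .
  have cO: "card orb < m" unfolding orb_def using card_image_le[of "{..<j}"] j by (metis card_lessThan finite_lessThan le_less_trans)
  have fO: "finite orb" by (simp add: orb_def)
  have xO: "x \<in> orb" unfolding orb_def using j by (intro image_eqI[of _ _ 0]) auto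
  have sub: "\<pi> ` orb \<subseteq> orb"
  proof
    fix y assume "y \<in> \<pi> ` orb"
    then obtain i where i: "i < j" "y = (\<pi> ^^ Suc i) x" by (auto simp: orb_def)
    show "y \<in> orb"
    proof (cases "Suc i < j")
      case True
      then show ?thesis unfolding orb_def i(2) by blast
    next
      case False
      then have "Suc i = j" using i by simp
      then have "y = x" using cyc i(2) by metis
      then show ?thesis using xO by simp
    qed
  qed
  then have "\<pi> ` orb = orb" using fO inj by (metis card_image card_subset_eq inj_on_subset subset_UNIV)
  then have Oiff: "\<pi> y \<in> orb \<longleftrightarrow> y \<in> orb" for y using inj by (metis imageI image_iff inj_eq)
  have iff: "a div 3 \<in> orb \<longleftrightarrow> b div 3 \<in> orb" if "{a, b} \<in> cycle_edges m \<pi>" for a b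
  proof -
    have d: "(3 * y) div 3 = y" "(3 * y + 1) div 3 = y" "(3 * y + 2) div 3 = y"
      "Suc (Suc (3 * y)) div 3 = y" for y :: nat by auto
    from that consider y where "{a,b} = {3 * y, 3 * y + 1}" | y where "{a,b} = {3 * y + 1, 3 * y + 2}"
      | y where "{a,b} = {3 * y + 2, 3 * \<pi> y}"
      unfolding cycle_edges_def forced_def gap_def by blast
    then show ?thesis
      by cases (auto simp: doubleton_eq_iff Oiff d simp del: One_nat_def)
  qed
  let ?N = "3 * m"
  have all: "us ! i div 3 \<in> orb \<longleftrightarrow> us ! 0 div 3 \<in> orb" if "i \<le> ?N" for i
    using that
  proof (induction i)
    case (Suc i)
    have "{us ! i, us ! Suc i} \<in> tour_edges {..<?N} us"
      unfolding tour_edges_def using Suc.prems by (intro image_eqI[of _ _ "Suc i"]) auto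
    then have "us ! i div 3 \<in> orb \<longleftrightarrow> us ! Suc i div 3 \<in> orb" using te iff by blast
    then show ?case using Suc by simp
  qed simp
  have len: "length us = ?N + 1" and dist: "distinct (take ?N us)" and sV: "set us \<subseteq> {..<?N}"
    using us by (auto simp: ham_tours_def)
  have "set (take ?N us) = {..<?N}"
  proof (rule card_subset_eq)
    show "set (take ?N us) \<subseteq> {..<?N}" using sV set_take_subset by fast
    show "card (set (take ?N us)) = card {..<?N}" using distinct_card[OF dist] len by simp
  qed simp
  then have visit: "\<exists>i\<le>?N. us ! i = v" if "v < ?N" for v
  proof -
    have "v \<in> set (take ?N us)" using that \<open>set (take ?N us) = {..<?N}\<close> by simp
    then obtain i where i: "i < length (take ?N us)" "take ?N us ! i = v" unfolding in_set_conv_nth by blast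
    then show ?thesis by (intro exI[of _ i]) auto
  qed
  obtain i where "i \<le> ?N" "us ! i = 3 * x" using visit[of "3 * x"] x by auto
  then have "us ! 0 div 3 \<in> orb" using all[of i] xO by auto
  have "y \<in> orb" if y: "y < m" for y
  proof -
    obtain i where "i \<le> ?N" "us ! i = 3 * y" using visit[of "3 * y"] y by auto
    then show ?thesis using all[of i] \<open>us ! 0 div 3 \<in> orb\<close> by simp
  qed
  then have "{..<m} \<subseteq> orb" by blast
  then show False using cO card_mono[OF fO, of "{..<m}"] by simp
qed

text \<open>A vertex ends at most one step of a tour and begins at most one, so two of the three
  edges would be the same step.\<close>

lemma tour_degree:
  assumes us: "us \<in> ham_tours V E" and e: "e1 \<in> tour_edges V us" "e2 \<in> tour_edges V us" "e3 \<in> tour_edges V us"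
    and v: "v \<in> e1" "v \<in> e2" "v \<in> e3" and d: "e1 \<noteq> e2" "e1 \<noteq> e3" "e2 \<noteq> e3"
  shows False
proof -
  obtain i1 i2 i3 where i: "i1 \<in> {1..card V}" "i2 \<in> {1..card V}" "i3 \<in> {1..card V}"
    and ei: "e1 = {us ! (i1 - 1), us ! i1}" "e2 = {us ! (i2 - 1), us ! i2}" "e3 = {us ! (i3 - 1), us ! i3}"
    using e unfolding tour_edges_def by (elim imageE)
  have ne: "i1 \<noteq> i2" "i1 \<noteq> i3" "i2 \<noteq> i3" using d ei by auto
  have A: "k = l" if "k \<in> {1..card V}" "l \<in> {1..card V}" "us ! k = v" "us ! l = v" for k l
    using tour_nth_eq[OF us, of k l] that by auto
  have B: "k = l" if kl: "k \<in> {1..card V}" "l \<in> {1..card V}" "us ! (k - 1) = v" "us ! (l - 1) = v" for k l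
  proof -
    have "k - 1 \<le> card V" "l - 1 \<le> card V" "us ! (k - 1) = us ! (l - 1)" using kl by auto
    from tour_nth_eq[OF us this] show ?thesis using kl(1,2) by auto
  qed
  have "us ! i1 = v \<or> us ! (i1 - 1) = v" "us ! i2 = v \<or> us ! (i2 - 1) = v" "us ! i3 = v \<or> us ! (i3 - 1) = v"
    using v ei by auto
  then show False using A B i ne by metis
qed

definition mix :: "nat set \<Rightarrow> (nat \<Rightarrow> nat) \<Rightarrow> (nat \<Rightarrow> nat) \<Rightarrow> nat \<Rightarrow> nat" where
  "mix U \<pi> \<rho> x = (if x \<in> U then \<pi> x else \<rho> x)"

text \<open>The part of a rectangle that survives in terms of permutations: the first player owns the
  steps out of \<open>U\<close>, all members agree on the image of \<open>U\<close>, and members may be combined freely.\<close>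

definition rectangle :: "nat \<Rightarrow> nat set \<Rightarrow> (nat \<Rightarrow> nat) set \<Rightarrow> bool" where
  "rectangle m U S \<longleftrightarrow> U \<subseteq> {..<m} \<and> m \<le> 3 * card U \<and> 3 * card U \<le> 2 * m \<and>
     (\<forall>\<pi>\<in>S. \<forall>\<rho>\<in>S. \<pi> ` U = \<rho> ` U \<and> (\<forall>x<m. \<forall>j. 1 \<le> j \<and> j < m \<longrightarrow> (mix U \<pi> \<rho> ^^ j) x \<noteq> x))"

text \<open>\<open>a \<pi>\<close> is the part of the cycle of \<open>\<pi>\<close> produced at the
  gate and \<open>c \<pi>\<close> the rest. Mixtures of two members are tours, so a cell left
  through \<open>a \<pi>\<close> and also through \<open>c \<rho>\<close> would have an exit of
  degree three; the same holds for entries. Hence all members own the same steps and agree on which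
  cells are entered by owned steps.\<close>

lemma gate_rectangle:
  fixes m :: nat
  assumes S: "S \<subseteq> {\<pi>. \<pi> permutes {..<m}}" and S0: "S \<noteq> {}"
    and split: "\<And>\<pi>. \<pi> \<in> S \<Longrightarrow> (\<lambda>e. c \<pi> e + a \<pi> e) = ind (cycle_edges m \<pi>)"
    and bal: "\<And>\<pi>. \<pi> \<in> S \<Longrightarrow> m \<le> 3 * (\<Sum>e\<in>(\<lambda>(x,y). gap x y) ` ({..<m} \<times> {..<m}). a \<pi> e) \<and>
      3 * (\<Sum>e\<in>(\<lambda>(x,y). gap x y) ` ({..<m} \<times> {..<m}). a \<pi> e) \<le> 2 * m"
    and comb: "\<And>\<pi> \<rho>. \<pi> \<in> S \<Longrightarrow> \<rho> \<in> S \<Longrightarrow>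
      \<exists>us\<in>ham_tours {..<3 * m} E. (\<lambda>e. c \<rho> e + a \<pi> e) = ind (tour_edges {..<3 * m} us)"
  shows "\<exists>U. rectangle m U S"
proof -
  have sum1: "c \<pi> e + a \<pi> e = (if e \<in> cycle_edges m \<pi> then 1 else 0)" if "\<pi> \<in> S" for \<pi> e
    using fun_cong[OF split[OF that], of e] by (simp add: ind_def)
  have le1: "c \<rho> e + a \<pi> e \<le> 1" if "\<pi> \<in> S" "\<rho> \<in> S" for \<pi> \<rho> e
    using comb[OF that] by (auto simp: ind_def fun_eq_iff)
  have perm: "\<pi> permutes {..<m}" if "\<pi> \<in> S" for \<pi> using S that by auto
  have pl: "\<pi> x < m \<longleftrightarrow> x < m" if "\<pi> \<in> S" for \<pi> x using permutes_in_image[OF perm[OF that], of x] by simp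
  \<comment> \<open>Both unmixed sums are \<open>1\<close>. The two mixed sums have the same total
    \<open>2\<close> and are at most \<open>1\<close> each, so every mixture contains all forced
    edges.\<close>
  have F: "c \<rho> e + a \<pi> e = 1" if "\<pi> \<in> S" "\<rho> \<in> S" "e \<in> forced m" for \<pi> \<rho> e
  proof -
    have "c \<rho> e + a \<rho> e = 1" "c \<pi> e + a \<pi> e = 1"
      using sum1[OF that(1), of e] sum1[OF that(2), of e] that(3) by (auto simp: cycle_edges_def)
    then show ?thesis using le1[OF that(1,2), of e] le1[OF that(2,1), of e] by linarith
  qed
  define own where "own \<pi> = {x. x < m \<and> a \<pi> (gap x (\<pi> x)) = 1}" for \<pi>
  have gap_in: "gap x (\<pi> x) \<in> cycle_edges m \<pi>" if "x < m" for x \<pi> using that by (auto simp: cycle_edges_def)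
  have A1: "a \<pi> (gap x (\<pi> x)) = 1" if "\<pi> \<in> S" "x \<in> own \<pi>" for \<pi> x using that by (simp add: own_def)
  have C1: "c \<pi> (gap x (\<pi> x)) = 1" if "\<pi> \<in> S" "x < m" "x \<notin> own \<pi>" for \<pi> x
    using that sum1[OF that(1), of "gap x (\<pi> x)"] gap_in[OF that(2), of \<pi>] by (auto simp: own_def)
  \<comment> \<open>One forced edge and two gap edges meet at \<open>v\<close>. The gap edges
    differ, since a common one would get exponent \<open>2\<close> in the mixture.\<close>
  have bad: False if pr: "\<pi> \<in> S" "\<rho> \<in> S" and e: "e0 \<in> forced m" "a \<pi> (gap x y) = 1" "c \<rho> (gap x' y') = 1"
    and v: "v \<in> e0" "v \<in> gap x y" "v \<in> gap x' y'" for \<pi> \<rho> e0 x y x' y' v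
  proof -
    obtain us where us: "us \<in> ham_tours {..<3 * m} E" "(\<lambda>e. c \<rho> e + a \<pi> e) = ind (tour_edges {..<3 * m} us)"
      using comb[OF pr] by blast
    have mem: "e \<in> tour_edges {..<3 * m} us" if "c \<rho> e + a \<pi> e \<ge> 1" for e
      using that fun_cong[OF us(2), of e] by (simp add: ind_def split: if_splits)
    have "gap x y \<noteq> gap x' y'"
      using e(2,3) le1[OF pr, of "gap x y"] by auto
    then show False
      using tour_degree[OF us(1) mem mem mem v] F[OF pr e(1)] e gap_not_forced by (metis le_add1 le_add2 order_refl)
  qed
  have own_sub: "own \<pi> \<subseteq> own \<rho>" if pr: "\<pi> \<in> S" "\<rho> \<in> S" for \<pi> \<rho>
  proof
    fix x assume x: "x \<in> own \<pi>"
    then have xm: "x < m" by (simp add: own_def)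
    show "x \<in> own \<rho>"
    proof (rule ccontr)
      assume "x \<notin> own \<rho>"
      then show False
        using bad[OF pr _ A1[OF pr(1) x] C1[OF pr(2) xm], of "{3 * x + 1, 3 * x + 2}" "3 * x + 2"] xm
        by (auto simp: forced_def gap_def)
    qed
  qed
  obtain \<pi>0 where \<pi>0: "\<pi>0 \<in> S" using S0 by auto
  define U where "U = own \<pi>0"
  have own: "own \<pi> = U" if "\<pi> \<in> S" for \<pi> using own_sub[OF that \<pi>0] own_sub[OF \<pi>0 that] by (auto simp: U_def)
  have fU: "finite U" "U \<subseteq> {..<m}" by (auto simp: U_def own_def)
  have img_sub: "\<pi> ` U \<subseteq> \<rho> ` U" if pr: "\<pi> \<in> S" "\<rho> \<in> S" for \<pi> \<rho>
  proof
    fix y assume "y \<in> \<pi> ` U"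
    then obtain x where x: "x \<in> U" "y = \<pi> x" by auto
    then have ym: "y < m" using fU pl[OF pr(1)] by auto
    obtain x' where x': "y = \<rho> x'" using permutes_surj[OF perm[OF pr(2)]] by (metis surjD)
    then have xm': "x' < m" using ym pl[OF pr(2)] by auto
    show "y \<in> \<rho> ` U"
    proof (rule ccontr)
      assume "y \<notin> \<rho> ` U"
      then have "x' \<notin> own \<rho>" using x' own[OF pr(2)] by auto
      then have "c \<rho> (gap x' y) = 1" using C1[OF pr(2) xm'] x' by simp
      moreover have "a \<pi> (gap x y) = 1" using A1[OF pr(1), of x] own[OF pr(1)] x by simp
      ultimately show False
        using bad[OF pr, of "{3 * y, 3 * y + 1}" x y x' y "3 * y"] ym by (auto simp: forced_def gap_def)
    qed
  qed
  have mix: "(mix U \<pi> \<rho> ^^ j) x \<noteq> x" if pr: "\<pi> \<in> S" "\<rho> \<in> S" and xj: "x < m" "1 \<le> j" "j < m" for \<pi> \<rho> x j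
  proof -
    have img: "\<pi> ` U = \<rho> ` U" using img_sub[OF pr] img_sub[OF pr(2,1)] by auto
    \<comment> \<open>As both members map \<open>U\<close> onto the same set, the images of
      \<open>U\<close> and of its complement fit together and the mixture is a permutation.\<close>
    have "bij_betw (mix U \<pi> \<rho>) ({..<m} \<inter> U \<union> ({..<m} - U)) (\<rho> ` ({..<m} \<inter> U) \<union> \<rho> ` ({..<m} - U))"
    proof (rule bij_betw_combine)
      have "bij_betw \<pi> U (\<rho> ` U)" using img permutes_inj_on[OF perm[OF pr(1)]] by (auto simp: bij_betw_def)
      moreover have "{..<m} \<inter> U = U" using fU by auto
      ultimately show "bij_betw (mix U \<pi> \<rho>) ({..<m} \<inter> U) (\<rho> ` ({..<m} \<inter> U))"
        by (subst bij_betw_cong[where g = \<pi>]) (auto simp: mix_def)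
      have "bij_betw \<rho> ({..<m} - U) (\<rho> ` ({..<m} - U))"
        using permutes_inj_on[OF perm[OF pr(2)]] by (auto simp: bij_betw_def)
      then show "bij_betw (mix U \<pi> \<rho>) ({..<m} - U) (\<rho> ` ({..<m} - U))"
        by (subst bij_betw_cong[where g = \<rho>]) (auto simp: mix_def)
      show "\<rho> ` ({..<m} \<inter> U) \<inter> \<rho> ` ({..<m} - U) = {}"
        using permutes_inj[OF perm[OF pr(2)]] by (auto simp: inj_eq)
    qed
    moreover have "{..<m} \<inter> U \<union> ({..<m} - U) = {..<m}" by auto
    moreover have "\<rho> ` ({..<m} \<inter> U) \<union> \<rho> ` ({..<m} - U) = {..<m}"
      using permutes_image[OF perm[OF pr(2)]] by (metis calculation(2) image_Un)
    ultimately have "bij_betw (mix U \<pi> \<rho>) {..<m} {..<m}" by simp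
    moreover have "mix U \<pi> \<rho> y = y" if "y \<notin> {..<m}" for y
      using that fU permutes_not_in[OF perm[OF pr(2)], of y] by (auto simp: mix_def)
    ultimately have pm: "mix U \<pi> \<rho> permutes {..<m}" by (intro bij_imp_permutes)
    obtain us where us: "us \<in> ham_tours {..<3 * m} E" "(\<lambda>e. c \<rho> e + a \<pi> e) = ind (tour_edges {..<3 * m} us)"
      using comb[OF pr] by blast
    have "tour_edges {..<3 * m} us \<subseteq> cycle_edges m (mix U \<pi> \<rho>)"
    proof
      fix e assume "e \<in> tour_edges {..<3 * m} us"
      then have "c \<rho> e + a \<pi> e = 1" using fun_cong[OF us(2), of e] by (simp add: ind_def)
      then consider "a \<pi> e = 1" | "c \<rho> e = 1" by linarith
      then show "e \<in> cycle_edges m (mix U \<pi> \<rho>)"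
      proof cases
        case 1
        then have "e \<in> cycle_edges m \<pi>" using sum1[OF pr(1), of e] by (auto split: if_splits)
        then consider "e \<in> forced m" | y where "y < m" "e = gap y (\<pi> y)" by (auto simp: cycle_edges_def)
        then show ?thesis
        proof cases
          case 2
          then have "y \<in> U" using 1 own[OF pr(1)] by (auto simp: own_def)
          then have "e = gap y (mix U \<pi> \<rho> y)" using 2 by (simp add: mix_def)
          then show ?thesis using 2 by (auto simp: cycle_edges_def)
        qed (simp add: cycle_edges_def)
      next
        case c: 2
        then have "e \<in> cycle_edges m \<rho>" using sum1[OF pr(2), of e] by (auto split: if_splits)
        then consider "e \<in> forced m" | y where "y < m" "e = gap y (\<rho> y)" by (auto simp: cycle_edges_def)
        then show ?thesis
        proof cases
          case 2
          then have "a \<rho> e = 0" using c le1[OF pr(2,2), of e] by simp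
          then have "y \<notin> U" using 2 own[OF pr(2)] by (auto simp: own_def)
          then have "e = gap y (mix U \<pi> \<rho> y)" using 2 by (simp add: mix_def)
          then show ?thesis using 2 by (auto simp: cycle_edges_def)
        qed (simp add: cycle_edges_def)
      qed
    qed
    from tour_no_short_cycle[OF pm us(1) this xj] show ?thesis .
  qed
  have "(\<Sum>e\<in>(\<lambda>(x,y). gap x y) ` ({..<m} \<times> {..<m}). a \<pi>0 e) = card U"
  proof -
    let ?G = "(\<lambda>(x,y). gap x y) ` ({..<m} \<times> {..<m})"
    have inj: "inj_on (\<lambda>x. gap x (\<pi>0 x)) {..<m}" by (auto simp: inj_on_def gap_eq_iff)
    have "(\<Sum>e\<in>?G. a \<pi>0 e) = (\<Sum>e\<in>(\<lambda>x. gap x (\<pi>0 x)) ` {..<m}. a \<pi>0 e)"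
    proof (rule sum.mono_neutral_right)
      show "(\<lambda>x. gap x (\<pi>0 x)) ` {..<m} \<subseteq> ?G" using pl[OF \<pi>0] by auto
      show "\<forall>e\<in>?G - (\<lambda>x. gap x (\<pi>0 x)) ` {..<m}. a \<pi>0 e = 0"
      proof
        fix e assume e: "e \<in> ?G - (\<lambda>x. gap x (\<pi>0 x)) ` {..<m}"
        then have "e \<notin> forced m" using gap_not_forced by auto
        then have "e \<notin> cycle_edges m \<pi>0" using e by (auto simp: cycle_edges_def)
        then show "a \<pi>0 e = 0" using sum1[OF \<pi>0, of e] by simp
      qed
    qed simp
    also have "\<dots> = (\<Sum>x<m. a \<pi>0 (gap x (\<pi>0 x)))" using inj by (simp add: sum.reindex)
    also have "\<dots> = (\<Sum>x<m. if x \<in> U then 1 else 0)"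
    proof (rule sum.cong)
      fix x assume "x \<in> {..<m}"
      then show "a \<pi>0 (gap x (\<pi>0 x)) = (if x \<in> U then 1 else 0)"
        using le1[OF \<pi>0 \<pi>0, of "gap x (\<pi>0 x)"] by (auto simp: U_def own_def)
    qed simp
    also have "\<dots> = card U" using fU by (simp add: sum.If_cases Int_absorb1)
    finally show ?thesis .
  qed
  then have "rectangle m U S"
    unfolding rectangle_def using fU bal[OF \<pi>0] img_sub mix by (auto; blast)
  then show ?thesis by blast
qed

theorem circuit_rectangles:
  fixes C :: "(nat set, 'n) circuit"
  assumes C: "tropical_circuit E C" and calc: "calculates_TSP C {..<3 * m} E" and finE: "finite E" and m: "m \<ge> 2"
    and H: "\<And>\<pi>. \<pi> \<in> H \<Longrightarrow> \<pi> permutes {..<m} \<and>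
      (\<exists>us\<in>ham_tours {..<3 * m} E. tour_edges {..<3 * m} us = cycle_edges m \<pi>)"
  shows "\<exists>F. H \<subseteq> (\<Union>g\<in>nodes C. F g) \<and> (\<forall>g\<in>nodes C. F g \<subseteq> H \<and> (F g = {} \<or> (\<exists>U. rectangle m U (F g))))"
proof -
  let ?V = "{..<3 * m}"
  let ?G = "(\<lambda>(x,y). gap x y) ` ({..<m} \<times> {..<m})"
  \<comment> \<open>Only gap edges are weighed, as forced edges say nothing about the permutation.
    The balance of the split thus becomes a balance of the number of owned steps.\<close>
  define W where "W f = (\<Sum>e\<in>?G. f e)" for f :: "nat set \<Rightarrow> nat"
  have N3: "card ?V \<ge> 3" using m by simp
  have fV: "finite ?V" by simp
  have o: "out C \<in> nodes C" using C by (simp add: tropical_circuit_def)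
  have fG: "finite ?G" by simp
  define ok where "ok g \<pi> p \<longleftrightarrow> mon C g (snd p) \<and> mon_context C (out C) g (fst p) \<and> m \<le> 3 * W (snd p) \<and> 3 * W (snd p) \<le> 2 * m
     \<and> (\<lambda>e. fst p e + snd p e) = ind (cycle_edges m \<pi>)" for g \<pi> p
  define F where "F g = {\<pi> \<in> H. \<exists>p. ok g \<pi> p}" for g
  have "\<exists>g\<in>nodes C. \<pi> \<in> F g" if \<pi>: "\<pi> \<in> H" for \<pi>
  proof -
    obtain us where us: "us \<in> ham_tours ?V E" "tour_edges ?V us = cycle_edges m \<pi>" using H[OF \<pi>] by blast
    have mo: "mon C (out C) (ind (cycle_edges m \<pi>))"
      using tour_out_mon[OF C calc fV finE N3 us(1)] us(2) by simp
    have ctx: "mon_context C (out C) (out C) (\<lambda>_. 0)" by (simp add: mon_context_def)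
    have "W (ind (cycle_edges m \<pi>)) \<ge> m"
    proof -
      have inj: "inj_on (\<lambda>x. gap x (\<pi> x)) {..<m}" by (auto simp: inj_on_def gap_eq_iff)
      have "(\<lambda>x. gap x (\<pi> x)) ` {..<m} \<subseteq> ?G" using permutes_in_image[of \<pi> "{..<m}"] H[OF \<pi>] by auto
      then have "(\<Sum>e\<in>(\<lambda>x. gap x (\<pi> x)) ` {..<m}. ind (cycle_edges m \<pi>) e) \<le> W (ind (cycle_edges m \<pi>))"
        unfolding W_def using fG by (intro sum_mono2) auto
      also have "(\<Sum>e\<in>(\<lambda>x. gap x (\<pi> x)) ` {..<m}. ind (cycle_edges m \<pi>) e) = (\<Sum>x<m. 1)"
        using inj by (subst sum.reindex) (auto simp: ind_def cycle_edges_def intro!: sum.cong)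
      finally show ?thesis by simp
    qed
    then have big: "3 * W (ind (cycle_edges m \<pi>)) > 2 * m" using m by linarith
    have "\<exists>g\<in>nodes C. \<exists>a c. mon C g a \<and> mon_context C (out C) g c \<and> m \<le> 3 * W a \<and> 3 * W a \<le> 2 * m
        \<and> (\<lambda>e. c e + a e) = (\<lambda>e. 0 + ind (cycle_edges m \<pi>) e)"
    proof (rule balanced_split[where W = W, OF mo o ctx C _ _ _ m big])
      show "W (\<lambda>e. f e + g e) = W f + W g" for f g by (simp add: W_def sum.distrib)
      show "W (\<lambda>_. 0) = 0" by (simp add: W_def)
      show "W (\<lambda>y. if y = x then 1 else 0) \<le> 1" for x using fG by (simp add: W_def)
    qed
    then obtain g a c where "g \<in> nodes C" "mon C g a" "mon_context C (out C) g c" "m \<le> 3 * W a" "3 * W a \<le> 2 * m"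
        "(\<lambda>e. c e + a e) = (\<lambda>e. 0 + ind (cycle_edges m \<pi>) e)" by blast
    then show ?thesis using \<pi> unfolding F_def ok_def by (intro bexI[of _ g]) (auto intro!: exI[of _ "(c, a)"])
  qed
  moreover have "\<exists>U. rectangle m U (F g)" if g: "g \<in> nodes C" "F g \<noteq> {}" for g
  proof -
    define p where "p \<pi> = (SOME p. ok g \<pi> p)" for \<pi>
    have p: "ok g \<pi> (p \<pi>)" if "\<pi> \<in> F g" for \<pi>
    proof -
      have "\<exists>p. ok g \<pi> p" using that by (simp add: F_def)
      then show ?thesis unfolding p_def by (rule someI_ex)
    qed
    show ?thesis
    proof (rule gate_rectangle[where c = "\<lambda>\<pi>. fst (p \<pi>)" and a = "\<lambda>\<pi>. snd (p \<pi>)" and E = E])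
      show "F g \<subseteq> {\<pi>. \<pi> permutes {..<m}}" using H by (auto simp: F_def)
      show "F g \<noteq> {}" by (rule g)
      fix \<pi> \<rho> assume pr: "\<pi> \<in> F g" "\<rho> \<in> F g"
      then have "mon C (out C) (\<lambda>e. fst (p \<rho>) e + snd (p \<pi>) e)"
        using p[OF pr(1)] p[OF pr(2)] by (auto simp: ok_def mon_context_def)
      from out_mon_tour[OF C calc fV finE N3 this]
      show "\<exists>us\<in>ham_tours ?V E. (\<lambda>e. fst (p \<rho>) e + snd (p \<pi>) e) = ind (tour_edges ?V us)" .
    qed (use p in \<open>auto simp: ok_def W_def\<close>)
  qed
  moreover have "F g \<subseteq> H" for g by (auto simp: F_def)
  ultimately have "H \<subseteq> (\<Union>g\<in>nodes C. F g) \<and> (\<forall>g\<in>nodes C. F g \<subseteq> H \<and> (F g = {} \<or> (\<exists>U. rectangle m U (F g))))"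
    by blast
  then show ?thesis by (rule exI[of _ F])
qed

section \<open>Tuples of permutations around a cylinder\<close>

definition perms :: "nat \<Rightarrow> (nat \<Rightarrow> nat) set" where
  "perms n = {p. p permutes {..<n}}"

lemma finite_perms [simp]: "finite (perms n)"
  by (simp add: perms_def finite_permutations)

lemma card_perms: "card (perms n) = fact n"
  by (simp add: perms_def card_permutations)

text \<open>The cell in column \<open>p\<close> and row \<open>i\<close> has number \<open>p * n + i\<close>.\<close>

definition col_perm :: "nat \<Rightarrow> nat \<Rightarrow> (nat \<Rightarrow> nat \<Rightarrow> nat) \<Rightarrow> nat \<Rightarrow> nat" where
  "col_perm n r \<sigma> x = (if x < r * n then ((x div n + 1) mod r) * n + \<sigma> (x div n) (x mod n) else x)"

fun trace_rows :: "nat \<Rightarrow> (nat \<Rightarrow> nat \<Rightarrow> nat) \<Rightarrow> nat \<Rightarrow> nat \<Rightarrow> nat \<Rightarrow> nat" where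
  "trace_rows r \<sigma> p 0 = id"
| "trace_rows r \<sigma> p (Suc k) = \<sigma> ((p + k) mod r) \<circ> trace_rows r \<sigma> p k"

lemma trace_rows_add: "trace_rows r \<sigma> p (k + l) = trace_rows r \<sigma> (p + k) l \<circ> trace_rows r \<sigma> p k"
  by (induction l) (auto simp: add.assoc comp_assoc)

lemma trace_rows_cong:
  "(\<And>j. j < k \<Longrightarrow> \<sigma> ((p + j) mod r) = \<tau> ((p + j) mod r)) \<Longrightarrow> trace_rows r \<sigma> p k = trace_rows r \<tau> p k"
  by (induction k) auto

lemma trace_rows_permutes:
  "r > 0 \<Longrightarrow> (\<And>p. p < r \<Longrightarrow> \<sigma> p permutes {..<n}) \<Longrightarrow> trace_rows r \<sigma> p k permutes {..<n}"
  by (induction k) (auto intro: permutes_compose permutes_id)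

lemma trace_rows_shift: "trace_rows r \<sigma> (p + r * t) k = trace_rows r \<sigma> p k"
proof (induction k)
  case (Suc k)
  have "(p + r * t + k) mod r = (p + k) mod r"
    by (metis add.assoc add.commute mod_mult_self2)
  then show ?case using Suc by simp
qed simp

lemma trace_rows_power: "trace_rows r \<sigma> p (r * t) = trace_rows r \<sigma> p r ^^ t"
proof (induction t)
  case (Suc t)
  have "trace_rows r \<sigma> p (r * t + r) = trace_rows r \<sigma> p r \<circ> trace_rows r \<sigma> p (r * t)"
    by (simp only: trace_rows_add trace_rows_shift)
  then show ?case using Suc by (simp add: add.commute)
qed simp

definition row_shift :: "nat \<Rightarrow> nat \<Rightarrow> nat" where
  "row_shift n i = (if i < n then (i + 1) mod n else i)"

lemma row_shift_permutes: "row_shift n permutes {..<n}"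
proof (rule bij_imp_permutes)
  have "inj_on (row_shift n) {..<n}"
  proof (rule inj_onI)
    fix i j assume "i \<in> {..<n}" "j \<in> {..<n}" "row_shift n i = row_shift n j"
    then show "i = j" by (auto simp: row_shift_def mod_Suc split: if_splits)
  qed
  moreover have "row_shift n ` {..<n} \<subseteq> {..<n}" by (auto simp: row_shift_def)
  ultimately show "bij_betw (row_shift n) {..<n} {..<n}"
    by (simp add: bij_betw_def endo_inj_surj)
qed (auto simp: row_shift_def)

text \<open>Only tuples with a fixed product around the cylinder are used: they all give Hamiltonian cycles,
  and such a tuple is determined by all but one of its entries.\<close>

definition tuples :: "nat \<Rightarrow> nat \<Rightarrow> (nat \<Rightarrow> nat \<Rightarrow> nat) set" where
  "tuples n r = {\<sigma>. (\<forall>p<r. \<sigma> p \<in> perms n) \<and> (\<forall>p\<ge>r. \<sigma> p = id) \<and> trace_rows r \<sigma> 0 r = row_shift n}"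

lemma tuples_permutes: "\<sigma> \<in> tuples n r \<Longrightarrow> p < r \<Longrightarrow> \<sigma> p permutes {..<n}"
  by (auto simp: tuples_def perms_def)

text \<open>The factors before and after position \<open>q\<close> are bijections common to both
  tuples and cancel from the prescribed product.\<close>

lemma tuples_determined:
  assumes \<sigma>: "\<sigma> \<in> tuples n r" and \<tau>: "\<tau> \<in> tuples n r" and q: "q < r"
    and eq: "\<And>p. p < r \<Longrightarrow> p \<noteq> q \<Longrightarrow> \<sigma> p = \<tau> p"
  shows "\<sigma> = \<tau>"
proof -
  have dec: "trace_rows r \<sigma> 0 r = trace_rows r \<sigma> (Suc q) (r - Suc q) \<circ> (\<sigma> q \<circ> trace_rows r \<sigma> 0 q)" for \<sigma>
    using trace_rows_add[of r \<sigma> 0 "Suc q" "r - Suc q"] q by simp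
  have 1: "trace_rows r \<sigma> 0 q = trace_rows r \<tau> 0 q"
    using q by (intro trace_rows_cong eq) auto
  have 2: "trace_rows r \<sigma> (Suc q) (r - Suc q) = trace_rows r \<tau> (Suc q) (r - Suc q)"
    using q by (intro trace_rows_cong eq) auto
  define f where "f = trace_rows r \<tau> (Suc q) (r - Suc q)"
  define g where "g = trace_rows r \<tau> 0 q"
  have f: "inj f" and g: "surj g"
    using trace_rows_permutes[of r \<tau> n] tuples_permutes[OF \<tau>] q permutes_inj permutes_surj
    unfolding f_def g_def by (metis gr_implies_not0 neq0_conv)+
  have "f \<circ> (\<sigma> q \<circ> g) = f \<circ> (\<tau> q \<circ> g)"
    using \<sigma> \<tau> dec[of \<sigma>] dec[of \<tau>] 1 2 by (simp add: tuples_def f_def g_def)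
  then have "\<sigma> q (g x) = \<tau> q (g x)" for x using f by (metis comp_apply injD)
  then have "\<sigma> q = \<tau> q" using g by (metis ext surjD)
  then have "\<sigma> p = \<tau> p" for p
    using eq[of p] \<sigma> \<tau> by (cases "p < r") (auto simp: tuples_def)
  then show ?thesis by auto
qed

lemma card_tuples: 
  assumes r: "r > 0"
  shows "fact n ^ (r - 1) \<le> card (tuples n r)" "finite (tuples n r)"
proof -
  let ?D = "PiE {..<r-1} (\<lambda>_. perms n)"
  define pre where "pre f p = (if p < r - 1 then f p else id)" for f :: "nat \<Rightarrow> nat \<Rightarrow> nat" and p
  \<comment> \<open>The last entry is solved from the prescribed product, all others being arbitrary
    permutations.\<close>
  define G where "G f p = (if p = r - 1 then row_shift n \<circ> inv_into UNIV (trace_rows r (pre f) 0 (r - 1)) else pre f p)" for f p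
  have pp: "pre f p permutes {..<n}" if "f \<in> ?D" for f p
    using that by (auto simp: pre_def perms_def permutes_id)
  have G: "G f \<in> tuples n r" if f: "f \<in> ?D" for f
  proof -
    let ?t = "trace_rows r (pre f) 0 (r - 1)"
    have t: "?t permutes {..<n}" using trace_rows_permutes[OF r] pp[OF f] by blast
    have Gp: "G f p permutes {..<n}" for p
      using pp[OF f] permutes_compose[OF permutes_inv[OF t] row_shift_permutes] by (auto simp: G_def)
    have "trace_rows r (G f) 0 (r - 1) = ?t"
      by (rule trace_rows_cong) (auto simp: G_def)
    moreover have "trace_rows r (G f) 0 r = G f (r - 1) \<circ> trace_rows r (G f) 0 (r - 1)"
      using r by (cases r) auto
    ultimately have "trace_rows r (G f) 0 r = row_shift n \<circ> (inv_into UNIV ?t \<circ> ?t)"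
      by (simp add: G_def comp_assoc)
    also have "inv_into UNIV ?t \<circ> ?t = id" using permutes_inv_o(2)[OF t] .
    finally have "trace_rows r (G f) 0 r = row_shift n" by simp
    moreover have "G f p = id" if "p \<ge> r" for p using that r by (auto simp: G_def pre_def)
    ultimately show ?thesis using Gp by (simp add: tuples_def perms_def)
  qed
  have injG: "inj_on G ?D"
  proof (rule inj_onI)
    fix f h assume fh: "f \<in> ?D" "h \<in> ?D" "G f = G h"
    show "f = h"
    proof (rule PiE_ext[OF fh(1,2)])
      fix p assume "p \<in> {..<r-1}"
      then have "G g p = g p" for g by (simp add: G_def pre_def)
      then show "f p = h p" using fun_cong[OF fh(3), of p] by metis
    qed
  qed
  have inj: "inj_on (\<lambda>\<sigma>. restrict \<sigma> {..<r-1}) (tuples n r)"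
  proof (rule inj_onI)
    fix \<sigma> \<tau> assume st: "\<sigma> \<in> tuples n r" "\<tau> \<in> tuples n r" "restrict \<sigma> {..<r-1} = restrict \<tau> {..<r-1}"
    have eq: "\<sigma> p = \<tau> p" if "p < r" "p \<noteq> r - 1" for p
    proof -
      have "p < r - 1" using that by simp
      then show ?thesis using fun_cong[OF st(3), of p] by simp
    qed
    show "\<sigma> = \<tau>" by (rule tuples_determined[OF st(1,2), of "r - 1"]) (use r eq in simp_all)
  qed
  have "(\<lambda>\<sigma>. restrict \<sigma> {..<r-1}) ` tuples n r \<subseteq> ?D" by (auto simp: tuples_def)
  then show fin: "finite (tuples n r)"
    using inj by (meson finite_PiE finite_imageD finite_lessThan finite_perms finite_subset)
  have "card ?D \<le> card (tuples n r)"
    using G injG fin by (intro card_inj_on_le[of G]) auto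
  then show "fact n ^ (r - 1) \<le> card (tuples n r)" by (simp add: card_PiE card_perms)
qed

context
  fixes n r :: nat
  assumes n: "n > 0" and r: "r > 0"
begin

lemma cell_less: "p < r \<Longrightarrow> i < n \<Longrightarrow> p * n + i < r * n"
proof -
  assume "p < r" "i < n"
  then have "p * n + i < Suc p * n" by simp
  also have "\<dots> \<le> r * n" using \<open>p < r\<close> by (intro mult_right_mono) auto
  finally show ?thesis .
qed

lemma col_perm_cell:
  assumes "p < r" "i < n"
  shows "col_perm n r \<sigma> (p * n + i) = ((p + 1) mod r) * n + \<sigma> p i"
  using assms cell_less[OF assms] by (simp add: col_perm_def)

lemma cell_cases: "x < r * n \<Longrightarrow> x div n < r \<and> x mod n < n \<and> x = (x div n) * n + x mod n"
  using n by (simp add: less_mult_imp_div_less)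

lemma col_perm_permutes:
  assumes \<sigma>: "\<And>p. p < r \<Longrightarrow> \<sigma> p permutes {..<n}"
  shows "col_perm n r \<sigma> permutes {..<r * n}"
proof (rule bij_imp_permutes)
  have less: "\<sigma> p i < n \<longleftrightarrow> i < n" if "p < r" for p i using permutes_in_image[OF \<sigma>[OF that], of i] by simp
  have inj: "inj_on (col_perm n r \<sigma>) {..<r * n}"
  proof (rule inj_onI)
    fix x y assume xy: "x \<in> {..<r * n}" "y \<in> {..<r * n}" and eq: "col_perm n r \<sigma> x = col_perm n r \<sigma> y"
    define p i q j where "p = x div n" and "i = x mod n" and "q = y div n" and "j = y mod n"
    have x: "p < r" "i < n" "x = p * n + i" and y: "q < r" "j < n" "y = q * n + j"
      using cell_cases xy by (auto simp: p_def i_def q_def j_def)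
    have e: "((p + 1) mod r) * n + \<sigma> p i = ((q + 1) mod r) * n + \<sigma> q j"
      using eq col_perm_cell[OF x(1,2)] col_perm_cell[OF y(1,2)] x(3) y(3) by simp
    have l: "\<sigma> p i < n" "\<sigma> q j < n" using less x y by auto
    have "(p + 1) mod r = (q + 1) mod r" using arg_cong[OF e, of "\<lambda>z. z div n"] l by simp
    then have pq: "p = q" using x(1) y(1) by (auto simp: mod_Suc split: if_splits)
    have "\<sigma> p i = \<sigma> q j" using arg_cong[OF e, of "\<lambda>z. z mod n"] l by simp
    then have "i = j" using pq permutes_inj[OF \<sigma>[OF x(1)]] by (simp add: inj_eq)
    then show "x = y" using x y pq by simp
  qed
  have "col_perm n r \<sigma> ` {..<r * n} \<subseteq> {..<r * n}"
  proof
    fix y assume "y \<in> col_perm n r \<sigma> ` {..<r * n}"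
    then obtain x where x: "x < r * n" "y = col_perm n r \<sigma> x" by auto
    have "\<sigma> (x div n) (x mod n) < n" using less cell_cases[OF x(1)] by auto
    then have "((x div n + 1) mod r) * n + \<sigma> (x div n) (x mod n) < r * n" using r by (intro cell_less) auto
    then show "y \<in> {..<r * n}" using x by (simp add: col_perm_def)
  qed
  then show "bij_betw (col_perm n r \<sigma>) {..<r * n} {..<r * n}"
    using inj by (simp add: bij_betw_def endo_inj_surj)
qed (auto simp: col_perm_def)

lemma col_perm_funpow:
  assumes \<sigma>: "\<And>p. p < r \<Longrightarrow> \<sigma> p permutes {..<n}" and pi: "p < r" "i < n"
  shows "(col_perm n r \<sigma> ^^ k) (p * n + i) = ((p + k) mod r) * n + trace_rows r \<sigma> p k i"
proof (induction k)
  case 0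
  then show ?case using pi by simp
next
  case (Suc k)
  have "trace_rows r \<sigma> p k i < n"
    using permutes_in_image[OF trace_rows_permutes[OF r \<sigma>, where k = k], where x = i] pi by auto
  then have "col_perm n r \<sigma> (((p + k) mod r) * n + trace_rows r \<sigma> p k i)
    = (((p + k) mod r + 1) mod r) * n + \<sigma> ((p + k) mod r) (trace_rows r \<sigma> p k i)"
    using r by (intro col_perm_cell) auto
  moreover have "((p + k) mod r + 1) mod r = (p + Suc k) mod r" by (simp add: mod_Suc_eq)
  ultimately show ?case using Suc by simp
qed

text \<open>A return to column \<open>0\<close> takes \<open>r * t\<close> steps, and
  \<open>t\<close> turns move row \<open>0\<close> to row \<open>t mod n\<close>; so
  \<open>t\<close> would be a multiple of \<open>n\<close>.\<close>

lemma col_perm_cyclic: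
  assumes \<sigma>: "\<sigma> \<in> tuples n r" and j: "1 \<le> j" "j < r * n"
  shows "(col_perm n r \<sigma> ^^ j) 0 \<noteq> 0"
proof
  assume 0: "(col_perm n r \<sigma> ^^ j) 0 = 0"
  have e: "(col_perm n r \<sigma> ^^ j) 0 = (j mod r) * n + trace_rows r \<sigma> 0 j 0"
    using col_perm_funpow[of \<sigma> 0 0 j] tuples_permutes[OF \<sigma>] n r by simp
  then have "j mod r = 0" "trace_rows r \<sigma> 0 j 0 = 0" using 0 n by auto
  then obtain t where t: "j = r * t" by auto
  have "(row_shift n ^^ t) 0 = t mod n" for t
    using n by (induction t) (auto simp: row_shift_def mod_Suc_eq)
  moreover have "trace_rows r \<sigma> 0 (r * t) = row_shift n ^^ t"
    using \<sigma> unfolding trace_rows_power by (simp add: tuples_def)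
  ultimately have "t mod n = 0" using \<open>trace_rows r \<sigma> 0 j 0 = 0\<close> t by simp
  moreover have "0 < t" "t < n" using t j r by (auto simp: mult.commute intro: Suc_leI)
  ultimately show False by simp
qed

lemma col_perm_inj: "inj_on (col_perm n r) (tuples n r)"
proof (rule inj_onI)
  fix \<sigma> \<tau> assume st: "\<sigma> \<in> tuples n r" "\<tau> \<in> tuples n r" "col_perm n r \<sigma> = col_perm n r \<tau>"
  have "\<sigma> p i = \<tau> p i" for p i
  proof (cases "p < r \<and> i < n")
    case True
    then show ?thesis using col_perm_cell[of p i \<sigma>] col_perm_cell[of p i \<tau>] st(3) by simp
  next
    case False
    then show ?thesis
      using permutes_not_in[OF tuples_permutes[OF st(1)], of p i] permutes_not_in[OF tuples_permutes[OF st(2)], of p i] st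
      by (cases "p < r") (auto simp: tuples_def)
  qed
  then show "\<sigma> = \<tau>" by blast
qed

end

text \<open>Exchanging a point of \<open>A\<close> with a point outside before applying
  \<open>s\<close> produces a disjoint copy of the set, of the same size.\<close>

lemma card_perms_image_le:
  assumes A: "A \<subseteq> {..<n}" "A \<noteq> {}" "A \<noteq> {..<n}"
  shows "2 * card {s \<in> perms n. s ` A = B} \<le> fact n"
proof -
  obtain a b where ab: "a \<in> A" "b < n" "b \<notin> A" using A by blast
  define t where "t = transpose a b"
  have t: "t permutes {..<n}" unfolding t_def using ab A by (intro permutes_swap_id) auto
  let ?G = "{s \<in> perms n. s ` A = B}"
  have "card ((\<lambda>s. s \<circ> t) ` ?G) = card ?G"
  proof (rule card_image, rule inj_onI)
    fix s s' assume "s \<circ> t = s' \<circ> t"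
    then have "s \<circ> t \<circ> t = s' \<circ> t \<circ> t" by simp
    then show "s = s'" by (simp add: comp_assoc t_def)
  qed
  moreover have "?G \<inter> (\<lambda>s. s \<circ> t) ` ?G = {}"
  proof -
    have False if s: "s \<in> perms n" "s ` A = B" "(s \<circ> t) ` A = B" for s
    proof -
      have "inj s" using s(1) by (auto simp: perms_def intro: permutes_inj)
      moreover have "s ` (t ` A) = s ` A" using s by (simp add: image_comp)
      ultimately have "t ` A = A" by (simp add: inj_image_eq_iff)
      moreover have "t a = b" by (simp add: t_def)
      ultimately show False using ab by blast
    qed
    then show ?thesis by (intro equals0I) (elim IntE imageE, blast)
  qed
  moreover have "(\<lambda>s. s \<circ> t) ` ?G \<subseteq> perms n"
    using t by (auto simp: perms_def intro: permutes_compose)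
  ultimately have "card ?G + card ?G \<le> card (perms n)"
    by (subst (2) \<open>card ((\<lambda>s. s \<circ> t) ` ?G) = card ?G\<close>[symmetric])
      (subst card_Un_disjoint[symmetric], auto intro!: card_mono)
  then show ?thesis by (simp add: card_perms)
qed

lemma mod_add_inj:
  fixes k l :: nat
  assumes e: "(p + k) mod r = (p + l) mod r" and p: "p < r" "k < r" "l < r"
  shows "k = l"
proof -
  have "(p + j) mod r = (if p + j < r then p + j else p + j - r)" if "j < r" for j
    using that p(1) by (auto simp: mod_if)
  from this[OF p(2)] this[OF p(3)] show ?thesis using e p by (auto split: if_splits)
qed

section \<open>Rectangles on the cylinder: mixed and pure columns\<close>

context
  fixes n r :: nat and U :: "nat set" and S :: "(nat \<Rightarrow> nat \<Rightarrow> nat) set"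
  assumes n: "n > 0" and r: "r > 0" and S: "S \<subseteq> tuples n r"
    and rect: "rectangle (r * n) U (col_perm n r ` S)"
begin

definition "owned p = {i. i < n \<and> p * n + i \<in> U}" for p

lemma owned_subset: "owned p \<subseteq> {..<n}"
  by (auto simp: owned_def)

lemma S_permutes: "\<sigma> \<in> S \<Longrightarrow> p < r \<Longrightarrow> \<sigma> p permutes {..<n}"
  using S tuples_permutes by blast

lemma card_U: "card U = (\<Sum>p<r. card (owned p))"
proof -
  have U: "U \<subseteq> {..<r * n}" using rect by (simp add: rectangle_def)
  have e: "U = (\<Union>p<r. (\<lambda>i. p * n + i) ` owned p)"
  proof
    show "U \<subseteq> (\<Union>p<r. (\<lambda>i. p * n + i) ` owned p)"
    proof
      fix x assume x: "x \<in> U"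
      then have "x < r * n" using U by auto
      note c = cell_cases[OF n r this]
      then have "x mod n \<in> owned (x div n)" using x by (simp add: owned_def)
      then show "x \<in> (\<Union>p<r. (\<lambda>i. p * n + i) ` owned p)" using c
        by (intro UN_I[of "x div n"] image_eqI[of _ _ "x mod n"]) auto
    qed
  qed (auto simp: owned_def)
  have "card (\<Union>p<r. (\<lambda>i. p * n + i) ` owned p) = (\<Sum>p<r. card ((\<lambda>i. p * n + i) ` owned p))"
  proof (rule card_UN_disjoint)
    show "\<forall>p\<in>{..<r}. finite ((\<lambda>i. p * n + i) ` owned p)" by (auto simp: owned_def)
    show "\<forall>p\<in>{..<r}. \<forall>q\<in>{..<r}. p \<noteq> q \<longrightarrow> (\<lambda>i. p * n + i) ` owned p \<inter> (\<lambda>i. q * n + i) ` owned q = {}"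
    proof (intro ballI impI equals0I)
      fix p q x assume pq: "p \<noteq> q" and x: "x \<in> (\<lambda>i. p * n + i) ` owned p \<inter> (\<lambda>i. q * n + i) ` owned q"
      then obtain i where i: "i < n" "x = p * n + i" by (auto simp: owned_def)
      obtain j where j: "j < n" "x = q * n + j" using x by (auto simp: owned_def)
      have "x div n = p" using i by simp
      moreover have "x div n = q" using j by simp
      ultimately show False using pq by simp
    qed
  qed simp
  also have "\<dots> = (\<Sum>p<r. card (owned p))" by (intro sum.cong card_image) (auto simp: inj_on_def)
  finally show ?thesis using e by simp
qed

text \<open>Each column goes to the next one, and distinct columns to distinct columns, so agreement
  on the image of \<open>U\<close> holds column by column.\<close>

lemma owned_image:
  assumes "\<sigma> \<in> S" "\<tau> \<in> S" "p < r"
  shows "\<sigma> p ` owned p \<subseteq> \<tau> p ` owned p"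
proof
  fix j assume "j \<in> \<sigma> p ` owned p"
  then obtain i where i: "i < n" "p * n + i \<in> U" "j = \<sigma> p i" by (auto simp: owned_def)
  have less: "\<rho> q l < n" if "\<rho> \<in> S" "q < r" "l < n" for \<rho> q l
    using permutes_in_image[OF S_permutes[OF that(1,2)], of l] that by simp
  have "col_perm n r \<sigma> ` U = col_perm n r \<tau> ` U"
  proof -
    have "\<forall>\<pi>\<in>col_perm n r ` S. \<forall>\<rho>\<in>col_perm n r ` S. \<pi> ` U = \<rho> ` U"
      using rect unfolding rectangle_def by blast
    then show ?thesis using assms(1,2) by blast
  qed
  then have "col_perm n r \<sigma> (p * n + i) \<in> col_perm n r \<tau> ` U" using i by blast
  then obtain x where x: "x \<in> U" "col_perm n r \<sigma> (p * n + i) = col_perm n r \<tau> x" by auto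
  have xl: "x < r * n" using x rect by (auto simp: rectangle_def)
  define q l where "q = x div n" and "l = x mod n"
  have c: "q < r" "l < n" "x = q * n + l" using cell_cases[OF n r xl] by (auto simp: q_def l_def)
  have e: "((p + 1) mod r) * n + \<sigma> p i = ((q + 1) mod r) * n + \<tau> q l"
    using x(2) col_perm_cell[OF n r assms(3) i(1)] col_perm_cell[OF n r c(1,2)] c(3) by simp
  have l: "\<sigma> p i < n" "\<tau> q l < n" using less assms i c by auto
  have "(p + 1) mod r = (q + 1) mod r" using arg_cong[OF e, of "\<lambda>z. z div n"] l by simp
  then have pq: "p = q" using c(1) assms(3) by (auto simp: mod_Suc split: if_splits)
  have "\<sigma> p i = \<tau> q l" using arg_cong[OF e, of "\<lambda>z. z mod n"] l by simp
  then show "j \<in> \<tau> p ` owned p" using x c pq i(3) by (auto simp: owned_def)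
qed

text \<open>Composing with a transposition across the boundary of \<open>owned p\<close> shows that each mixed column costs a factor \<open>2\<close>.\<close>

lemma many_mixed_columns:
  assumes X: "X \<subseteq> {..<r-1}" "\<And>p. p \<in> X \<Longrightarrow> owned p \<noteq> {} \<and> owned p \<noteq> {..<n}"
  shows "card S * 2 ^ card X \<le> fact n ^ (r - 1)"
proof (cases "S = {}")
  case False
  then obtain \<tau> where \<tau>: "\<tau> \<in> S" by auto
  define G where "G p = {s \<in> perms n. s ` owned p = \<tau> p ` owned p}" for p
  \<comment> \<open>The last column is determined by the others and is dropped. Therefore
    \<open>X\<close> avoids it and the bound has exponent \<open>r - 1\<close>.\<close>
  have "inj_on (\<lambda>\<sigma>. restrict \<sigma> {..<r-1}) S"
  proof (rule inj_onI)
    fix \<sigma> \<rho> assume st: "\<sigma> \<in> S" "\<rho> \<in> S" "restrict \<sigma> {..<r-1} = restrict \<rho> {..<r-1}"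
    have eq: "\<sigma> p = \<rho> p" if "p < r" "p \<noteq> r - 1" for p
    proof -
      have "p < r - 1" using that by simp
      then show ?thesis using fun_cong[OF st(3), of p] by simp
    qed
    show "\<sigma> = \<rho>"
      by (rule tuples_determined[OF subsetD[OF S st(1)] subsetD[OF S st(2)], of "r - 1"]) (use r eq in simp_all)
  qed
  moreover have "(\<lambda>\<sigma>. restrict \<sigma> {..<r-1}) ` S \<subseteq> PiE {..<r-1} G"
  proof (clarify)
    fix \<sigma> assume s: "\<sigma> \<in> S"
    have "\<sigma> p \<in> G p" if "p < r - 1" for p
    proof -
      have "p < r" using that by simp
      then show ?thesis using owned_image[OF s \<tau>] owned_image[OF \<tau> s] S_permutes[OF s] unfolding G_def perms_def by blast
    qed
    then show "restrict \<sigma> {..<r-1} \<in> PiE {..<r-1} G" by auto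
  qed
  ultimately have "card S \<le> card (PiE {..<r-1} G)"
    by (intro card_inj_on_le) (auto intro!: finite_PiE simp: G_def)
  also have "\<dots> = (\<Prod>p<r-1. card (G p))" by (simp add: card_PiE)
  finally have "card S * 2 ^ card X \<le> (\<Prod>p<r-1. card (G p)) * 2 ^ card X" by (rule mult_right_mono) simp
  also have "\<dots> = (\<Prod>p<r-1. card (G p) * (if p \<in> X then 2 else 1))"
  proof -
    have "(2::nat) ^ card X = (\<Prod>p<r-1. if p \<in> X then 2 else 1)"
      using X(1) by (simp add: prod.If_cases Int_absorb1)
    then show ?thesis by (simp only: prod.distrib)
  qed
  also have "\<dots> \<le> (\<Prod>p<r-1. fact n)"
  proof (intro prod_mono conjI)
    fix p assume "p \<in> {..<r-1}"
    show "card (G p) * (if p \<in> X then 2 else 1) \<le> fact n"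
    proof (cases "p \<in> X")
      case True
      then show ?thesis using card_perms_image_le[OF owned_subset, of p "\<tau> p ` owned p"] X(2) by (simp add: G_def mult.commute)
    next
      case False
      then show ?thesis using card_mono[of "perms n" "G p"] by (auto simp: card_perms G_def)
    qed
  qed simp
  finally show ?thesis by simp
qed simp

text \<open>Once all other columns are fixed, columns \<open>p\<close> and \<open>q\<close> range independently over two families of
  permutations, and the composition around the cylinder must not have short cycles.\<close>

lemma two_pure_columns:
  assumes pq: "p < r" "q < r" "owned p = {..<n}" "owned q = {}"
    and Q1: "Q \<ge> 1" and Mn: "M < n"
    and M: "real M \<ge> 96 * (exp 2 * Q) ^ 4 + 8"
    and big: "4 * real M ^ 2 * ln (2 * real n ^ 2) * (2 * (exp 2 * Q)\<^sup>2) ^ M < real n"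
  shows "real (card S) * Q ^ n \<le> fact n ^ (r - 1)"
proof -
  have neq: "p \<noteq> q" using pq n by auto
  define I where "I = {..<r} - {p,q}"
  define fib where "fib \<phi> = {\<sigma> \<in> S. restrict \<sigma> I = \<phi>}" for \<phi>
  have finS: "finite S" using S card_tuples(2)[OF r] finite_subset by blast
  have small: "real (card (fib \<phi>)) \<le> fact n / Q ^ n" for \<phi>
  proof (rule ccontr)
    assume "\<not> ?thesis"
    then have gt: "real (card (fib \<phi>)) > fact n / Q ^ n" by simp
    have "0 < fact n / Q ^ n" using Q1 by simp
    then have "card (fib \<phi>) > 0" using gt by (meson less_trans of_nat_0_less_iff)
    then obtain \<tau> where \<tau>: "\<tau> \<in> fib \<phi>" by (metis card_gt_0_iff ex_in_conv)
    have fibS: "fib \<phi> \<subseteq> S" by (auto simp: fib_def)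
    have agree: "\<sigma> s = \<rho> s" if "\<sigma> \<in> fib \<phi>" "\<rho> \<in> fib \<phi>" "s < r" "s \<noteq> p" "s \<noteq> q" for \<sigma> \<rho> s
    proof -
      have "restrict \<sigma> I = restrict \<rho> I" using that(1,2) by (simp add: fib_def)
      moreover have "s \<in> I" using that by (simp add: I_def)
      ultimately show ?thesis by (metis restrict_apply')
    qed
    \<comment> \<open>Within a fibre the fixed product makes either of the two free entries
      determine the other, so both families are as large as the fibre.\<close>
    have injp: "inj_on (\<lambda>\<sigma>. \<sigma> s) (fib \<phi>)" if s: "s = p \<or> s = q" for s
    proof (rule inj_onI)
      fix \<sigma> \<rho> assume st: "\<sigma> \<in> fib \<phi>" "\<rho> \<in> fib \<phi>" "\<sigma> s = \<rho> s"
      define s' where "s' = (if s = p then q else p)"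
      have eq: "\<sigma> x = \<rho> x" if "x < r" "x \<noteq> s'" for x
        using agree[OF st(1,2) that(1)] that(2) st(3) s by (cases "x = s") (auto simp: s'_def split: if_splits)
      have "\<sigma> \<in> tuples n r" "\<rho> \<in> tuples n r" using st(1,2) S by (auto simp: fib_def)
      then show "\<sigma> = \<rho>"
        by (rule tuples_determined[where q = s']) (use pq eq in \<open>auto simp: s'_def\<close>)
    qed
    \<comment> \<open>The cyclic distance from column \<open>p\<close> forward to column
      \<open>q\<close>; adding \<open>r\<close> avoids truncated subtraction.\<close>
    define d where "d = (q + r - p) mod r"
    have dq: "(p + d) mod r = q"
    proof -
      have "(p + d) mod r = (p + (q + r - p)) mod r" unfolding d_def by (rule mod_add_right_eq)
      also have "p + (q + r - p) = q + r" using pq by simp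
      finally show ?thesis using pq by simp
    qed
    have d: "0 < d" "d < r"
    proof -
      show "d < r" using r by (simp add: d_def)
      show "0 < d" using dq neq pq by (cases d) auto
    qed
    define f1 where "f1 = trace_rows r \<tau> (p + 1) (d - 1)"
    define f2 where "f2 = trace_rows r \<tau> (p + d + 1) (r - d - 1)"
    define A where "A = (\<lambda>\<sigma>. \<sigma> p) ` fib \<phi>"
    define B where "B = (\<lambda>b. f2 \<circ> b \<circ> f1) ` (\<lambda>\<sigma>. \<sigma> q) ` fib \<phi>"
    have \<tau>p: "\<tau> s permutes {..<n}" if "s < r" for s using \<tau> fibS S_permutes that by blast
    have f12: "f1 permutes {..<n}" "f2 permutes {..<n}"
      unfolding f1_def f2_def by (intro trace_rows_permutes r \<tau>p; assumption)+
    have Ap: "a permutes {..<n}" if "a \<in> A" for a using that S_permutes pq fibS by (auto simp: A_def)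
    have Bp: "b permutes {..<n}" if "b \<in> B" for b
      using that S_permutes[OF subsetD[OF fibS] pq(2)] f12 by (auto simp: B_def intro!: permutes_compose)
    have cA: "card A = card (fib \<phi>)" unfolding A_def using injp by (simp add: card_image)
    have "inj_on (\<lambda>b. f2 \<circ> b \<circ> f1) X" for X
    proof (rule inj_onI)
      fix b b' assume "f2 \<circ> b \<circ> f1 = f2 \<circ> b' \<circ> f1"
      then have "b (f1 x) = b' (f1 x)" for x using permutes_inj[OF f12(2)] by (metis comp_apply injD)
      then show "b = b'" using permutes_surj[OF f12(1)] by (metis ext surjD)
    qed
    then have cB: "card B = card (fib \<phi>)" unfolding B_def using injp by (simp add: card_image)
    have "\<exists>a\<in>A. \<exists>b\<in>B. \<exists>u<n. \<exists>t\<in>{2..M}. ((b \<circ> a) ^^ t) u = u"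
      by (rule short_cycle[OF n Ap Bp _ _ Q1 _ _ M big]) (use cA cB gt \<tau> in \<open>auto simp: A_def B_def\<close>)
    then obtain \<sigma> \<rho> u t where st: "\<sigma> \<in> fib \<phi>" "\<rho> \<in> fib \<phi>" and u: "u < n" and t: "t \<in> {2..M}"
      and cyc: "((f2 \<circ> \<rho> q \<circ> f1 \<circ> \<sigma> p) ^^ t) u = u"
      unfolding A_def B_def by (auto simp: comp_assoc)
    \<comment> \<open>The mixture of \<open>\<sigma>\<close> and \<open>\<rho>\<close>: column
      \<open>p\<close> is wholly owned, column \<open>q\<close> not at all, and elsewhere the two
      agree. It need not have the prescribed product, but the rectangle still forbids short
      cycles.\<close>
    define \<omega> where "\<omega> = \<sigma>(q := \<rho> q)"
    have stS: "\<sigma> \<in> S" "\<rho> \<in> S" using st fibS by auto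
    have \<omega>p: "\<omega> s permutes {..<n}" if "s < r" for s using S_permutes[OF stS(1) that] S_permutes[OF stS(2) that] by (auto simp: \<omega>_def)
    have \<omega>\<tau>: "\<omega> s = \<tau> s" if "s < r" "s \<noteq> p" "s \<noteq> q" for s using agree[OF st(1) \<tau> that] that by (simp add: \<omega>_def)
    have mix: "mix U (col_perm n r \<sigma>) (col_perm n r \<rho>) = col_perm n r \<omega>"
    proof
      fix x
      show "mix U (col_perm n r \<sigma>) (col_perm n r \<rho>) x = col_perm n r \<omega> x"
      proof (cases "x < r * n")
        case True
        define s i where "s = x div n" and "i = x mod n"
        have c: "s < r" "i < n" "x = s * n + i" using cell_cases[OF n r True] by (auto simp: s_def i_def)
        have own: "x \<in> U \<longleftrightarrow> i \<in> owned s" using c by (simp add: owned_def)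
        have "(if x \<in> U then \<sigma> s i else \<rho> s i) = \<omega> s i"
        proof -
          consider "s = p" | "s = q" | "s \<noteq> p" "s \<noteq> q" by blast
          then show ?thesis
          proof cases
            case 3
            then show ?thesis using agree[OF st c(1)] by (simp add: \<omega>_def)
          qed (use own pq c neq in \<open>auto simp: \<omega>_def\<close>)
        qed
        moreover have "col_perm n r \<upsilon> x = ((s + 1) mod r) * n + \<upsilon> s i" for \<upsilon>
          using col_perm_cell[OF n r c(1,2), of \<upsilon>] by (simp add: c(3)[symmetric])
        ultimately show ?thesis by (auto simp: mix_def)
      qed (simp add: mix_def col_perm_def)
    qed
    have ne: "(col_perm n r \<omega> ^^ j) x \<noteq> x" if "x < r * n" "1 \<le> j" "j < r * n" for x j
      using rect stS that mix unfolding rectangle_def by (metis imageI)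
    have away: "(p + k) mod r < r \<and> (p + k) mod r \<noteq> p \<and> (p + k) mod r \<noteq> q" if "k < r" "k \<noteq> 0" "k \<noteq> d" for k
      using mod_add_inj[of p k r 0] mod_add_inj[of p k r d] that d dq pq(1) r by auto
    have "trace_rows r \<omega> p r = trace_rows r \<omega> p (1 + (d - 1) + 1 + (r - d - 1))" using d by simp
    also have "\<dots> = trace_rows r \<omega> (p + d + 1) (r - d - 1) \<circ> \<omega> ((p + d) mod r) \<circ> trace_rows r \<omega> (p + 1) (d - 1) \<circ> \<omega> (p mod r)"
      using d by (simp only: trace_rows_add) (simp add: comp_assoc)
    also have "trace_rows r \<omega> (p + 1) (d - 1) = f1"
      unfolding f1_def
    proof (rule trace_rows_cong)
      fix j assume "j < d - 1"
      then have "1 + j < r" "1 + j \<noteq> d" using d by auto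
      then show "\<omega> ((p + 1 + j) mod r) = \<tau> ((p + 1 + j) mod r)"
        using away[of "1 + j"] \<omega>\<tau> by (simp add: add.assoc)
    qed
    also have "trace_rows r \<omega> (p + d + 1) (r - d - 1) = f2"
      unfolding f2_def
    proof (rule trace_rows_cong)
      fix j assume "j < r - d - 1"
      then have "d + 1 + j < r" using d by auto
      then show "\<omega> ((p + d + 1 + j) mod r) = \<tau> ((p + d + 1 + j) mod r)"
        using away[of "d + 1 + j"] \<omega>\<tau> by (simp add: add.assoc)
    qed
    also have "\<omega> ((p + d) mod r) = \<rho> q" using dq by (simp add: \<omega>_def)
    also have "\<omega> (p mod r) = \<sigma> p" using pq neq by (simp add: \<omega>_def)
    finally have R: "trace_rows r \<omega> p r = f2 \<circ> \<rho> q \<circ> f1 \<circ> \<sigma> p" .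
    have "(col_perm n r \<omega> ^^ (r * t)) (p * n + u) = ((p + r * t) mod r) * n + trace_rows r \<omega> p (r * t) u"
      by (rule col_perm_funpow[OF n r \<omega>p pq(1) u])
    also have "trace_rows r \<omega> p (r * t) u = u" unfolding trace_rows_power R by (rule cyc)
    also have "(p + r * t) mod r = p" using pq by simp
    finally have "(col_perm n r \<omega> ^^ (r * t)) (p * n + u) = p * n + u" .
    moreover have "r * t < r * n" "1 \<le> r * t" using t Mn r by auto
    ultimately show False using ne[OF cell_less[OF n r pq(1) u]] by blast
  qed
  have "S \<subseteq> (\<Union>\<phi>\<in>PiE I (\<lambda>_. perms n). fib \<phi>)"
  proof
    fix \<sigma> assume s: "\<sigma> \<in> S"
    then have "restrict \<sigma> I \<in> PiE I (\<lambda>_. perms n)" using S_permutes[OF s] by (auto simp: I_def perms_def)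
    then show "\<sigma> \<in> (\<Union>\<phi>\<in>PiE I (\<lambda>_. perms n). fib \<phi>)" using s by (auto simp: fib_def)
  qed
  then have "card S \<le> card (\<Union>\<phi>\<in>PiE I (\<lambda>_. perms n). fib \<phi>)"
    using finS by (intro card_mono) (auto simp: fib_def I_def intro!: finite_PiE)
  also have "\<dots> \<le> (\<Sum>\<phi>\<in>PiE I (\<lambda>_. perms n). card (fib \<phi>))"
    by (intro card_UN_le finite_PiE) (auto simp: I_def)
  finally have "real (card S) \<le> (\<Sum>\<phi>\<in>PiE I (\<lambda>_. perms n). real (card (fib \<phi>)))"
    by (metis of_nat_le_iff of_nat_sum)
  also have "\<dots> \<le> (\<Sum>\<phi>\<in>PiE I (\<lambda>_. perms n). fact n / Q ^ n)" using small by (intro sum_mono) auto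
  also have "\<dots> = fact n ^ card I * (fact n / Q ^ n)" by (simp add: card_PiE card_perms I_def)
  also have "card I = r - 2" using pq neq by (simp add: I_def card_Diff_subset)
  also have "fact n ^ (r - 2) * (fact n / Q ^ n) = fact n ^ (r - 1) / Q ^ n"
  proof -
    have "r - 1 = Suc (r - 2)" using pq neq by auto
    then show ?thesis by simp
  qed
  finally show ?thesis using Q1 by (simp add: field_simps)
qed

text \<open>Either more than \<open>D\<close> columns are mixed and halving gains
  \<open>2 ^ D\<close>, or fewer than a third are. In the second case the share of \<open>U\<close>,
  between one and two thirds, forces a wholly owned and a wholly unowned column.\<close>

lemma rectangle_small:
  assumes D: "3 * D < r" "Q ^ n \<le> 2 ^ D"
    and Q1: "Q \<ge> 1" and Mn: "M < n"
    and M: "real M \<ge> 96 * (exp 2 * Q) ^ 4 + 8"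
    and big: "4 * real M ^ 2 * ln (2 * real n ^ 2) * (2 * (exp 2 * Q)\<^sup>2) ^ M < real n"
  shows "real (card S) * Q ^ n \<le> fact n ^ (r - 1)"
proof -
  define X where "X = {p. p < r \<and> owned p \<noteq> {} \<and> owned p \<noteq> {..<n}}"
  have fX: "finite X" "X \<subseteq> {..<r}" by (auto simp: X_def)
  show ?thesis
  proof (cases "card X \<le> D")
    case False
    \<comment> \<open>Removing the last column, which cannot be counted, uses up the strictness of
      \<open>D < card X\<close>.\<close>
    have "card (X - {r - 1}) \<ge> D"
      by (cases "r - 1 \<in> X") (use False fX in \<open>auto simp: card_Diff_singleton_if\<close>)
    then have "real (card S) * Q ^ n \<le> real (card S) * 2 ^ card (X - {r - 1})"
      using D(2) by (intro mult_left_mono) (auto intro: order_trans power_increasing)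
    also have "\<dots> \<le> fact n ^ (r - 1)"
    proof -
      have "card S * 2 ^ card (X - {r - 1}) \<le> fact n ^ (r - 1)"
        by (rule many_mixed_columns) (use fX in \<open>auto simp: X_def\<close>)
      then have "real (card S * 2 ^ card (X - {r - 1})) \<le> real (fact n ^ (r - 1))" by (simp only: of_nat_le_iff)
      then show ?thesis by simp
    qed
    finally show ?thesis .
  next
    case True
    have own_le: "card (owned p) \<le> n" for p using card_mono[OF _ owned_subset] by simp
    have bal: "r * n \<le> 3 * card U" "3 * card U \<le> 2 * (r * n)" using rect by (auto simp: rectangle_def)
    have "\<exists>p<r. owned p = {..<n}"
    proof (rule ccontr)
      assume none: "\<not> ?thesis"
      have "card U \<le> (\<Sum>p<r. if p \<in> X then n else 0)"
        unfolding card_U using own_le none by (intro sum_mono) (auto simp: X_def)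
      also have "\<dots> = card X * n" using fX by (simp add: sum.If_cases Int_absorb1)
      also have "\<dots> \<le> D * n" using True by simp
      finally have "3 * card U \<le> (3 * D) * n" by simp
      also have "\<dots> < r * n" using D(1) n by simp
      finally show False using bal by simp
    qed
    moreover have "\<exists>q<r. owned q = {}"
    proof (rule ccontr)
      assume none: "\<not> ?thesis"
      have "(\<Sum>p<r. n) \<le> (\<Sum>p<r. card (owned p) + (if p \<in> X then n else 0))"
        using none by (intro sum_mono) (auto simp: X_def)
      also have "\<dots> = card U + card X * n" using fX by (simp add: card_U sum.distrib sum.If_cases Int_absorb1)
      also have "\<dots> \<le> card U + D * n" using True by simp
      finally have "3 * (r * n) \<le> 3 * card U + (3 * D) * n" by simp
      moreover have "(3 * D) * n < r * n" using D(1) n by simp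
      ultimately show False using bal by linarith
    qed
    ultimately show ?thesis using two_pure_columns[OF _ _ _ _ Q1 Mn M big] by blast
  qed
qed

end

theorem circuit_lower_bound:
  fixes C :: "(nat set, 'n) circuit"
  assumes n: "n \<ge> 2" and r: "r > 0" and D: "3 * D < r" "Q ^ n \<le> 2 ^ D"
    and Q1: "Q \<ge> 1" and Mn: "M < n"
    and M: "real M \<ge> 96 * (exp 2 * Q) ^ 4 + 8"
    and big: "4 * real M ^ 2 * ln (2 * real n ^ 2) * (2 * (exp 2 * Q)\<^sup>2) ^ M < real n"
    and finE: "finite E" and E: "\<And>\<sigma>. \<sigma> \<in> tuples n r \<Longrightarrow> cycle_edges (r * n) (col_perm n r \<sigma>) \<subseteq> E"
    and C: "tropical_circuit E C" and calc: "calculates_TSP C {..<3 * (r * n)} E"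
  shows "Q ^ n \<le> real (card (nodes C))"
proof -
  have n0: "n > 0" using n by simp
  have m: "r * n \<ge> 2" using n r by (metis One_nat_def Suc_leI mult_le_mono nat_mult_1)
  define H where "H = col_perm n r ` tuples n r"
  have H: "\<pi> permutes {..<r * n} \<and>
      (\<exists>us\<in>ham_tours {..<3 * (r * n)} E. tour_edges {..<3 * (r * n)} us = cycle_edges (r * n) \<pi>)" if pi: "\<pi> \<in> H" for \<pi>
  proof -
    obtain \<sigma> where \<sigma>: "\<sigma> \<in> tuples n r" "\<pi> = col_perm n r \<sigma>" using pi by (auto simp: H_def)
    have p: "\<pi> permutes {..<r * n}"
      unfolding \<sigma>(2) using tuples_permutes[OF \<sigma>(1)] by (rule col_perm_permutes[OF n0 r])
    have c: "\<And>j. 1 \<le> j \<Longrightarrow> j < r * n \<Longrightarrow> (\<pi> ^^ j) 0 \<noteq> 0"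
      unfolding \<sigma>(2) by (rule col_perm_cyclic[OF n0 r \<sigma>(1)])
    have e: "cycle_edges (r * n) \<pi> \<subseteq> E" unfolding \<sigma>(2) by (rule E[OF \<sigma>(1)])
    have z: "0 < r * n" using m by linarith
    show ?thesis using p cycle_tour[OF p z c e] by blast
  qed
  have "\<exists>F. H \<subseteq> (\<Union>g\<in>nodes C. F g) \<and>
      (\<forall>g\<in>nodes C. F g \<subseteq> H \<and> (F g = {} \<or> (\<exists>U. rectangle (r * n) U (F g))))"
    by (rule circuit_rectangles[OF C calc finE m H])
  then obtain F where F0: "H \<subseteq> (\<Union>g\<in>nodes C. F g) \<and>
      (\<forall>g\<in>nodes C. F g \<subseteq> H \<and> (F g = {} \<or> (\<exists>U. rectangle (r * n) U (F g))))" by (elim exE)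
  have F: "H \<subseteq> (\<Union>g\<in>nodes C. F g)" "\<And>g. g \<in> nodes C \<Longrightarrow> F g \<subseteq> H"
    "\<And>g. g \<in> nodes C \<Longrightarrow> F g \<noteq> {} \<Longrightarrow> \<exists>U. rectangle (r * n) U (F g)"
    using F0 by auto
  have fC: "finite (nodes C)" using C by (simp add: tropical_circuit_def)
  have fH: "finite H" using card_tuples(2)[OF r] by (simp add: H_def)
  have small: "real (card (F g)) * Q ^ n \<le> fact n ^ (r - 1)" if g: "g \<in> nodes C" for g
  proof (cases "F g = {}")
    case False
    then obtain U where U: "rectangle (r * n) U (F g)" using F(3) g by blast
    define S where "S = {\<sigma> \<in> tuples n r. col_perm n r \<sigma> \<in> F g}"
    have im: "col_perm n r ` S = F g" using F(2)[OF g] by (auto simp: S_def H_def)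
    have "card (F g) = card S"
      unfolding im[symmetric] using col_perm_inj[OF n0 r] by (intro card_image) (auto simp: S_def inj_on_def)
    then show ?thesis
      using rectangle_small[OF n0 r _ _ D Q1 Mn M big, of S U] U im by (auto simp: S_def)
  qed simp
  have "card (tuples n r) = card H" unfolding H_def using col_perm_inj[OF n0 r] by (simp add: card_image)
  also have "\<dots> \<le> card (\<Union>g\<in>nodes C. F g)"
    using F(1,2) fC fH by (intro card_mono) (auto intro: finite_subset)
  also have "\<dots> \<le> (\<Sum>g\<in>nodes C. card (F g))" using fC by (rule card_UN_le)
  finally have "fact n ^ (r - 1) \<le> (\<Sum>g\<in>nodes C. card (F g))" using card_tuples(1)[OF r, of n] by linarith
  then have "real (fact n ^ (r - 1)) \<le> real (\<Sum>g\<in>nodes C. card (F g))" by (simp only: of_nat_le_iff)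
  then have "fact n ^ (r - 1) \<le> (\<Sum>g\<in>nodes C. real (card (F g)))" by simp
  then have "fact n ^ (r - 1) * Q ^ n \<le> (\<Sum>g\<in>nodes C. real (card (F g)) * Q ^ n)"
    using Q1 by (simp add: mult_right_mono flip: sum_distrib_right)
  also have "\<dots> \<le> (\<Sum>g\<in>nodes C. fact n ^ (r - 1))" using small by (intro sum_mono) auto
  finally have "fact n ^ (r - 1) * Q ^ n \<le> fact n ^ (r - 1) * real (card (nodes C))" by (simp add: mult.commute)
  then show ?thesis by (subst (asm) mult_le_cancel_left_pos) auto
qed

section \<open>The graph and the parameters\<close>

text \<open>With \<open>q = (ln n) powr (1/6)\<close> the walk length is of order
  \<open>q ^ 4 = (ln n) powr (2/3)\<close>, so the logarithm of the \<open>M\<close>-th power is of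
  order \<open>(ln n) powr (2/3) * ln (ln n)\<close> and stays below \<open>ln n\<close>.\<close>

lemma parameters_eventually:
  "eventually (\<lambda>n::nat. \<exists>M. 1 \<le> ln (real n) powr (1/6) \<and> M < n \<and>
     real M \<ge> 96 * (exp 2 * (ln (real n) powr (1/6))) ^ 4 + 8 \<and>
     4 * real M ^ 2 * ln (2 * real n ^ 2) * (2 * (exp 2 * (ln (real n) powr (1/6)))\<^sup>2) ^ M < real n \<and>
     ln (real n) powr (1/6) \<le> real n \<and> n \<ge> 2) at_top"
proof -
  define q where "q n = ln (real n) powr (1/6)" for n :: nat
  \<comment> \<open>The constant is \<open>9\<close> instead of \<open>8\<close> to leave room for
    rounding to the natural number \<open>M\<close>.\<close>
  define m where "m n = 96 * (exp 2 * q n) ^ 4 + 9" for n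
  have 1: "eventually (\<lambda>n. 1 \<le> q n) at_top" unfolding q_def by real_asymp
  have 2: "eventually (\<lambda>n. m n < real n) at_top" unfolding m_def q_def by real_asymp
  have 3: "eventually (\<lambda>n. 4 * m n ^ 2 * ln (2 * real n ^ 2) * (2 * (exp 2 * q n)\<^sup>2) powr (m n) < real n) at_top"
    unfolding m_def q_def by real_asymp
  have 4: "eventually (\<lambda>n. q n \<le> real n) at_top" unfolding q_def by real_asymp
  have 5: "eventually (\<lambda>n::nat. n \<ge> 2) at_top" by (rule eventually_ge_at_top)
  show ?thesis
    using 1 2 3 4 5
  proof eventually_elim
    case (elim n)
    define M where "M = nat \<lceil>m n - 1\<rceil>"
    have m0: "m n \<ge> 9" using elim(1) by (simp add: m_def)
    have M: "real M \<ge> m n - 1" "real M \<le> m n" unfolding M_def using m0 by linarith+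
    define b where "b = 2 * (exp 2 * q n)\<^sup>2"
    have b1: "b \<ge> 1"
    proof -
      have "1 * 1 \<le> exp 2 * q n" using elim(1) by (intro mult_mono) auto
      then have "1\<^sup>2 \<le> (exp 2 * q n)\<^sup>2" by (intro power_mono) auto
      then show ?thesis by (simp add: b_def)
    qed
    have "b ^ M = b powr real M" using b1 by (simp add: powr_realpow)
    also have "\<dots> \<le> b powr m n" using M b1 by (intro powr_mono) auto
    finally have bM: "b ^ M \<le> b powr m n" .
    have l: "ln (2 * real n ^ 2) \<ge> 0"
    proof -
      have "1 \<le> real n ^ 2" using elim(5) by (intro one_le_power) simp
      then show ?thesis by (intro ln_ge_zero) simp
    qed
    have "4 * real M ^ 2 * ln (2 * real n ^ 2) * b ^ M \<le> 4 * m n ^ 2 * ln (2 * real n ^ 2) * b powr m n"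
      using M bM l b1 by (intro mult_mono power_mono mult_nonneg_nonneg) auto
    also have "\<dots> < real n" using elim(3) by (simp add: b_def)
    finally have big: "4 * real M ^ 2 * ln (2 * real n ^ 2) * b ^ M < real n" .
    have "real M < real n" using M elim(2) by linarith
    then have "M < n" by simp
    moreover have "real M \<ge> 96 * (exp 2 * q n) ^ 4 + 8" using M(1) by (simp add: m_def)
    ultimately show ?case using big elim(1,4,5) unfolding b_def q_def by blast
  qed
qed

text \<open>The right-hand side is asymptotically \<open>k / 9\<close> times one sixth of
  \<open>log 2 (log 2 k)\<close>, that is, factor \<open>1/54\<close>; the value
  \<open>1/100\<close> absorbs the lower-order terms.\<close>

lemma rate_eventually:
  "eventually (\<lambda>k::nat. real k * log 2 (log 2 (real k)) / 100
     \<le> real (k div 9) * log 2 (ln (real (k div 9)) powr (1/6))) at_top"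
proof -
  have 1: "eventually (\<lambda>k::nat. real k * log 2 (log 2 (real k)) / 100
     \<le> (real k / 9 - 1) * log 2 (ln (real k / 9 - 1) powr (1/6))) at_top"
    by real_asymp
  have 2: "eventually (\<lambda>k::nat. ln (real k / 9 - 1) \<ge> 1) at_top" by real_asymp
  have 3: "eventually (\<lambda>k::nat. real k / 9 - 1 \<ge> 1) at_top" by real_asymp
  show ?thesis
    using 1 2 3
  proof eventually_elim
    case (elim k)
    let ?x = "real k / 9 - 1" and ?n = "real (k div 9)"
    have x: "?x \<le> ?n" by linarith
    have "ln ?x powr (1/6) \<le> ln ?n powr (1/6)" using elim x by (intro powr_mono2 ln_mono) auto
    moreover have "ln ?x powr (1/6) \<ge> 1" using elim by (intro ge_one_powr_ge_zero) auto
    ultimately have "?x * log 2 (ln ?x powr (1/6)) \<le> ?n * log 2 (ln ?n powr (1/6))"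
    proof (intro mult_mono)
      have log: "log 2 a \<le> log 2 b" "0 \<le> log 2 a" if "1 \<le> a" "a \<le> b" for a b :: real
        using that by auto
      show "log 2 (ln ?x powr (1/6)) \<le> log 2 (ln ?n powr (1/6))" "0 \<le> log 2 (ln ?x powr (1/6))"
        using log \<open>ln ?x powr (1/6) \<ge> 1\<close> \<open>ln ?x powr (1/6) \<le> ln ?n powr (1/6)\<close> by blast+
    qed (use elim x in auto)
    then show ?case using elim(1) by linarith
  qed
qed

text \<open>All widths lie between \<open>-1\<close> and \<open>card V\<close>, so the set under
  \<open>Min\<close> is finite and any decomposition gives an upper bound.\<close>

lemma pathwidth_le:
  assumes V: "finite V" and pd: "path_decomposition V E bs" and w: "\<And>b. b \<in> set bs \<Longrightarrow> int (card b) \<le> w + 1"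
  shows "pathwidth V E \<le> w"
proof -
  let ?W = "{int (Max (card ` set bs)) - 1 | bs. path_decomposition V E bs}"
  have "?W \<subseteq> {-1..int (card V)}"
  proof
    fix x assume "x \<in> ?W"
    then obtain cs where cs: "path_decomposition V E cs" "x = int (Max (card ` set cs)) - 1" by auto
    then have ne: "set cs \<noteq> {}" and sub: "\<And>b. b \<in> set cs \<Longrightarrow> b \<subseteq> V" by (auto simp: path_decomposition_def)
    have "Max (card ` set cs) \<le> card V" using ne sub V by (auto intro: card_mono)
    then show "x \<in> {-1..int (card V)}" using cs(2) by simp
  qed
  then have fin: "finite ?W" using finite_subset by blast
  have ne: "set bs \<noteq> {}" using pd by (auto simp: path_decomposition_def)
  have "Max (card ` set bs) \<in> card ` set bs" using ne by (intro Max_in) auto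
  then have "int (Max (card ` set bs)) - 1 \<le> w" using w by force
  moreover have "pathwidth V E \<le> int (Max (card ` set bs)) - 1"
    unfolding pathwidth_def using fin pd by (intro Min_le) auto
  ultimately show ?thesis by simp
qed

text \<open>Serves \<open>k = 1\<close>, where the vertex bound allows at most one vertex and no
  such graph has a tour.\<close>

lemma empty_graph: "ugraph ({} :: nat set) {} \<and> pathwidth ({} :: nat set) {} \<le> 1"
proof -
  have "pathwidth ({}::nat set) {} \<le> 1"
    by (rule pathwidth_le[where bs = "[{}]"]) (auto simp: path_decomposition_def)
  then show ?thesis by (simp add: ugraph_def)
qed

text \<open>Serves the small \<open>k \<ge> 2\<close>, for which only the trivial bound of one gate
  is claimed; three vertices fit below \<open>2 ^ 3\<close>.\<close>

lemma triangle:
  defines "V \<equiv> {0, 1, 2 :: nat}" and "E \<equiv> {{0, 1}, {1, 2}, {2, 0 :: nat}}"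
  shows "ugraph V E" "pathwidth V E \<le> 2" "card V = 3" "ham_tours V E \<noteq> {}"
proof -
  show "card V = 3" by (simp add: V_def)
  show "ugraph V E" by (auto simp: ugraph_def V_def E_def)
  show "pathwidth V E \<le> 2"
    by (rule pathwidth_le[where bs = "[V]"]) (auto simp: path_decomposition_def V_def E_def)
  have "{1..3::nat} = {1,2,3}" by auto
  then have "[0,1,2,0] \<in> ham_tours V E"
    by (simp add: ham_tours_def V_def E_def numeral_3_eq_3 numeral_2_eq_2 insert_commute)
  then show "ham_tours V E \<noteq> {}" by blast
qed

lemma circuit_nonempty: "tropical_circuit E C \<Longrightarrow> card (nodes C) \<ge> 1"
  by (auto simp: tropical_circuit_def Suc_le_eq card_gt_0_iff)

text \<open>\<open>r\<close> columns of \<open>n\<close> cells around a cylinder, consecutive columns being completely joined.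
  Cell \<open>x\<close> consists of the path \<open>3x, 3x+1, 3x+2\<close>, whose middle vertex has degree two; this forces
  every tour to pass straight through the cell.\<close>

definition cyl_edges :: "nat \<Rightarrow> nat \<Rightarrow> nat set set" where
  "cyl_edges n r = forced (r * n) \<union>
     (\<lambda>(x,y). gap x y) ` {(x,y). x < r * n \<and> y < r * n \<and> y div n = (x div n + 1) mod r}"

lemma finite_cyl_edges: "finite (cyl_edges n r)"
proof -
  have "finite {(x,y). x < r * n \<and> y < r * n \<and> y div n = (x div n + 1) mod r}"
    by (rule finite_subset[of _ "{..<r * n} \<times> {..<r * n}"]) auto
  then show ?thesis by (simp add: cyl_edges_def forced_def)
qed

lemma cyl_ugraph: "ugraph {..<3 * (r * n)} (cyl_edges n r)"
proof -
  have "card {3 * x + 2, 3 * y} = 2" for x y :: nat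
  proof -
    have "3 * x + 2 \<noteq> 3 * y" by presburger
    then show ?thesis by simp
  qed
  then show ?thesis by (auto simp: ugraph_def cyl_edges_def forced_def gap_def)
qed

lemma cycle_edges_subset_cyl:
  assumes n: "n > 0" and r: "r > 0" and \<sigma>: "\<sigma> \<in> tuples n r"
  shows "cycle_edges (r * n) (col_perm n r \<sigma>) \<subseteq> cyl_edges n r"
proof -
  have "gap x (col_perm n r \<sigma> x) \<in> cyl_edges n r" if x: "x < r * n" for x
  proof -
    note c = cell_cases[OF n r x]
    have s: "\<sigma> (x div n) (x mod n) < n"
      using permutes_in_image[OF tuples_permutes[OF \<sigma>, of "x div n"], of "x mod n"] c by simp
    have "col_perm n r \<sigma> x < r * n"
      using permutes_in_image[OF col_perm_permutes[OF n r, of \<sigma>], of x] tuples_permutes[OF \<sigma>] x by simp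
    moreover have "col_perm n r \<sigma> x div n = (x div n + 1) mod r"
      using x s by (simp add: col_perm_def)
    ultimately show ?thesis using x unfolding cyl_edges_def by blast
  qed
  then show ?thesis by (auto simp: cycle_edges_def cyl_edges_def)
qed

lemma cyl_ham:
  assumes n: "n > 0" and r: "r > 0"
  shows "ham_tours {..<3 * (r * n)} (cyl_edges n r) \<noteq> {}"
proof -
  have "card (tuples n r) > 0" using card_tuples(1)[OF r, of n] by (meson fact_gt_zero less_le_trans zero_less_power)
  then obtain \<sigma> where \<sigma>: "\<sigma> \<in> tuples n r" by (metis card_gt_0_iff ex_in_conv)
  have p: "col_perm n r \<sigma> permutes {..<r * n}"
    using tuples_permutes[OF \<sigma>] by (rule col_perm_permutes[OF n r])
  have z: "0 < r * n" using n r by simp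
  show ?thesis
    using cycle_tour[OF p z col_perm_cyclic[OF n r \<sigma>] cycle_edges_subset_cyl[OF n r \<sigma>]] by blast
qed

text \<open>Putting column \<open>0\<close> into every bag cuts the cylinder open into a path of
  columns. Three columns of \<open>3 * n\<close> vertices per bag give \<open>9 * n\<close>, whence
  the later choice \<open>n = k div 9\<close>.\<close>

lemma cyl_pathwidth:
  assumes n: "n > 0" and r: "r > 0" and k: "9 * n \<le> k"
  shows "pathwidth {..<3 * (r * n)} (cyl_edges n r) \<le> int k"
proof -
  define V where "V = {..<3 * (r * n)}"
  define col where "col v = v div 3 div n" for v
  define bag where "bag p = {v \<in> V. col v \<in> {0, p, p + 1}}" for p
  define bs where "bs = map bag [0..<r]"
  have col_less: "col v < r" if "v \<in> V" for v
    using that n by (simp add: col_def V_def less_mult_imp_div_less)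
  have nth: "bs ! i = bag i" if "i < r" for i using that by (simp add: bs_def)
  have cell: "(3 * x) div 3 = x" "(3 * x + 1) div 3 = x" "(3 * x + 2) div 3 = x" "Suc (Suc (3 * x)) div 3 = x"
    for x :: nat by auto
  have bag_in: "bag p \<in> set bs" if "p < r" for p using that by (simp add: bs_def)
  have inV: "3 * x \<in> V" "3 * x + 1 \<in> V" "3 * x + 2 \<in> V" if "x < r * n" for x
    using that by (auto simp: V_def)
  have pd: "path_decomposition V (cyl_edges n r) bs"
    unfolding path_decomposition_def
  proof (intro conjI)
    show "bs \<noteq> []" using r by (simp add: bs_def)
    show "\<Union>(set bs) = V"
    proof
      show "V \<subseteq> \<Union>(set bs)"
      proof
        fix v assume v: "v \<in> V"
        then have "v \<in> bag (col v)" by (simp add: bag_def)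
        then show "v \<in> \<Union>(set bs)" using col_less[OF v] by (auto simp: bs_def)
      qed
    qed (auto simp: bs_def bag_def)
    show "\<forall>e\<in>cyl_edges n r. \<exists>b\<in>set bs. e \<subseteq> b"
    proof
      fix e assume "e \<in> cyl_edges n r"
      then consider x where "x < r * n" "e = {3 * x, 3 * x + 1} \<or> e = {3 * x + 1, 3 * x + 2}"
        | x y where "x < r * n" "y < r * n" "y div n = (x div n + 1) mod r" "e = {3 * x + 2, 3 * y}"
        unfolding cyl_edges_def forced_def gap_def by blast
      then show "\<exists>b\<in>set bs. e \<subseteq> b"
      proof cases
        case 1
        have p: "x div n < r" using 1 cell_cases[OF n r] by blast
        have "e \<subseteq> bag (x div n)" using 1 inV[OF 1(1)] by (auto simp: bag_def col_def cell simp del: One_nat_def)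
        then show ?thesis using bag_in[OF p] by blast
      next
        case 2
        have p: "x div n < r" using 2 cell_cases[OF n r] by blast
        have "(x div n + 1) mod r \<in> {0, x div n, x div n + 1}"
          using p by (auto simp: mod_Suc)
        then have "3 * y \<in> bag (x div n)" using 2 inV(1)[OF 2(2)] by (simp add: bag_def col_def)
        moreover have "3 * x + 2 \<in> bag (x div n)" using inV(3)[OF 2(1)] by (simp add: bag_def col_def cell)
        ultimately have "e \<subseteq> bag (x div n)" unfolding 2(4) by simp
        then show ?thesis using bag_in[OF p] by (rule bexI)
      qed
    qed
    show "\<forall>v i j l. i \<le> j \<and> j \<le> l \<and> l < length bs \<and> v \<in> bs ! i \<and> v \<in> bs ! l \<longrightarrow> v \<in> bs ! j"
    proof (intro allI impI)
      fix v i j l assume h: "i \<le> j \<and> j \<le> l \<and> l < length bs \<and> v \<in> bs ! i \<and> v \<in> bs ! l"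
      then have l: "l < r" "i < r" "j < r" by (auto simp: bs_def)
      then have "v \<in> V" "col v \<in> {0, i, i + 1}" "col v \<in> {0, l, l + 1}" using h nth by (auto simp: bag_def)
      then have "v \<in> bag j" using h by (auto simp: bag_def)
      then show "v \<in> bs ! j" using nth l by simp
    qed
  qed
  have bagc: "card (bag p) \<le> 9 * n" for p
  proof -
    have c: "{v. col v = c} \<subseteq> {3 * n * c ..< 3 * n * c + 3 * n}" for c
    proof
      fix v assume "v \<in> {v. col v = c}"
      then have "v div (3 * n) = c" by (simp add: col_def div_mult2_eq)
      moreover have "v = 3 * n * (v div (3 * n)) + v mod (3 * n)" by simp
      moreover have "v mod (3 * n) < 3 * n" using n by simp
      ultimately show "v \<in> {3 * n * c ..< 3 * n * c + 3 * n}" by auto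
    qed
    have f: "finite {v. col v = c}" "card {v. col v = c} \<le> 3 * n" for c
      using finite_subset[OF c[of c]] card_mono[OF _ c[of c]] by auto
    have "bag p \<subseteq> {v. col v = 0} \<union> ({v. col v = p} \<union> {v. col v = p + 1})" by (auto simp: bag_def)
    then have "card (bag p) \<le> card ({v. col v = 0} \<union> ({v. col v = p} \<union> {v. col v = p + 1}))"
      using f(1) by (intro card_mono) auto
    also have "\<dots> \<le> card {v. col v = 0} + (card {v. col v = p} + card {v. col v = p + 1})"
      by (meson add_left_mono card_Un_le order_trans)
    also have "\<dots> \<le> 3 * n + (3 * n + 3 * n)" using f(2) by (intro add_mono) auto
    finally show ?thesis by simp
  qed
  have "pathwidth V (cyl_edges n r) \<le> int k"
  proof (rule pathwidth_le[OF _ pd])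
    show "finite V" by (simp add: V_def)
    fix b assume "b \<in> set bs"
    then obtain p where "b = bag p" by (auto simp: bs_def)
    then have "card b \<le> k" using bagc[of p] k by simp
    then show "int (card b) \<le> int k + 1" by simp
  qed
  then show ?thesis by (simp add: V_def)
qed

lemma large_width_graph:
  assumes n: "n = k div 9" "n \<ge> 2" and q: "q = ln (real n) powr (1/6)" "1 \<le> q" "q \<le> real n"
    and M: "M < n" "real M \<ge> 96 * (exp 2 * q) ^ 4 + 8"
      "4 * real M ^ 2 * ln (2 * real n ^ 2) * (2 * (exp 2 * q)\<^sup>2) ^ M < real n"
    and f: "f \<le> real n * log 2 q"
  shows "\<exists>(V::nat set) E. ugraph V E \<and> pathwidth V E \<le> int k \<and> real (card V) \<le> real k powr 3 \<and>
    ham_tours V E \<noteq> {} \<and>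
    (\<forall>C::(nat set, nat) circuit. tropical_circuit E C \<and> calculates_TSP C V E \<longrightarrow> real (card (nodes C)) \<ge> 2 powr f)"
proof -
  \<comment> \<open>From \<open>q \<le> n \<le> 2 ^ n\<close> it follows that
    \<open>q ^ n \<le> 2 ^ (n * n)\<close>, so \<open>n * n\<close> halvings are enough. Then
    \<open>3 * r * n\<close> is cubic in \<open>n\<close>, which is the origin of the exponent
    \<open>3\<close>.\<close>
  define D where "D = n * n"
  define r where "r = 3 * D + 1"
  have n0: "n > 0" and r0: "r > 0" using n by (auto simp: r_def)
  have k9: "9 * n \<le> k" unfolding n(1) by simp
  let ?V = "{..<3 * (r * n)}" and ?E = "cyl_edges n r"
  have card: "real (card ?V) \<le> real k powr 3"
  proof -
    have "1 \<le> n * n" using n0 by (metis One_nat_def Suc_leI nat_0_less_mult_iff)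
    then have "r \<le> 4 * (n * n)" by (simp add: r_def D_def)
    then have "3 * (r * n) \<le> 3 * (4 * (n * n) * n)" by (intro mult_left_mono mult_right_mono) auto
    also have "\<dots> \<le> (9 * n) ^ 3" by (simp add: power3_eq_cube)
    also have "\<dots> \<le> k ^ 3" using k9 by (rule power_mono) simp
    finally have "real (3 * (r * n)) \<le> real (k ^ 3)" by (simp only: of_nat_le_iff)
    moreover have "real k powr 3 = real k ^ 3" using k9 n0 powr_realpow[of "real k" 3] by simp
    ultimately show ?thesis by simp
  qed
  have bound: "2 powr f \<le> real (card (nodes C))"
    if C: "tropical_circuit ?E C" "calculates_TSP C ?V ?E" for C :: "(nat set, nat) circuit"
  proof -
    have qD: "q ^ n \<le> 2 ^ D"
    proof -
      have "real n \<le> 2 ^ n" using of_nat_less_two_power[of n, where 'a = real] by simp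
      then have "q \<le> 2 ^ n" using q(3) by linarith
      then have "q ^ n \<le> (2 ^ n) ^ n" using q(2) by (intro power_mono) linarith+
      then show ?thesis by (simp add: D_def power_mult)
    qed
    have "q ^ n \<le> real (card (nodes C))"
      using circuit_lower_bound[OF n(2) r0 _ qD q(2) M finite_cyl_edges _ C] cycle_edges_subset_cyl[OF n0 r0]
      by (simp add: r_def)
    moreover have "2 powr f \<le> q ^ n"
    proof -
      have "2 powr f \<le> 2 powr (real n * log 2 q)" using f by (intro powr_mono) auto
      also have "\<dots> = (2 powr (log 2 q)) powr real n" by (simp add: powr_powr mult.commute)
      also have "\<dots> = q ^ n" using q(2) by (simp add: powr_realpow)
      finally show ?thesis .
    qed
    ultimately show ?thesis by linarith
  qed
  show ?thesis
    using cyl_ugraph cyl_pathwidth[OF n0 r0 k9] card cyl_ham[OF n0 r0] bound by blast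
qed

theorem theorem1p3:
  "\<exists>c::real. c > 0 \<and> (\<exists>f::nat \<Rightarrow> real. (\<forall>k. f k \<ge> 0) \<and>
     f \<in> \<Omega>(\<lambda>k. real k * log 2 (log 2 (real k))) \<and>
     (\<forall>k\<ge>1. \<exists>(V::nat set) (E::nat set set).
        ugraph V E \<and> pathwidth V E \<le> int k \<and> real (card V) \<le> real k powr c \<and>
        (k \<ge> 2 \<longrightarrow> ham_tours V E \<noteq> {}) \<and>
        (\<forall>C::(nat set, nat) circuit. tropical_circuit E C \<and> calculates_TSP C V E \<longrightarrow>
           real (card (nodes C)) \<ge> 2 powr f k)))"
proof -
  define g where "g k = real k * log 2 (log 2 (real k)) / 100" for k :: nat
  have "filterlim (\<lambda>k::nat. k div 9) at_top at_top"
  proof (subst filterlim_at_top, intro allI)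
    fix Z :: nat
    show "eventually (\<lambda>k. Z \<le> k div 9) at_top"
      using eventually_ge_at_top[of "9 * Z"] by eventually_elim simp
  qed
  note params = eventually_compose_filterlim[OF parameters_eventually this]
  have pos: "eventually (\<lambda>k. g k \<ge> 0) at_top" unfolding g_def by real_asymp
  have "eventually (\<lambda>k. (\<exists>M. 1 \<le> ln (real (k div 9)) powr (1/6) \<and> M < k div 9 \<and>
     real M \<ge> 96 * (exp 2 * (ln (real (k div 9)) powr (1/6))) ^ 4 + 8 \<and>
     4 * real M ^ 2 * ln (2 * real (k div 9) ^ 2) * (2 * (exp 2 * (ln (real (k div 9)) powr (1/6)))\<^sup>2) ^ M < real (k div 9) \<and>
     ln (real (k div 9)) powr (1/6) \<le> real (k div 9) \<and> k div 9 \<ge> 2)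
     \<and> g k \<le> real (k div 9) * log 2 (ln (real (k div 9)) powr (1/6)) \<and> g k \<ge> 0) at_top"
    (is "eventually ?P at_top")
    using params rate_eventually[folded g_def] pos by eventually_elim blast
  then obtain K where K: "\<And>k. k \<ge> K \<Longrightarrow> ?P k" by (auto simp: eventually_at_top_linorder)
  \<comment> \<open>Below the threshold \<open>K\<close> the claimed bound is
    \<open>2 powr 0\<close>, met by any circuit because it has a node; the order of growth is
    unaffected.\<close>
  define f where "f k = (if k \<ge> K then g k else 0)" for k
  have f0: "f k \<ge> 0" for k using K[of k] by (simp add: f_def)
  have "f \<in> \<Omega>(\<lambda>k. real k * log 2 (log 2 (real k)))"
  proof (rule landau_omega.bigI[of "1/100"])
    show "eventually (\<lambda>k. norm (f k) \<ge> 1/100 * norm (real k * log 2 (log 2 (real k)))) at_top"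
      using eventually_ge_at_top[of K] by eventually_elim (simp add: f_def g_def abs_mult)
  qed simp
  moreover have "\<exists>(V::nat set) (E::nat set set).
        ugraph V E \<and> pathwidth V E \<le> int k \<and> real (card V) \<le> real k powr 3 \<and>
        (k \<ge> 2 \<longrightarrow> ham_tours V E \<noteq> {}) \<and>
        (\<forall>C::(nat set, nat) circuit. tropical_circuit E C \<and> calculates_TSP C V E \<longrightarrow>
           real (card (nodes C)) \<ge> 2 powr f k)" if k: "k \<ge> 1" for k
  proof (cases "k \<ge> K")
    case True
    from K[OF True] obtain M where M: "1 \<le> ln (real (k div 9)) powr (1/6)" "M < k div 9"
      "real M \<ge> 96 * (exp 2 * (ln (real (k div 9)) powr (1/6))) ^ 4 + 8"
      "4 * real M ^ 2 * ln (2 * real (k div 9) ^ 2) * (2 * (exp 2 * (ln (real (k div 9)) powr (1/6)))\<^sup>2) ^ M < real (k div 9)"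
      "ln (real (k div 9)) powr (1/6) \<le> real (k div 9)" "k div 9 \<ge> 2"
      "g k \<le> real (k div 9) * log 2 (ln (real (k div 9)) powr (1/6))" by blast
    show ?thesis
      using large_width_graph[OF refl M(6) refl M(1,5,2,3,4,7)] True by (simp add: f_def) blast
  next
    case False
    have one: "real (card (nodes C)) \<ge> 2 powr f k" if "tropical_circuit E C" for E and C :: "(nat set, nat) circuit"
      using circuit_nonempty[OF that] False by (simp add: f_def)
    show ?thesis
    proof (cases "k = 1")
      case True
      show ?thesis using empty_graph one True by (intro exI[of _ "{}"]) auto
    next
      case k1: False
      then have k2: "k \<ge> 2" using k by simp
      have "(3::real) \<le> 2 powr 3" by (simp add: powr_numeral)
      also have "\<dots> \<le> real k powr 3" using k2 by (intro powr_mono2) auto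
      finally have "real (card {0, 1, 2 :: nat}) \<le> real k powr 3" by simp
      moreover have "pathwidth {0, 1, 2 :: nat} {{0, 1}, {1, 2}, {2, 0}} \<le> int k" using triangle(2) k2 by linarith
      ultimately show ?thesis using triangle(1,4) one by blast
    qed
  qed
  ultimately show ?thesis using f0 by (intro exI[of _ "3::real"] conjI exI[of _ f]) auto
qed

end
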